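(* There exist a nonatomic standard probability space $(X,\mu)$ and an invertible measure-preserving transformation $T$ of $(X,\mu)$ which is mixing and such that the infinite product $T\otimes T^2\otimes T^3\otimes\cdots$ has simple spectrum.
   Context: A measure-preserving transformation $T$ of a probability space $(X,\mu)$ is mixing if $\mu(T^nA\cap B)\to\mu(A)\mu(B)$ as $n\to\infty$ for all measurable sets $A,B$. The infinite product $T\otimes T^2\otimes T^3\otimes\cdots$ is the measure-preserving transformation $(x_1,x_2,x_3,\dots)\mapsto(Tx_1,T^2x_2,T^3x_3,\dots)$ of the countable product space $(X^{\mathbb N},\mu^{\otimes\mathbb N})$. An invertible measure-preserving transformation $R$ of a probability space $(Y,\nu)$ is said to have simple spectrum if its Koopman unitary operator $U_R$ on $L_2(Y,\nu)$, $U_Rg=g\circ R$, has a cyclic vector, i.e. there is $g\in L_2(Y,\nu)$ such that the closed linear span of $\{U_R^k g: k\in\mathbb Z\}$ is all of $L_2(Y,\nu)$. *)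

theory Defs
  imports "HOL-Probability.Probability"
begin

definition standard_borel_space :: "'a measure \<Rightarrow> bool" where
  "standard_borel_space M \<longleftrightarrow>
     (\<exists>X. topspace X = space M \<and> completely_metrizable_space X \<and> second_countable X \<and>
          sets M = sigma_sets (space M) {U. openin X U})"

definition standard_prob_space :: "'a measure \<Rightarrow> bool" where
  "standard_prob_space M \<longleftrightarrow> prob_space M \<and> standard_borel_space M"

definition nonatomic :: "'a measure \<Rightarrow> bool" where
  "nonatomic M \<longleftrightarrow>
     (\<forall>A\<in>sets M. 0 < measure M A \<longrightarrow>
        (\<exists>B\<in>sets M. B \<subseteq> A \<and> 0 < measure M B \<and> measure M B < measure M A))"

definition measure_preserving_map :: "'a measure \<Rightarrow> ('a \<Rightarrow> 'a) \<Rightarrow> bool" where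
  "measure_preserving_map M T \<longleftrightarrow> T \<in> measurable M M \<and> distr M M T = M"

definition invertible_mpt :: "'a measure \<Rightarrow> ('a \<Rightarrow> 'a) \<Rightarrow> bool" where
  "invertible_mpt M T \<longleftrightarrow>
     measure_preserving_map M T \<and> bij_betw T (space M) (space M) \<and>
     the_inv_into (space M) T \<in> measurable M M"

text \<open>The forward images below are measurable sets when \<open>T\<close> satisfies \<^const>\<open>invertible_mpt\<close>.\<close>

definition mixing :: "'a measure \<Rightarrow> ('a \<Rightarrow> 'a) \<Rightarrow> bool" where
  "mixing M T \<longleftrightarrow>
     (\<forall>A\<in>sets M. \<forall>B\<in>sets M.
        (\<lambda>n. measure M ((T ^^ n) ` A \<inter> B)) \<longlonglongrightarrow> measure M A * measure M B)"

text \<open>Coordinates are indexed from 0, so coordinate \<open>i\<close> carries the power \<open>Suc i\<close>.\<close>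

definition countable_power :: "'a measure \<Rightarrow> (nat \<Rightarrow> 'a) measure" where
  "countable_power M = (\<Pi>\<^sub>M i\<in>UNIV. M)"

definition product_of_powers :: "('a \<Rightarrow> 'a) \<Rightarrow> (nat \<Rightarrow> 'a) \<Rightarrow> (nat \<Rightarrow> 'a)" where
  "product_of_powers T x = (\<lambda>i. (T ^^ Suc i) (x i))"

text \<open>Elements of complex \<open>L\<^sub>2\<close> are represented by square-integrable functions rather than by
  classes of functions equal almost everywhere; \<open>l2_norm\<close> is accordingly a seminorm, and
  closures with respect to it are closed under almost-everywhere equality.\<close>

definition l2_space :: "'a measure \<Rightarrow> ('a \<Rightarrow> complex) set" where
  "l2_space M = {f \<in> borel_measurable M. integrable M (\<lambda>x. (cmod (f x))\<^sup>2)}"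

definition l2_norm :: "'a measure \<Rightarrow> ('a \<Rightarrow> complex) \<Rightarrow> real" where
  "l2_norm M f = sqrt (\<integral>x. (cmod (f x))\<^sup>2 \<partial>M)"

definition linear_span :: "('a \<Rightarrow> complex) set \<Rightarrow> ('a \<Rightarrow> complex) set" where
  "linear_span S = {(\<lambda>x. \<Sum>h\<in>F. c h * h x) | F c. finite F \<and> F \<subseteq> S}"

definition l2_closure :: "'a measure \<Rightarrow> ('a \<Rightarrow> complex) set \<Rightarrow> ('a \<Rightarrow> complex) set" where
  "l2_closure M S =
     {f \<in> l2_space M. \<forall>\<epsilon>>0. \<exists>h\<in>S. l2_norm M (\<lambda>x. f x - h x) < \<epsilon>}"

definition koopman :: "('a \<Rightarrow> 'a) \<Rightarrow> ('a \<Rightarrow> complex) \<Rightarrow> ('a \<Rightarrow> complex)" where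
  "koopman R g = g \<circ> R"

text \<open>The inverse of the Koopman operator of \<open>R\<close> is the Koopman operator of the inverse of \<open>R\<close>.\<close>

definition koopman_power ::
  "'a measure \<Rightarrow> ('a \<Rightarrow> 'a) \<Rightarrow> int \<Rightarrow> ('a \<Rightarrow> complex) \<Rightarrow> ('a \<Rightarrow> complex)" where
  "koopman_power M R k =
     (if 0 \<le> k then koopman R ^^ nat k
      else koopman (the_inv_into (space M) R) ^^ nat (- k))"

definition cyclic_vector :: "'a measure \<Rightarrow> ('a \<Rightarrow> 'a) \<Rightarrow> ('a \<Rightarrow> complex) \<Rightarrow> bool" where
  "cyclic_vector M R g \<longleftrightarrow>
     g \<in> l2_space M \<and>
     l2_closure M (linear_span (range (\<lambda>k. koopman_power M R k g))) = l2_space M"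

definition simple_spectrum :: "'a measure \<Rightarrow> ('a \<Rightarrow> 'a) \<Rightarrow> bool" where
  "simple_spectrum M R \<longleftrightarrow> invertible_mpt M R \<and> (\<exists>g. cyclic_vector M R g)"

end

theory Submission
  imports Defs "HOL-Probability.Hoeffding" "HOL-Real_Asymp.Real_Asymp"
begin

text \<open>
  \<open>T\<close> is the shift of a stationary Gaussian sequence whose spectral measure \<open>\<sigma>\<close> is carried by
  infinitesimally small cells with the following two properties. The Fourier coefficients of \<open>\<sigma>\<close>
  tend to \<open>0\<close>, which makes the shift mixing. The cells are rationally independent in a quantitative
  way, as in Rudin's construction of independent sets carrying measures with vanishing Fourier
  coefficients: cells are split by random points, Hoeffding's inequality controls the Fourier
  coefficients and a union bound the integer relations. Only the atomic approximations
  \<open>1/N\<^sub>L \<Sum>\<^sub>c \<delta>(a\<^sub>L c)\<close> of \<open>\<sigma>\<close> occur below, never \<open>\<sigma>\<close> itself.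

  The \<open>L\<^sub>2\<close> space of the product is a symmetric Fock space: normalised exponentials
  \<open>G\<^sub>x = exp(\<bar>x\<bar>\<^sup>2/2 + i x)\<close> of Gaussian variables have Gram matrix \<open>exp\<langle>x, x'\<rangle>\<close>, the limit of
  \<open>\<Prod>\<^sub>c (1 + p\<^sub>c/N\<^sub>L)\<close>. Expanding the product turns norms into sums over configurations \<open>\<kappa>\<close>, which
  attach to each cell \<open>c\<close> an integer, \<open>0\<close> for no particle and \<open>\<plusminus>(j + 1)\<close> for a particle of
  coordinate \<open>j\<close> at frequency \<open>\<plusminus>a\<^sub>c\<close>. Since coordinate \<open>j\<close> moves under \<open>T\<^bsup>j+1\<^esup>\<close>, the product
  transformation multiplies the component \<open>\<kappa>\<close> by \<open>exp(2\<pi>i \<Sum>\<^sub>c \<kappa>\<^sub>c a\<^sub>c)\<close>. By independence these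
  eigenvalues determine \<open>\<kappa>\<close>, so trigonometric polynomials in them carry a vector with all components
  nonzero, such as \<open>exp(i \<Sum>\<^sub>j 2\<^bsup>-(j+1)\<^esup> Y\<^sub>j)\<close>, arbitrarily close to every other exponential.
\<close>

section \<open>Trigonometric polynomials and bounded limits of exponentials\<close>

text \<open>Two requirements pull against each other: decaying Fourier coefficients ask for many
  points in wide cells, independence for thin cells. Random splitting reconciles them because, for
  bounded complexity, the number of integer relations is polynomial in the number \<open>P\<close>
  of points. A width that is a slightly larger negative power of \<open>P\<close> makes all of them
  fail with a margin, and it leaves only polynomially many frequencies to control, against a
  Hoeffding bound exponentially small in \<open>P\<close>. Independence is needed across
  coordinates: coordinate j turns the frequency a into (j + 1) a, so different coordinates could
  share eigenvalues. Up to a given complexity, the only ambiguity left is that of several particles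
  in one cell, whose labels merely add; the weight of such configurations is of order
  \<open>1 / N k\<close>. The trigonometric polynomial is chosen once, at a level k, with an error
  bound uniform in the finer level L and in the number K of coordinates. Only afterwards does L tend
  to infinity, which recovers the Gaussian norms, and then K, which recovers the infinite
  product.\<close>

definition trig_poly_fun :: "(complex \<Rightarrow> complex) \<Rightarrow> bool" where
  "trig_poly_fun p \<longleftrightarrow>
     (\<exists>A c. finite A \<and> (\<forall>z. cmod z = 1 \<longrightarrow> p z = (\<Sum>k\<in>A. c k * z powi (k::int))))"

lemma trig_poly_fun_add:
  assumes "trig_poly_fun p" "trig_poly_fun q"
  shows "trig_poly_fun (\<lambda>z. p z + q z)"
proof -
  obtain A c where A: "finite A" "\<And>z. cmod z = 1 \<Longrightarrow> p z = (\<Sum>k\<in>A. c k * z powi (k::int))"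
    using assms(1) unfolding trig_poly_fun_def by blast
  obtain B d where B: "finite B" "\<And>z. cmod z = 1 \<Longrightarrow> q z = (\<Sum>k\<in>B. d k * z powi (k::int))"
    using assms(2) unfolding trig_poly_fun_def by blast
  define a b where "a = (\<lambda>k. if k \<in> A then c k else 0)" and "b = (\<lambda>k. if k \<in> B then d k else 0)"
  have "p z + q z = (\<Sum>k\<in>A \<union> B. (a k + b k) * z powi k)" if "cmod z = 1" for z
  proof -
    have "(\<Sum>k\<in>A \<union> B. (a k + b k) * z powi k)
        = (\<Sum>k\<in>A \<union> B. a k * z powi k) + (\<Sum>k\<in>A \<union> B. b k * z powi k)"
      by (simp add: sum.distrib ring_distribs)
    also have "(\<Sum>k\<in>A \<union> B. a k * z powi k) = (\<Sum>k\<in>A. c k * z powi k)"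
      by (rule sum.mono_neutral_cong_right) (use A B in \<open>auto simp: a_def\<close>)
    also have "(\<Sum>k\<in>A \<union> B. b k * z powi k) = (\<Sum>k\<in>B. d k * z powi k)"
      by (rule sum.mono_neutral_cong_right) (use A B in \<open>auto simp: b_def\<close>)
    finally show ?thesis using A(2) B(2) that by simp
  qed
  then show ?thesis
    unfolding trig_poly_fun_def using A(1) B(1)
    by (intro exI[of _ "A \<union> B"] exI[of _ "\<lambda>k. a k + b k"]) auto
qed

lemma trig_poly_fun_monomial: "trig_poly_fun (\<lambda>z. c * z powi k)"
  unfolding trig_poly_fun_def by (intro exI[of _ "{k}"] exI[of _ "\<lambda>_. c"]) auto

lemma trig_poly_fun_cong:
  assumes "trig_poly_fun p" "\<And>z. cmod z = 1 \<Longrightarrow> q z = p z"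
  shows "trig_poly_fun q"
  using assms unfolding trig_poly_fun_def by auto

lemma trig_poly_fun_sum:
  assumes "\<And>i. i \<in> I \<Longrightarrow> trig_poly_fun (p i)"
  shows "trig_poly_fun (\<lambda>z. \<Sum>i\<in>I. p i z)"
  using assms
proof (induction I rule: infinite_finite_induct)
  case (insert x F)
  then show ?case by (simp add: trig_poly_fun_add)
qed (use trig_poly_fun_monomial[of 0] in auto)

lemma trig_poly_fun_mult:
  assumes "trig_poly_fun p" "trig_poly_fun q"
  shows "trig_poly_fun (\<lambda>z. p z * q z)"
proof -
  obtain A c where A: "finite A" "\<And>z. cmod z = 1 \<Longrightarrow> p z = (\<Sum>k\<in>A. c k * z powi (k::int))"
    using assms(1) unfolding trig_poly_fun_def by blast
  obtain B d where B: "finite B" "\<And>z. cmod z = 1 \<Longrightarrow> q z = (\<Sum>k\<in>B. d k * z powi (k::int))"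
    using assms(2) unfolding trig_poly_fun_def by blast
  have "trig_poly_fun (\<lambda>z. \<Sum>k\<in>A. \<Sum>l\<in>B. (c k * d l) * z powi (k + l))"
    by (intro trig_poly_fun_sum trig_poly_fun_monomial)
  then show ?thesis
  proof (rule trig_poly_fun_cong)
    fix z :: complex assume z: "cmod z = 1"
    then have "z \<noteq> 0" by auto
    then show "p z * q z = (\<Sum>k\<in>A. \<Sum>l\<in>B. (c k * d l) * z powi (k + l))"
      using A(2)[OF z] B(2)[OF z]
      by (simp add: sum_product power_int_add mult_ac)
  qed
qed

text \<open>On the circle \<open>Re z\<close> and \<open>Im z\<close> are combinations of
  \<open>z\<close> and its inverse \<open>cnj z\<close>, and a real-linear \<open>f\<close> is
  determined by \<open>f 1\<close> and \<open>f \<i>\<close>.\<close>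

lemma trig_poly_fun_linear:
  fixes f :: "complex \<Rightarrow> real"
  assumes "bounded_linear f"
  shows "trig_poly_fun (\<lambda>z. of_real (f z))"
proof -
  interpret bounded_linear f by fact
  define a b where "a = complex_of_real (f 1)" and "b = complex_of_real (f \<i>)"
  have "trig_poly_fun (\<lambda>z. (a / 2 - \<i> * b / 2) * z powi 1 + (a / 2 + \<i> * b / 2) * z powi (-1))"
    by (intro trig_poly_fun_add trig_poly_fun_monomial)
  then show ?thesis
  proof (rule trig_poly_fun_cong)
    fix z :: complex assume z: "cmod z = 1"
    have inv: "z powi (-1) = cnj z"
    proof -
      have "z * cnj z = 1" using z complex_norm_square[of z] by simp
      then have "inverse z = cnj z" by (rule inverse_unique)
      then show ?thesis by (simp add: power_int_minus)
    qed
    have "f z = f (Re z *\<^sub>R 1 + Im z *\<^sub>R \<i>)"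
      by (rule arg_cong[of _ _ f]) (simp add: complex_eq_iff)
    also have "\<dots> = Re z * f 1 + Im z * f \<i>"
      by (simp only: add scaleR) simp
    finally have "complex_of_real (f z) = Re z * a + Im z * b"
      by (simp add: a_def b_def)
    then show "complex_of_real (f z)
        = (a / 2 - \<i> * b / 2) * z powi 1 + (a / 2 + \<i> * b / 2) * z powi (-1)"
      unfolding inv by (simp add: complex_eq_iff a_def b_def field_simps)
  qed
qed

lemma trig_poly_fun_real_polynomial:
  fixes p :: "complex \<Rightarrow> real"
  assumes "real_polynomial_function p"
  shows "trig_poly_fun (\<lambda>z. of_real (p z))"
  using assms
proof (induction p rule: real_polynomial_function.induct)
  case (linear f)
  then show ?case by (rule trig_poly_fun_linear)
next
  case (const c)
  then show ?case using trig_poly_fun_monomial[of "of_real c" 0] by simp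
next
  case (add f g)
  then show ?case using trig_poly_fun_add[OF add.IH] by simp
next
  case (mult f g)
  then show ?case using trig_poly_fun_mult[OF mult.IH] by simp
qed

text \<open>Stone-Weierstrass for polynomials in the real plane, applied to the compact circle,
  where such polynomials are trigonometric.\<close>

lemma trig_poly_approx:
  fixes f :: "complex \<Rightarrow> complex"
  assumes "continuous_on (sphere 0 1) f" "e > 0"
  obtains A c where "finite A"
    "\<And>z. cmod z = 1 \<Longrightarrow> cmod ((\<Sum>k\<in>A. c k * z powi (k::int)) - f z) < e"
proof -
  obtain p where p: "polynomial_function p" "\<And>z. z \<in> sphere 0 1 \<Longrightarrow> norm (f z - p z) < e"
    using Stone_Weierstrass_polynomial_function[OF compact_sphere assms] by blast
  have "trig_poly_fun (\<lambda>z. of_real (Re (p z)) + \<i> powi 1 * of_real (Im (p z)))"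
    using p(1) unfolding polynomial_function_def
    by (intro trig_poly_fun_add trig_poly_fun_mult trig_poly_fun_real_polynomial
          trig_poly_fun_monomial[of \<i> 0, simplified])
       (auto simp: o_def intro: bounded_linear_Re bounded_linear_Im
          trig_poly_fun_monomial[of \<i> 0, simplified])
  then have "trig_poly_fun p"
    by (rule trig_poly_fun_cong) (simp add: complex_eq_iff)
  then obtain A c where A: "finite A" "\<And>z. cmod z = 1 \<Longrightarrow> p z = (\<Sum>k\<in>A. c k * z powi (k::int))"
    unfolding trig_poly_fun_def by blast
  show thesis
  proof (rule that[of A c])
    fix z :: complex assume "cmod z = 1"
    then show "cmod ((\<Sum>k\<in>A. c k * z powi k) - f z) < e"
      using p(2)[of z] A(2)[of z] by (simp add: norm_minus_commute)
  qed (rule A(1))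
qed

section \<open>Functional monotone class argument: from exponentials to indicators\<close>

definition bp_closed :: "'a set \<Rightarrow> ('a \<Rightarrow> complex) set \<Rightarrow> bool" where
  "bp_closed S V \<longleftrightarrow>
     (\<forall>f\<in>V. \<forall>g\<in>V. (\<lambda>x. f x + g x) \<in> V) \<and> (\<forall>c. \<forall>f\<in>V. (\<lambda>x. c * f x) \<in> V) \<and>
     (\<forall>F f C. (\<forall>n::nat. F n \<in> V) \<longrightarrow> (\<forall>n. \<forall>x\<in>S. cmod (F n x) \<le> C) \<longrightarrow>
        (\<forall>x\<in>S. (\<lambda>n. F n x) \<longlonglongrightarrow> f x) \<longrightarrow> f \<in> V)"

text \<open>Lists may repeat an index, so that appending adds combinations and no normal form is
  needed.\<close>

definition lin_comb :: "('j \<Rightarrow> 'a \<Rightarrow> real) \<Rightarrow> ('j \<times> real) list \<Rightarrow> 'a \<Rightarrow> real" where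
  "lin_comb Y xs w = (\<Sum>(j, r)\<leftarrow>xs. r * Y j w)"

lemma lin_comb_simps [simp]:
  "lin_comb Y [] w = 0"
  "lin_comb Y ((j, r) # xs) w = r * Y j w + lin_comb Y xs w"
  "lin_comb Y (xs @ ys) w = lin_comb Y xs w + lin_comb Y ys w"
  by (simp_all add: lin_comb_def)

context
  fixes S :: "'a set" and V :: "('a \<Rightarrow> complex) set" and Y :: "'j \<Rightarrow> 'a \<Rightarrow> real"
  assumes V: "bp_closed S V" and exps: "\<And>xs. (\<lambda>w. cis (lin_comb Y xs w)) \<in> V"
begin

lemma bp_add: "f \<in> V \<Longrightarrow> g \<in> V \<Longrightarrow> (\<lambda>x. f x + g x) \<in> V"
  using V unfolding bp_closed_def by blast

lemma bp_scale: "f \<in> V \<Longrightarrow> (\<lambda>x. c * f x) \<in> V"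
  using V unfolding bp_closed_def by blast

lemma bp_lim:
  assumes "\<And>n::nat. F n \<in> V" "\<And>n x. x \<in> S \<Longrightarrow> cmod (F n x) \<le> C"
    "\<And>x. x \<in> S \<Longrightarrow> (\<lambda>n. F n x) \<longlonglongrightarrow> f x"
  shows "f \<in> V"
  using V assms unfolding bp_closed_def by blast

lemma bp_const: "(\<lambda>_. c) \<in> V"
  using bp_scale[OF exps[of "[]"], of c] by simp

lemma bp_sum:
  assumes "\<And>i. i \<in> I \<Longrightarrow> f i \<in> V"
  shows "(\<lambda>x. \<Sum>i\<in>I. f i x) \<in> V"
  using assms
proof (induction I rule: infinite_finite_induct)
  case (insert x F)
  then show ?case by (simp add: bp_add)
qed (use bp_const in auto)

text \<open>Multiplication by exponentials is built in because \<open>V\<close> is not assumed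
  closed under products; it lets functions of single variables \<open>Y j\<close> be multiplied on
  one after the other.\<close>

definition exp_stable :: "('a \<Rightarrow> complex) \<Rightarrow> bool" where
  "exp_stable g \<longleftrightarrow> (\<exists>C. \<forall>x\<in>S. cmod (g x) \<le> C) \<and> (\<forall>xs. (\<lambda>w. g w * cis (lin_comb Y xs w)) \<in> V)"

text \<open>The function \<open>f\<close> is not periodic; it is the limit of the \<open>2 \<pi> n\<close>-periodic functions
  \<open>f (n * sin (x / n))\<close>, which are uniform limits of trigonometric polynomials.\<close>

lemma exp_stable_continuous:
  assumes g: "exp_stable g" and f: "continuous_on UNIV f" "\<And>t::real. cmod (f t) \<le> B"
  shows "exp_stable (\<lambda>w. f (Y j w) * g w)"
proof -
  obtain C where C: "\<And>x. x \<in> S \<Longrightarrow> cmod (g x) \<le> C" and gV: "\<And>xs. (\<lambda>w. g w * cis (lin_comb Y xs w)) \<in> V"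
    using g unfolding exp_stable_def by blast
  \<comment> \<open>At \<open>z = cis (t / Suc n)\<close> the imaginary part is
    \<open>sin (t / Suc n)\<close>, so \<open>F n\<close> is the periodic replacement of
    \<open>f\<close>, seen as a function on the circle.\<close>
  define F where "F = (\<lambda>n z. f (real (Suc n) * Im z))"
  have "\<exists>A c. finite A \<and> (\<forall>z. cmod z = 1 \<longrightarrow>
      cmod ((\<Sum>k\<in>A. c k * z powi (k::int)) - F n z) < 1 / Suc n)" for n
  proof -
    have cont: "continuous_on (sphere 0 1) (F n)"
      unfolding F_def
      by (intro continuous_on_compose2[OF f(1)] continuous_intros) auto
    have pos: "0 < 1 / real (Suc n)" by simp
    obtain A c where "finite A"
      "\<And>z. cmod z = 1 \<Longrightarrow> cmod ((\<Sum>k\<in>A. c k * z powi (k::int)) - F n z) < 1 / Suc n"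
      by (rule trig_poly_approx[OF cont pos]) blast
    then show ?thesis by blast
  qed
  then obtain A c where Ac: "\<And>n. finite (A n)"
     "\<And>n z. cmod z = 1 \<Longrightarrow> cmod ((\<Sum>k\<in>A n. c n k * z powi (k::int)) - F n z) < 1 / Suc n"
    by metis
  define p where "p = (\<lambda>n t. \<Sum>k\<in>A n. c n k * cis (t / Suc n) powi k)"
  have pF: "cmod (p n t - f (Suc n * sin (t / Suc n))) < 1 / Suc n" for n t
    using Ac(2)[of "cis (t / Suc n)" n] by (simp add: p_def F_def)
  have pb: "cmod (p n t) \<le> B + 1" for n t
  proof -
    have "cmod (p n t) \<le> cmod (p n t - f (Suc n * sin (t / Suc n))) + cmod (f (Suc n * sin (t / Suc n)))"
      using norm_triangle_sub by (metis add.commute)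
    also have "\<dots> \<le> 1 / Suc n + B" using pF[of n t] f(2) by (intro add_mono) auto
    also have "\<dots> \<le> 1 + B" by simp
    finally show ?thesis by simp
  qed
  have lim: "(\<lambda>n. p n t) \<longlonglongrightarrow> f t" for t
  proof -
    have s: "(\<lambda>n. real (Suc n) * sin (t / real (Suc n))) \<longlonglongrightarrow> t"
    proof (cases "t = 0")
      case False
      have "((\<lambda>x::real. sin x / x) \<longlongrightarrow> 1) (at 0)"
        using DERIV_sin[of "0::real"] by (simp add: has_field_derivative_iff)
      moreover have "filterlim (\<lambda>n. t / real (Suc n)) (at 0) sequentially"
        unfolding filterlim_at using False
        by (intro conjI real_tendsto_divide_at_top[OF tendsto_const]
            filterlim_compose[OF filterlim_real_sequentially filterlim_Suc]) auto
      ultimately have "(\<lambda>n. sin (t / real (Suc n)) / (t / real (Suc n))) \<longlonglongrightarrow> 1"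
        by (rule filterlim_compose)
      from tendsto_mult_left[OF this, of t]
      have "(\<lambda>n. t * (sin (t / real (Suc n)) / (t / real (Suc n)))) \<longlonglongrightarrow> t" by simp
      moreover have "t * (sin (t / real (Suc n)) / (t / real (Suc n)))
          = real (Suc n) * sin (t / real (Suc n))" for n
        using False by simp
      ultimately show ?thesis by simp
    qed auto
    have "isCont f t" using f(1) by (simp add: continuous_on_eq_continuous_at)
    then have "(\<lambda>n. f (real (Suc n) * sin (t / real (Suc n)))) \<longlonglongrightarrow> f t"
      using s by (rule isCont_tendsto_compose)
    moreover have "(\<lambda>n. p n t - f (real (Suc n) * sin (t / real (Suc n)))) \<longlonglongrightarrow> 0"
      (is "?d \<longlonglongrightarrow> 0")
      by (rule Lim_null_comparison[OF _ LIMSEQ_inverse_real_of_nat])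
         (use pF in \<open>auto intro!: always_eventually less_imp_le simp: inverse_eq_divide\<close>)
    ultimately show ?thesis
      using tendsto_add[of ?d 0 sequentially "\<lambda>n. f (real (Suc n) * sin (t / real (Suc n)))" "f t"] by simp
  qed
  have "(\<lambda>w. f (Y j w) * g w * cis (lin_comb Y xs w)) \<in> V" for xs
  proof (rule bp_lim[where F = "\<lambda>n w. p n (Y j w) * g w * cis (lin_comb Y xs w)" and C = "(B + 1) * C"])
    fix n
    \<comment> \<open>The monomial of degree \<open>k\<close> is the exponential with coefficient
      \<open>k / Suc n\<close> at \<open>Y j\<close>; prepending this entry to \<open>xs\<close> is
      covered by the stability of \<open>g\<close>.\<close>
    have "(\<lambda>w. \<Sum>k\<in>A n. c n k * (g w * cis (lin_comb Y ((j, k / Suc n) # xs) w))) \<in> V"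
      by (intro bp_sum bp_scale gV)
    also have "(\<lambda>w. \<Sum>k\<in>A n. c n k * (g w * cis (lin_comb Y ((j, k / Suc n) # xs) w)))
       = (\<lambda>w. p n (Y j w) * g w * cis (lin_comb Y xs w))"
      by (simp add: p_def sum_distrib_right sum_distrib_left cis_power_int cis_mult[symmetric] mult_ac)
    finally show "(\<lambda>w. p n (Y j w) * g w * cis (lin_comb Y xs w)) \<in> V" .
  next
    fix n x assume "x \<in> S"
    then show "cmod (p n (Y j x) * g x * cis (lin_comb Y xs x)) \<le> (B + 1) * C"
      using mult_mono[OF pb C, of x n "Y j x"] order_trans[OF norm_ge_zero pb]
      by (simp add: norm_mult)
  next
    fix x show "(\<lambda>n. p n (Y j x) * g x * cis (lin_comb Y xs x)) \<longlonglongrightarrow> f (Y j x) * g x * cis (lin_comb Y xs x)"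
      by (intro tendsto_intros lim)
  qed
  moreover have "\<exists>C'. \<forall>x\<in>S. cmod (f (Y j x) * g x) \<le> C'"
    using mult_mono[OF f(2) C] order_trans[OF norm_ge_zero f(2)]
    by (intro exI[of _ "B * C"]) (simp add: norm_mult)
  ultimately show ?thesis unfolding exp_stable_def by simp
qed

text \<open>Ever steeper ramps that vanish from \<open>b\<close> on converge boundedly to the
  indicator of the half-line; the limit is right at \<open>b\<close> itself because the inequality
  is strict.\<close>

lemma exp_stable_half_line:
  assumes g: "exp_stable g"
  shows "exp_stable (\<lambda>w. of_bool (Y j w < b) * g w)"
proof -
  obtain C where C: "\<And>x. x \<in> S \<Longrightarrow> cmod (g x) \<le> C"
    using g unfolding exp_stable_def by blast
  define f :: "nat \<Rightarrow> real \<Rightarrow> real" where "f = (\<lambda>m t. max 0 (min 1 (m * (b - t))))"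
  have f: "exp_stable (\<lambda>w. of_real (f m (Y j w)) * g w)" for m
  proof (rule exp_stable_continuous[OF g, where B = 1])
    show "continuous_on UNIV (\<lambda>t. complex_of_real (f m t))"
      unfolding f_def by (intro continuous_intros)
    show "cmod (complex_of_real (f m t)) \<le> 1" for t
      by (simp add: f_def)
  qed
  have lim: "(\<lambda>m. f m t) \<longlonglongrightarrow> of_bool (t < b)" for t
  proof (cases "t < b")
    case True
    obtain m0 :: nat where m0: "1 / (b - t) < real m0" using reals_Archimedean2 by blast
    have "eventually (\<lambda>m. f m t = 1) sequentially"
      using eventually_ge_at_top[of m0]
    proof eventually_elim
      case (elim m)
      then have "1 / (b - t) \<le> real m" using m0 by linarith
      then have "1 \<le> real m * (b - t)" using True by (simp add: field_simps)
      then show ?case by (simp add: f_def)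
    qed
    then show ?thesis using True by (simp add: tendsto_eventually)
  next
    case False
    then have "real m * (b - t) \<le> 0" for m by (simp add: mult_nonneg_nonpos)
    then have "f m t = 0" for m unfolding f_def by (simp add: max_absorb1 min.coboundedI2)
    then show ?thesis using False by simp
  qed
  have "(\<lambda>w. of_bool (Y j w < b) * g w * cis (lin_comb Y xs w)) \<in> V" for xs
  proof (rule bp_lim[where F = "\<lambda>m w. of_real (f m (Y j w)) * g w * cis (lin_comb Y xs w)" and C = C])
    show "(\<lambda>w. of_real (f m (Y j w)) * g w * cis (lin_comb Y xs w)) \<in> V" for m
      using f[of m] unfolding exp_stable_def by blast
    show "cmod (of_real (f m (Y j x)) * g x * cis (lin_comb Y xs x)) \<le> C" if "x \<in> S" for m x
    proof -
      have "\<bar>f m (Y j x)\<bar> \<le> 1" by (simp add: f_def)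
      from mult_mono[OF this C[OF that]] show ?thesis by (simp add: norm_mult)
    qed
    show "(\<lambda>m. of_real (f m (Y j x)) * g x * cis (lin_comb Y xs x))
         \<longlonglongrightarrow> of_bool (Y j x < b) * g x * cis (lin_comb Y xs x)" for x
      using tendsto_of_real[OF lim[of "Y j x"], where 'a = complex]
      by (intro tendsto_intros) (cases "Y j x < b"; simp)
  qed
  moreover have "\<exists>C. \<forall>x\<in>S. cmod (of_bool (Y j x < b) * g x) \<le> C"
    using C by (intro exI[of _ "max C 0"]) (auto simp: norm_mult le_max_iff_disj)
  ultimately show ?thesis unfolding exp_stable_def by simp
qed

lemma bp_half_lines:
  "(\<lambda>w. of_bool (\<forall>(j, b)\<in>set bs. Y j w < b)) \<in> V"
proof -
  have "exp_stable (\<lambda>w. of_bool (\<forall>(j, b)\<in>set bs. Y j w < b))"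
  proof (induction bs)
    case Nil
    show ?case unfolding exp_stable_def by (auto intro!: exI[of _ 1] exps)
  next
    case (Cons jb bs)
    obtain j b where jb: "jb = (j, b)" by (cases jb)
    have *: "(\<lambda>w. of_bool (Y j w < b) * of_bool (\<forall>(j, b)\<in>set bs. Y j w < b))
      = (\<lambda>w. of_bool (\<forall>(j, b)\<in>set (jb # bs). Y j w < b) :: complex)"
      by (auto simp: jb fun_eq_iff)
    show ?case
      using exp_stable_half_line[OF Cons.IH, of j b] unfolding * .
  qed
  then have "(\<lambda>w. of_bool (\<forall>(j, b)\<in>set bs. Y j w < b) * cis (lin_comb Y [] w)) \<in> V"
    unfolding exp_stable_def by blast
  then show ?thesis by simp
qed

text \<open>Dynkin's argument: finite intersections of half-lines are stable under intersection, and
  indicators of complements and of disjoint unions are sums and bounded limits.\<close>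

lemma bp_sigma_sets:
  assumes "A \<in> sigma_sets S (range (\<lambda>bs. {x\<in>S. \<forall>(j, b)\<in>set bs. Y j x < b}))"
  shows "indicator A \<in> V"
proof -
  \<comment> \<open>A constant sequence converges on \<open>S\<close> to every function that agrees
    with it there, so values off \<open>S\<close> may be changed freely.\<close>
  have cong: "g \<in> V" if "f \<in> V" "\<And>x. x \<in> S \<Longrightarrow> g x = f x" "\<And>x. x \<in> S \<Longrightarrow> cmod (f x) \<le> 1" for f g
    by (rule bp_lim[where F = "\<lambda>_. f" and C = 1]) (simp_all only: that tendsto_const)
  show ?thesis
  proof (rule sigma_sets_induct_disjoint[OF _ _ assms, where P = "\<lambda>A. indicator A \<in> V"])
    show "Int_stable (range (\<lambda>bs. {x\<in>S. \<forall>(j, b)\<in>set bs. Y j x < b}))"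
    proof (rule Int_stableI)
      fix a b assume "a \<in> range (\<lambda>bs. {x\<in>S. \<forall>(j, b)\<in>set bs. Y j x < b})"
         "b \<in> range (\<lambda>bs. {x\<in>S. \<forall>(j, b)\<in>set bs. Y j x < b})"
      then obtain as bs where "a = {x\<in>S. \<forall>(j, b)\<in>set as. Y j x < b}"
         "b = {x\<in>S. \<forall>(j, b)\<in>set bs. Y j x < b}" by blast
      then have "a \<inter> b = {x\<in>S. \<forall>(j, b)\<in>set (as @ bs). Y j x < b}"
        by auto
      then show "a \<inter> b \<in> range (\<lambda>bs. {x\<in>S. \<forall>(j, b)\<in>set bs. Y j x < b})" by blast
    qed
    show "range (\<lambda>bs. {x\<in>S. \<forall>(j, b)\<in>set bs. Y j x < b}) \<subseteq> Pow S" by auto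
    show "indicator A \<in> V" if A: "A \<in> range (\<lambda>bs. {x\<in>S. \<forall>(j, b)\<in>set bs. Y j x < b})" for A
    proof -
      obtain bs where "A = {x\<in>S. \<forall>(j, b)\<in>set bs. Y j x < b}" using A by (rule rangeE)
      then show ?thesis
        by (intro cong[OF bp_half_lines[of bs]]) (simp_all add: indicator_def)
    qed
    show "indicator {} \<in> V"
      by (rule cong[OF bp_const[of 0]]) auto
    show "indicator (S - A) \<in> V" if "indicator A \<in> V" for A
    proof (rule cong)
      show "(\<lambda>x. 1 + (-1) * indicator A x) \<in> V"
        using bp_add[OF bp_const[of 1] bp_scale[OF that, of "-1"]] .
    qed (auto simp: indicator_def)
    show "indicator (\<Union> (range A)) \<in> V"
      if "disjoint_family A" "\<And>i. indicator (A i) \<in> V" for A :: "nat \<Rightarrow> 'a set"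
    proof (rule bp_lim[where C = 1])
      have eq: "(\<Sum>i<n. indicator (A i) x) = (indicator (\<Union>i<n. A i) x :: complex)" for n x
        using that(1) by (subst indicator_UN_disjoint) (auto simp: disjoint_family_on_def)
      show "(\<lambda>x. \<Sum>i<n. indicator (A i) x) \<in> V" for n
        using that(2) by (intro bp_sum) auto
      show "cmod (\<Sum>i<n. indicator (A i) x) \<le> 1" for n x
        unfolding eq by (simp split: split_indicator)
      show "(\<lambda>n. \<Sum>i<n. indicator (A i) x) \<longlonglongrightarrow> (indicator (\<Union> (range A)) x :: complex)" for x
        unfolding eq by (rule LIMSEQ_indicator_UN)
    qed
  qed
qed

end

text \<open>Minimality is tested against all measures on the same space. For products and for images
  under injections this reduces to the measurability of a single map.\<close>

definition generated_by :: "'a measure \<Rightarrow> ('j \<Rightarrow> 'a \<Rightarrow> real) \<Rightarrow> bool" where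
  "generated_by M Y \<longleftrightarrow> (\<forall>j. Y j \<in> borel_measurable M) \<and>
     (\<forall>N. space N = space M \<longrightarrow> (\<forall>j. Y j \<in> borel_measurable N) \<longrightarrow> sets M \<subseteq> sets N)"

text \<open>The form in which the monotone class argument is applied to invariance, to mixing and to
  density in L2: a property that is linear and stable under bounded limits need only be checked on
  exponentials.\<close>

lemma bp_indicator:
  assumes gen: "generated_by M Y" and V: "bp_closed (space M) V"
    and exps: "\<And>xs. (\<lambda>w. cis (lin_comb Y xs w)) \<in> V" and A: "A \<in> sets M"
  shows "indicator A \<in> V"
proof -
  define G where "G = range (\<lambda>bs. {x\<in>space M. \<forall>(j, b)\<in>set bs. Y j x < b})"
  have G: "G \<subseteq> Pow (space M)" unfolding G_def by auto
  have "Y j \<in> borel_measurable (sigma (space M) G)" for j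
  proof (rule borel_measurable_iff_less[THEN iffD2], intro allI)
    fix a
    have "{w \<in> space M. Y j w < a} = {x\<in>space M. \<forall>(j, b)\<in>set [(j, a)]. Y j x < b}" by auto
    then have "{w \<in> space M. Y j w < a} \<in> G" unfolding G_def by blast
    then show "{w \<in> space (sigma (space M) G). Y j w < a} \<in> sets (sigma (space M) G)"
      using G by simp
  qed
  then have "sets M \<subseteq> sigma_sets (space M) G"
    using gen[unfolded generated_by_def, THEN conjunct2, rule_format, of "sigma (space M) G"] G
    by simp
  then show ?thesis
    using bp_sigma_sets[OF V exps] A unfolding G_def by blast
qed

section \<open>Existence of Gaussian sequences\<close>

lemma integral_PiM_prod:
  fixes f :: "'i \<Rightarrow> 'a \<Rightarrow> complex"
  assumes M: "\<And>i. prob_space (M i)" and J: "finite J"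
    and f: "\<And>j. j \<in> J \<Longrightarrow> integrable (M j) (f j)"
  shows "(\<integral>w. (\<Prod>j\<in>J. f j (w j)) \<partial>PiM UNIV M) = (\<Prod>j\<in>J. \<integral>x. f j x \<partial>M j)"
proof -
  interpret product_prob_space M UNIV by (rule product_prob_spaceI) (rule M)
  have [measurable]: "f j \<in> borel_measurable (M j)" if "j \<in> J" for j
    using f[OF that] by simp
  have "(\<integral>w. (\<Prod>j\<in>J. f j (w j)) \<partial>PiM UNIV M)
     = (\<integral>w. (\<Prod>j\<in>J. f j (restrict w J j)) \<partial>PiM UNIV M)"
    by (intro Bochner_Integration.integral_cong refl prod.cong) auto
  also have "\<dots> = (\<integral>w. (\<Prod>j\<in>J. f j (w j)) \<partial>distr (PiM UNIV M) (PiM J M) (\<lambda>w. restrict w J))"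
    by (rule integral_distr[symmetric], rule measurable_restrict_subset) auto
  also have "distr (PiM UNIV M) (PiM J M) (\<lambda>w. restrict w J) = PiM J M"
    using J by (intro distr_PiM_restrict_finite) auto
  also have "(\<integral>w. (\<Prod>j\<in>J. f j (w j)) \<partial>PiM J M) = (\<Prod>j\<in>J. \<integral>x. f j x \<partial>M j)"
    by (rule product_integral_prod[OF J f])
  finally show ?thesis .
qed

section \<open>Cholesky factorisation of positive semidefinite kernels\<close>

definition psd_kernel :: "(nat \<Rightarrow> nat \<Rightarrow> real) \<Rightarrow> bool" where
  "psd_kernel G \<longleftrightarrow> (\<forall>i j. G i j = G j i) \<and>
     (\<forall>n x. 0 \<le> (\<Sum>i<n. \<Sum>j<n. x i * x j * G i j))"

text \<open>Were \<open>G p j\<close> nonzero, the vector with entry \<open>s\<close> at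
  \<open>p\<close> and 1 at \<open>j\<close> would have the value
  \<open>2 * s * G p j + G j j\<close>, and \<open>s\<close> is chosen to make this -1.\<close>

lemma psd_kernel_zero_pivot:
  assumes G: "psd_kernel G" and p: "G p p = 0"
  shows "G p j = 0"
proof (rule ccontr)
  assume nz: "G p j \<noteq> 0"
  with p have pj: "p \<noteq> j" by auto
  define s where "s = - (G j j + 1) / (2 * G p j)"
  define n where "n = Suc (max p j)"
  define x where "x = (\<lambda>i. (if i = p then s else 0) + (if i = j then 1 else 0))"
  have n: "p < n" "j < n" unfolding n_def by auto
  have "(\<Sum>i<n. \<Sum>l<n. x i * x l * G i l)
    = (\<Sum>i<n. \<Sum>l<n. (if i = p then if l = p then s * s * G p p else 0 else 0)
       + (if i = p then if l = j then s * G p j else 0 else 0)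
       + (if i = j then if l = p then s * G j p else 0 else 0)
       + (if i = j then if l = j then G j j else 0 else 0))"
    using pj by (intro sum.cong refl) (auto simp: x_def)
  also have "\<dots> = s * s * G p p + s * G p j + s * G j p + G j j"
    using n by (simp add: sum.distrib if_distrib[of "\<lambda>f. sum f _"] sum.delta cong: if_cong)
       (simp add: sum.If_cases)
  also have "\<dots> = 2 * s * G p j + G j j"
    using G p unfolding psd_kernel_def by simp
  also have "\<dots> = - 1" using nz by (simp add: s_def field_simps)
  finally have "(\<Sum>i<n. \<Sum>l<n. x i * x l * G i l) < 0" by simp
  with G show False unfolding psd_kernel_def by (meson not_le)
qed

text \<open>Completing the square: adding \<open>t\<close> to the entry at \<open>p\<close> and
  minimising over \<open>t\<close> turns the form of \<open>G\<close> into the form of its Schur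
  complement.\<close>

lemma psd_kernel_schur:
  assumes G: "psd_kernel G"
  shows "psd_kernel (\<lambda>i j. G i j - G i p * G p j / G p p)"
proof (cases "G p p = 0")
  case True
  \<comment> \<open>Division by zero gives 0, so a vanishing pivot leaves the kernel
    unchanged.\<close>
  then show ?thesis using G by simp
next
  case nz: False
  have sym: "G i j = G j i" for i j using G unfolding psd_kernel_def by blast
  have "0 \<le> (\<Sum>i<n. \<Sum>j<n. x i * x j * (G i j - G i p * G p j / G p p))" for n x
  proof -
    define N where "N = max n (Suc p)"
    define y where "y = (\<lambda>i. if i < n then x i else 0)"
    define L where "L = (\<Sum>j<N. y j * G p j)"
    define t where "t = - L / G p p"
    have p: "p < N" unfolding N_def by auto
    have "0 \<le> (\<Sum>i<N. \<Sum>j<N. (y i + (if i = p then t else 0)) * (y j + (if j = p then t else 0)) * G i j)"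
      using G[unfolded psd_kernel_def, THEN conjunct2, rule_format, of "\<lambda>i. y i + (if i = p then t else 0)" N] .
    also have "\<dots> = (\<Sum>i<N. (\<Sum>j<N. y i * y j * G i j) + (if i = p then t * L else 0)
        + y i * G i p * t + (if i = p then t * t * G p p else 0))"
    proof (intro sum.cong refl)
      fix i assume "i \<in> {..<N}"
      have "(\<Sum>j<N. (y i + (if i = p then t else 0)) * (y j + (if j = p then t else 0)) * G i j)
        = (\<Sum>j<N. y i * y j * G i j + (if i = p then t else 0) * (y j * G i j)
            + (if j = p then y i * G i p * t else 0) + (if j = p then (if i = p then t else 0) * t * G i p else 0))"
        by (intro sum.cong refl) (auto simp: algebra_simps)
      also have "\<dots> = (\<Sum>j<N. y i * y j * G i j) + (if i = p then t else 0) * (\<Sum>j<N. y j * G i j)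
            + y i * G i p * t + (if i = p then t else 0) * t * G i p"
        using p by (simp add: sum.distrib sum_distrib_left)
      finally show "(\<Sum>j<N. (y i + (if i = p then t else 0)) * (y j + (if j = p then t else 0)) * G i j)
        = (\<Sum>j<N. y i * y j * G i j) + (if i = p then t * L else 0)
        + y i * G i p * t + (if i = p then t * t * G p p else 0)"
        by (auto simp: L_def)
    qed
    also have "\<dots> = (\<Sum>i<N. \<Sum>j<N. y i * y j * G i j) + t * L + L * t + t * t * G p p"
    proof -
      have "(\<Sum>i<N. y i * G i p * t) = L * t"
        unfolding L_def sum_distrib_right by (intro sum.cong refl) (metis sym)
      then show ?thesis using p by (simp add: sum.distrib)
    qed
    also have "\<dots> = (\<Sum>i<N. \<Sum>j<N. y i * y j * G i j) - L * L / G p p"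
      using nz by (simp add: t_def field_simps)
    also have "L * L / G p p = (\<Sum>i<N. \<Sum>j<N. y i * y j * (G i p * G p j / G p p))"
      unfolding L_def sum_product sum_divide_distrib
    proof (intro sum.cong refl)
      fix i j
      show "y i * G p i * (y j * G p j) / G p p = y i * y j * (G i p * G p j / G p p)"
        using sym[of i p] by simp
    qed
    also have "(\<Sum>i<N. \<Sum>j<N. y i * y j * G i j) - \<dots>
        = (\<Sum>i<N. \<Sum>j<N. y i * y j * (G i j - G i p * G p j / G p p))"
      by (simp add: sum_subtractf right_diff_distrib)
    also have "\<dots> = (\<Sum>i<n. \<Sum>j<N. y i * y j * (G i j - G i p * G p j / G p p))"
      by (rule sum.mono_neutral_right) (auto simp: y_def N_def)
    also have "\<dots> = (\<Sum>i<n. \<Sum>j<n. y i * y j * (G i j - G i p * G p j / G p p))"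
      by (intro sum.cong refl sum.mono_neutral_right) (auto simp: y_def N_def)
    also have "\<dots> = (\<Sum>i<n. \<Sum>j<n. x i * x j * (G i j - G i p * G p j / G p p))"
      by (intro sum.cong refl) (auto simp: y_def)
    finally show ?thesis .
  qed
  moreover have "G i j - G i p * G p j / G p p = G j i - G j p * G p i / G p p" for i j
    using sym[of i j] sym[of i p] sym[of j p] by (simp add: mult.commute)
  ultimately show ?thesis unfolding psd_kernel_def by blast
qed

text \<open>Gaussian elimination: \<open>K p\<close> is what remains of \<open>G\<close> after
  \<open>p\<close> pivots. It vanishes on the rows of index below \<open>p\<close>, so after
  \<open>n\<close> steps the factorisation is exact on the first \<open>n\<close> rows, and the
  factor is triangular.\<close>

lemma cholesky:
  assumes G: "psd_kernel G"
  obtains a :: "nat \<Rightarrow> nat \<Rightarrow> real" where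
    "\<And>i j n. i < n \<Longrightarrow> G i j = (\<Sum>p<n. a i p * a j p)" "\<And>i p. i < p \<Longrightarrow> a i p = 0"
proof -
  define K where "K = rec_nat G (\<lambda>p H i j. H i j - H i p * H p j / H p p)"
  have K0: "K 0 = G" and KS: "\<And>p. K (Suc p) = (\<lambda>i j. K p i j - K p i p * K p p j / K p p p)"
    unfolding K_def by simp_all
  have psd: "psd_kernel (K p)" for p
    by (induction p) (auto simp: K0 KS G intro: psd_kernel_schur)
  have sym: "K p i j = K p j i" for p i j using psd unfolding psd_kernel_def by blast
  have zero: "K p i j = 0" if "i < p" for p i j
    using that
  proof (induction p arbitrary: i j)
    case (Suc p)
    show ?case
    proof (cases "i < p")
      case True
      then show ?thesis using Suc.IH unfolding KS by simp
    next
      case False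
      with Suc.prems have "i = p" by simp
      \<comment> \<open>A zero pivot eliminates nothing, but then its whole row is already
        zero.\<close>
      then show ?thesis
        using psd_kernel_zero_pivot[OF psd, of p p] unfolding KS by (cases "K p p p = 0") auto
    qed
  qed simp
  define a where "a = (\<lambda>i p. K p i p / sqrt (K p p p))"
  have diag: "0 \<le> K p p p" for p
  proof -
    have "0 \<le> (\<Sum>i<Suc p. \<Sum>j<Suc p. (if i = p then 1 else 0) * (if j = p then 1 else 0) * K p i j)"
      using psd[of p, unfolded psd_kernel_def, THEN conjunct2, rule_format, of "\<lambda>i. if i = p then 1 else 0" "Suc p"] .
    also have "\<dots> = (\<Sum>i<Suc p. \<Sum>j<Suc p. (if i = p then if j = p then K p p p else 0 else 0))"
      by (intro sum.cong refl) auto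
    also have "\<dots> = K p p p" by (simp add: sum.If_cases if_distrib[of "\<lambda>f. sum f _"] cong: if_cong)
    finally show ?thesis .
  qed
  have dec: "G i j = (\<Sum>p<n. a i p * a j p) + K n i j" for n i j
  proof (induction n)
    case (Suc n)
    have "a i n * a j n = K n i n * K n j n / K n n n"
      using diag[of n] by (simp add: a_def)
    then show ?case using Suc sym[of n j n] by (simp add: KS)
  qed (simp add: K0)
  show thesis
  proof (rule that[of a])
    show "G i j = (\<Sum>p<n. a i p * a j p)" if "i < n" for i j n
      using dec[of i j n] zero[OF that] by simp
    show "a i p = 0" if "i < p" for i p
      using zero[OF that] by (simp add: a_def)
  qed
qed

definition quad_form :: "('j \<Rightarrow> 'j \<Rightarrow> real) \<Rightarrow> ('j \<times> real) list \<Rightarrow> real" where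
  "quad_form G xs = (\<Sum>(n, r)\<leftarrow>xs. \<Sum>(m, s)\<leftarrow>xs. r * s * G n m)"

lemma sum_list_sum_swap: "(\<Sum>x\<leftarrow>xs. \<Sum>p\<in>A. f x p) = (\<Sum>p\<in>A. \<Sum>x\<leftarrow>xs. f x p :: 'a :: comm_monoid_add)"
  by (induction xs) (simp_all add: sum.distrib)

lemma quad_form_gram:
  assumes "\<And>n m. n \<in> fst ` set xs \<Longrightarrow> G n m = (\<Sum>p\<in>P. b n p * b m p)"
  shows "quad_form G xs = (\<Sum>p\<in>P. (\<Sum>(n, r)\<leftarrow>xs. r * b n p)\<^sup>2)"
proof -
  have "(\<Sum>(n, r)\<leftarrow>xs. \<Sum>(m, s)\<leftarrow>xs. r * s * G n m)
      = (\<Sum>(n, r)\<leftarrow>xs. \<Sum>(m, s)\<leftarrow>xs. \<Sum>p\<in>P. (r * b n p) * (s * b m p))"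
    using assms
    by (intro arg_cong[of _ _ sum_list] map_cong refl)
       (force simp: sum_distrib_left mult_ac intro!: arg_cong[of _ _ sum_list] map_cong)
  also have "\<dots> = (\<Sum>p\<in>P. \<Sum>(n, r)\<leftarrow>xs. \<Sum>(m, s)\<leftarrow>xs. (r * b n p) * (s * b m p))"
    by (simp add: case_prod_unfold sum_list_sum_swap)
  also have "\<dots> = (\<Sum>p\<in>P. (\<Sum>(n, r)\<leftarrow>xs. r * b n p)\<^sup>2)"
    by (simp add: power2_eq_square case_prod_unfold sum_list_mult_const sum_list_const_mult)
  finally show ?thesis unfolding quad_form_def .
qed

text \<open>The process is a triangular image of independent standard normal variables. Enumerating
  the integers gives the elimination a first index, and triangularity makes each coordinate a finite
  sum, so that characteristic functions are finite products.\<close>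

lemma gaussian_process_exists:
  fixes G :: "int \<Rightarrow> int \<Rightarrow> real"
  assumes sym: "\<And>n m. G n m = G m n" and psd: "\<And>xs. 0 \<le> quad_form G xs"
  obtains M :: "(int \<Rightarrow> real) measure" where "prob_space M" "sets M = sets (PiM UNIV (\<lambda>_. borel))"
    "\<And>xs. (\<integral>w. cis (lin_comb (\<lambda>n w. w n) xs w) \<partial>M) = exp (- quad_form G xs / 2)"
proof -
  define H where "H = (\<lambda>i j. G (int_decode i) (int_decode j))"
  have "psd_kernel H"
    unfolding psd_kernel_def
  proof (intro conjI allI)
    show "H i j = H j i" for i j unfolding H_def by (rule sym)
    fix n and x :: "nat \<Rightarrow> real"
    have "quad_form G (map (\<lambda>i. (int_decode i, x i)) [0..<n])
        = (\<Sum>i<n. \<Sum>j<n. x i * x j * H i j)"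
      by (simp add: quad_form_def H_def o_def interv_sum_list_conv_sum_set_nat atLeast0LessThan)
    then show "0 \<le> (\<Sum>i<n. \<Sum>j<n. x i * x j * H i j)" using psd by metis
  qed
  then obtain a where a: "\<And>i j n. i < n \<Longrightarrow> H i j = (\<Sum>p<n. a i p * a j p)"
      and a0: "\<And>i p. i < p \<Longrightarrow> a i p = 0"
    by (rule cholesky) blast
  define P where "P = PiM UNIV (\<lambda>_::nat. std_normal_distribution)"
  interpret N: real_distribution std_normal_distribution by (rule real_dist_normal_dist)
  have P: "prob_space P" unfolding P_def by (intro prob_space_PiM N.prob_space_axioms)
  have comp [measurable]: "(\<lambda>\<omega>. \<omega> p) \<in> borel_measurable P" for p
  proof -
    have "(\<lambda>\<omega>. \<omega> p) \<in> measurable P std_normal_distribution"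
      unfolding P_def by (rule measurable_component_singleton) simp
    then show ?thesis by simp
  qed
  define \<Phi> where "\<Phi> = (\<lambda>\<omega> n. \<Sum>p\<le>int_encode n. a (int_encode n) p * \<omega> p)"
  have meas [measurable]: "\<Phi> \<in> measurable P (PiM UNIV (\<lambda>_. borel))"
    unfolding \<Phi>_def by (rule measurable_PiM_single') (auto simp: space_PiM)
  define M where "M = distr P (PiM UNIV (\<lambda>_. borel)) \<Phi>"
  have cf: "(\<integral>w. cis (lin_comb (\<lambda>n w. w n) xs w) \<partial>M) = exp (- quad_form G xs / 2)" for xs
  proof -
    define B where "B = Suc (Max (insert 0 (int_encode ` fst ` set xs)))"
    have B: "int_encode n < B" if "n \<in> fst ` set xs" for n
      unfolding B_def using that by (intro le_imp_less_Suc Max_ge) auto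
    define b where "b = (\<lambda>p. \<Sum>(n, r)\<leftarrow>xs. r * a (int_encode n) p)"
    have lc: "lin_comb (\<lambda>n w. w n) xs (\<Phi> \<omega>) = (\<Sum>p<B. b p * \<omega> p)" for \<omega>
    proof -
      have "\<Phi> \<omega> n = (\<Sum>p<B. a (int_encode n) p * \<omega> p)" if "n \<in> fst ` set xs" for n
        unfolding \<Phi>_def using B[OF that] a0 by (intro sum.mono_neutral_left) auto
      then have "lin_comb (\<lambda>n w. w n) xs (\<Phi> \<omega>) = (\<Sum>(n, r)\<leftarrow>xs. \<Sum>p<B. r * a (int_encode n) p * \<omega> p)"
        unfolding lin_comb_def
        by (intro arg_cong[of _ _ sum_list] map_cong refl) (force simp: sum_distrib_left mult_ac)
      then show ?thesis
        by (simp add: b_def case_prod_unfold sum_list_sum_swap sum_list_mult_const[symmetric])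
    qed
    have [measurable]: "(\<lambda>w. cis (lin_comb (\<lambda>n w. w n) xs w)) \<in> borel_measurable (PiM UNIV (\<lambda>_. borel))"
    proof -
      have "(\<lambda>w. lin_comb (\<lambda>n w. w n) xs w :: real) \<in> borel_measurable (PiM UNIV (\<lambda>_. borel))"
        unfolding lin_comb_def by (induction xs) auto
      then show ?thesis unfolding cis_conv_exp by measurable
    qed
    have "(\<integral>w. cis (lin_comb (\<lambda>n w. w n) xs w) \<partial>M) = (\<integral>\<omega>. cis (lin_comb (\<lambda>n w. w n) xs (\<Phi> \<omega>)) \<partial>P)"
      unfolding M_def by (rule integral_distr) measurable
    also have "\<dots> = (\<integral>\<omega>. (\<Prod>p<B. cis (b p * \<omega> p)) \<partial>P)"
      by (simp add: lc cis_conv_exp exp_sum sum_distrib_left)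
    also have "\<dots> = (\<Prod>p<B. \<integral>t. cis (b p * t) \<partial>std_normal_distribution)"
      unfolding P_def
      by (rule integral_PiM_prod)
         (auto intro!: N.prob_space_axioms N.integrable_const_bound[where B = 1] simp: cis_conv_exp)
    also have "\<dots> = (\<Prod>p<B. char std_normal_distribution (b p))"
      by (simp add: char_def cis_conv_exp)
    also have "\<dots> = (\<Prod>p<B. complex_of_real (exp (- (b p)\<^sup>2 / 2)))"
      by (simp add: char_std_normal_distribution)
    also have "\<dots> = exp (- (\<Sum>p<B. (b p)\<^sup>2) / 2)"
    proof -
      have "exp (- (\<Sum>p<B. (b p)\<^sup>2) / 2) = exp (\<Sum>p<B. - (b p)\<^sup>2 / 2)"
        by (rule arg_cong[of _ _ exp]) (simp add: sum_negf sum_divide_distrib)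
      also have "\<dots> = (\<Prod>p<B. exp (- (b p)\<^sup>2 / 2))"
        by (rule exp_sum) simp
      finally show ?thesis by (simp only: of_real_prod)
    qed
    also have "(\<Sum>p<B. (b p)\<^sup>2) = quad_form G xs"
      unfolding b_def
    proof (rule quad_form_gram[where b = "\<lambda>n. a (int_encode n)", symmetric])
      fix n m assume "n \<in> fst ` set xs"
      from a[OF B[OF this], of "int_encode m"]
      show "G n m = (\<Sum>p<B. a (int_encode n) p * a (int_encode m) p)" by (simp add: H_def)
    qed
    finally show ?thesis by simp
  qed
  show thesis
  proof (rule that[of M])
    show "prob_space M" unfolding M_def by (rule prob_space.prob_space_distr[OF P]) measurable
    show "sets M = sets (PiM UNIV (\<lambda>_. borel))" by (simp add: M_def)
  qed (rule cf)
qed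

section \<open>Random refinement of cells\<close>

definition ex :: "real \<Rightarrow> complex" where "ex t = cis (2 * pi * t)"

lemma ex_simps [simp]: "cmod (ex t) = 1" "ex 0 = 1" "ex (of_int z) = 1" "cnj (ex t) = ex (- t)"
  by (simp_all add: ex_def cis_cnj cis_multiple_2pi)

lemma ex_add: "ex (s + t) = ex s * ex t"
  by (simp add: ex_def ring_distribs cis_mult)

lemma ex_sum: "ex (\<Sum>i\<in>I. f i) = (\<Prod>i\<in>I. ex (f i))"
  by (induction I rule: infinite_finite_induct) (simp_all add: ex_add)

lemma cmod_ex_diff_le: "cmod (ex s - ex t) \<le> 2 * pi * \<bar>s - t\<bar>"
proof -
  have "ex s - ex t = ex t * (ex (s - t) - 1)"
    using ex_add[of t "s - t"] by (simp add: right_diff_distrib)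
  moreover have "ex (s - t) = iexp (2 * pi * (s - t))"
    unfolding ex_def cis_conv_exp ..
  ultimately have "ex s - ex t = ex t * (iexp (2 * pi * (s - t)) - 1)" by simp
  then have "cmod (ex s - ex t) = cmod (iexp (2 * pi * (s - t)) - 1)"
    by (simp add: norm_mult)
  also have "\<dots> \<le> \<bar>2 * pi * (s - t)\<bar>"
    using iexp_approx1[of "2 * pi * (s - t)" 0] by simp
  finally show ?thesis by (simp add: abs_mult)
qed

lemma borel_measurable_ex [measurable]: "ex \<in> borel_measurable borel"
  unfolding ex_def cis_conv_exp by measurable

section \<open>The uniform law on a cell and its Fourier transform\<close>

definition unit_law :: "real measure" where
  "unit_law = density lborel (\<lambda>x. ennreal (indicator {0..1} x))"

lemma sets_unit_law [simp, measurable_cong]: "sets unit_law = sets borel"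
  and space_unit_law [simp]: "space unit_law = UNIV"
  by (simp_all add: unit_law_def)

lemma nn_integral_unit_law:
  "f \<in> borel_measurable borel \<Longrightarrow> (\<integral>\<^sup>+x. f x \<partial>unit_law) = (\<integral>\<^sup>+x. indicator {0..1} x * f x \<partial>lborel)"
  unfolding unit_law_def by (subst nn_integral_density) (auto simp: ennreal_indicator)

lemma prob_space_unit_law: "prob_space unit_law"
proof
  show "emeasure unit_law (space unit_law) = 1"
    unfolding unit_law_def by (subst emeasure_density) (auto simp: ennreal_indicator)
qed

lemma AE_unit_law: "AE x in unit_law. x \<in> {0..1}"
  unfolding unit_law_def by (subst AE_density) (auto simp: indicator_def)

text \<open>The Fourier transform of the uniform law, hence the average of \<open>ex\<close> over a cell of width \<open>t\<close>.\<close>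

definition psi :: "real \<Rightarrow> complex" where
  "psi t = (\<integral>x. ex (t * x) \<partial>unit_law)"

interpretation U: prob_space unit_law by (rule prob_space_unit_law)

lemma psi_0 [simp]: "psi 0 = 1"
  by (simp add: psi_def U.prob_space[simplified])

lemma integrable_unit_law_ex: "integrable unit_law (\<lambda>x. ex (s + t * x))"
  by (rule U.integrable_const_bound[where B = 1]) auto

lemma integral_unit_law_ex: "(\<integral>x. ex (s + t * x) \<partial>unit_law) = ex s * psi t"
  by (simp add: psi_def ex_add)

lemma cmod_psi_le_1: "cmod (psi t) \<le> 1"
proof -
  have "cmod (psi t) \<le> (\<integral>x. cmod (ex (t * x)) \<partial>unit_law)"
    unfolding psi_def by (rule integral_norm_bound)
  then show ?thesis by (simp add: U.prob_space[simplified])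
qed

lemma cmod_1_minus_psi_le: "cmod (1 - psi t) \<le> 2 * pi * \<bar>t\<bar>"
proof -
  have "1 - psi t = (\<integral>x. (1 - ex (t * x)) \<partial>unit_law)"
    using integrable_unit_law_ex[of 0 t]
    unfolding psi_def by (subst Bochner_Integration.integral_diff) (auto simp: U.prob_space[simplified])
  also have "cmod \<dots> \<le> (\<integral>x. cmod (1 - ex (t * x)) \<partial>unit_law)"
    by (rule integral_norm_bound)
  also have "\<dots> \<le> (\<integral>x. 2 * pi * \<bar>t\<bar> \<partial>unit_law)"
  proof (rule integral_mono_AE)
    show "integrable unit_law (\<lambda>x. cmod (1 - ex (t * x)))"
      using integrable_unit_law_ex[of 0 t] by (intro integrable_norm Bochner_Integration.integrable_diff) auto
    show "AE x in unit_law. cmod (1 - ex (t * x)) \<le> 2 * pi * \<bar>t\<bar>"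
      using AE_unit_law
    proof eventually_elim
      case (elim x)
      have "cmod (1 - ex (t * x)) \<le> 2 * pi * \<bar>t * x\<bar>"
        using cmod_ex_diff_le[of 0 "t * x"] by simp
      also have "\<dots> \<le> 2 * pi * \<bar>t\<bar>"
        using elim by (simp add: abs_mult mult_left_le)
      finally show ?case .
    qed
  qed simp
  finally show ?thesis by (simp add: U.prob_space[simplified])
qed

text \<open>By explicit integration \<open>psi t = (ex t - 1) / (2 * pi * \<i> * t)\<close>.\<close>

lemma cmod_psi_le_inverse:
  assumes "t \<noteq> 0"
  shows "cmod (psi t) \<le> 1 / (pi * \<bar>t\<bar>)"
proof -
  define F where "F = (\<lambda>x. (1 / (2 * pi * t)) *\<^sub>R (- \<i> * ex (t * x)))"
  have der: "(F has_vector_derivative ex (t * x)) (at x within {0..1})" for x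
  proof -
    have "((\<lambda>x. cis (2 * pi * (t * x))) has_derivative
        (\<lambda>h. (2 * pi * (t * h)) *\<^sub>R (\<i> * cis (2 * pi * (t * x))))) (at x within {0..1})"
      by (rule has_derivative_cis) (auto intro!: derivative_eq_intros)
    then have "(F has_derivative
        (\<lambda>h. (1 / (2 * pi * t)) *\<^sub>R (- \<i> * ((2 * pi * (t * h)) *\<^sub>R (\<i> * cis (2 * pi * (t * x)))))))
        (at x within {0..1})"
      unfolding F_def ex_def by (intro has_derivative_scaleR_right has_derivative_mult_right)
    also have "(\<lambda>h. (1 / (2 * pi * t)) *\<^sub>R (- \<i> * ((2 * pi * (t * h)) *\<^sub>R (\<i> * cis (2 * pi * (t * x))))))
        = (\<lambda>h. h *\<^sub>R ex (t * x))"
      using assms by (simp add: fun_eq_iff scaleR_conv_of_real ex_def complex_eq_iff)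
    finally show ?thesis unfolding has_vector_derivative_def .
  qed
  have "psi t = (\<integral>x. indicator {0..1} x *\<^sub>R ex (t * x) \<partial>lborel)"
    unfolding psi_def unit_law_def by (subst integral_density) auto
  also have "\<dots> = F 1 - F 0"
  proof (rule integral_FTC_atLeastAtMost)
    show "continuous_on {0..1} (\<lambda>x. ex (t * x))"
      unfolding ex_def by (intro continuous_intros)
  qed (simp_all add: der)
  finally have "psi t = F 1 - F 0" .
  then have "cmod (psi t) \<le> cmod (F 1) + cmod (F 0)"
    by (simp add: norm_triangle_ineq4)
  also have "\<dots> = 1 / (pi * \<bar>t\<bar>)"
    by (simp add: F_def norm_mult abs_mult)
  finally show ?thesis .
qed

section \<open>Probability bounds for random points in cells\<close>

lemma indep_vars_PiM_coordinates:
  assumes M: "\<And>i. prob_space (M i)" and I: "I \<noteq> {}"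
  shows "prob_space.indep_vars (PiM I M) M (\<lambda>i \<omega>. \<omega> i) I"
proof -
  interpret prob_space "PiM I M" by (intro prob_space_PiM M)
  have "distr (PiM I M) (PiM I M) (\<lambda>x. \<lambda>i\<in>I. x i) = distr (PiM I M) (PiM I M) (\<lambda>x. x)"
    by (intro distr_cong refl) (auto simp: space_PiM PiE_def extensional_def restrict_def fun_eq_iff)
  also have "\<dots> = PiM I (\<lambda>i. distr (PiM I M) (M i) (\<lambda>\<omega>. \<omega> i))"
    unfolding distr_id2[OF refl] by (intro PiM_cong refl distr_PiM_component[symmetric] M)
  finally show ?thesis
    using I by (subst indep_vars_iff_distr_eq_PiM') auto
qed

text \<open>Fubini: with all coordinates but \<open>c0\<close> frozen, the form is affine in
  \<open>\<omega> c0\<close> with slope at least \<open>d\<close> in absolute value, since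
  \<open>q c0\<close> is a nonzero integer. The bad values lie in an interval of length at most
  \<open>2 * \<eta> / d\<close>, and the uniform law has density at most 1.\<close>

lemma linear_form_small_prob:
  fixes q :: "nat \<Rightarrow> int"
  assumes c0: "c0 < P" "q c0 \<noteq> 0" and d: "0 < d" and \<eta>: "0 \<le> \<eta>"
  defines "\<Omega> \<equiv> PiM {..<P} (\<lambda>_. unit_law)"
  shows "measure \<Omega> {\<omega>\<in>space \<Omega>. \<bar>(\<Sum>c<P. q c * (b c + d * \<omega> c)) - z\<bar> \<le> \<eta>} \<le> 2 * \<eta> / d"
proof -
  define I where "I = {..<P} - {c0}"
  have I: "{..<P} = insert c0 I" "finite I" "c0 \<notin> I" using c0 by (auto simp: I_def)
  interpret product_prob_space "\<lambda>_. unit_law" "{..<P}"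
    by (rule product_prob_spaceI) (rule prob_space_unit_law)
  interpret \<Omega>: prob_space \<Omega> unfolding \<Omega>_def by (intro prob_space_PiM prob_space_unit_law)
  define B where "B = {\<omega>\<in>space \<Omega>. \<bar>(\<Sum>c<P. q c * (b c + d * \<omega> c)) - z\<bar> \<le> \<eta>}"
  have B [measurable]: "B \<in> sets \<Omega>" unfolding B_def \<Omega>_def by measurable
  have "emeasure \<Omega> B = (\<integral>\<^sup>+\<omega>. indicator B \<omega> \<partial>PiM (insert c0 I) (\<lambda>_. unit_law))"
    using B by (simp add: \<Omega>_def I)
  also have "\<dots> = (\<integral>\<^sup>+x. (\<integral>\<^sup>+y. indicator B (x(c0 := y)) \<partial>unit_law) \<partial>PiM I (\<lambda>_. unit_law))"
    using B by (intro product_nn_integral_insert I) (auto simp: \<Omega>_def I)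
  also have "\<dots> \<le> (\<integral>\<^sup>+x. ennreal (2 * \<eta> / d) \<partial>PiM I (\<lambda>_. unit_law))"
  proof (rule nn_integral_mono)
    fix x
    define r where "r = (\<Sum>c\<in>I. q c * (b c + d * x c)) + q c0 * b c0 - z"
    define u where "u = q c0 * d"
    have u: "u \<noteq> 0" "d \<le> \<bar>u\<bar>"
    proof -
      have "1 \<le> \<bar>q c0\<bar>" using c0 by simp
      then have "1 \<le> \<bar>real_of_int (q c0)\<bar>" by linarith
      then show "d \<le> \<bar>u\<bar>" unfolding u_def abs_mult using d mult_right_mono[of 1 "\<bar>real_of_int (q c0)\<bar>" d] by simp
      then show "u \<noteq> 0" using d by auto
    qed
    have sub: "indicator B (x(c0 := y)) \<le> (indicator {- r / u - \<eta> / \<bar>u\<bar> .. - r / u + \<eta> / \<bar>u\<bar>} y :: ennreal)" for y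
    proof (cases "x(c0 := y) \<in> B")
      case True
      have "(\<Sum>c<P. q c * (b c + d * (x(c0 := y)) c)) - z = r + u * y"
        using I(2,3) unfolding I(1)
        by (simp add: r_def u_def algebra_simps sum.If_cases)
           (intro sum.cong refl arg_cong2[of _ _ _ _ "(+)"]; auto)
      with True have "\<bar>r + u * y\<bar> \<le> \<eta>" unfolding B_def by simp
      then have "\<bar>u\<bar> * \<bar>y + r / u\<bar> \<le> \<eta>"
        unfolding abs_mult[symmetric] using u by (simp add: distrib_left add.commute)
      then have "\<bar>y + r / u\<bar> \<le> \<eta> / \<bar>u\<bar>" using u by (simp add: field_simps)
      then have "y \<in> {- r / u - \<eta> / \<bar>u\<bar> .. - r / u + \<eta> / \<bar>u\<bar>}"
        by (simp add: abs_le_iff)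
      then show ?thesis by (simp split: split_indicator)
    qed simp
    have "(\<integral>\<^sup>+y. indicator B (x(c0 := y)) \<partial>unit_law)
        \<le> (\<integral>\<^sup>+y. indicator {- r / u - \<eta> / \<bar>u\<bar> .. - r / u + \<eta> / \<bar>u\<bar>} y \<partial>unit_law)"
      by (intro nn_integral_mono sub)
    also have "\<dots> = (\<integral>\<^sup>+y. indicator {0..1} y * indicator {- r / u - \<eta> / \<bar>u\<bar> .. - r / u + \<eta> / \<bar>u\<bar>} y \<partial>lborel)"
      by (rule nn_integral_unit_law) simp
    also have "\<dots> \<le> (\<integral>\<^sup>+y. indicator {- r / u - \<eta> / \<bar>u\<bar> .. - r / u + \<eta> / \<bar>u\<bar>} y \<partial>lborel)"
      by (intro nn_integral_mono) (simp split: split_indicator)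
    also have "\<dots> = ennreal (2 * \<eta> / \<bar>u\<bar>)"
      using \<eta> u by simp
    also have "\<dots> \<le> ennreal (2 * \<eta> / d)"
      using \<eta> u d by (intro ennreal_leI divide_left_mono) auto
    finally show "(\<integral>\<^sup>+y. indicator B (x(c0 := y)) \<partial>unit_law) \<le> ennreal (2 * \<eta> / d)" .
  qed
  also have "\<dots> = ennreal (2 * \<eta> / d)"
  proof -
    interpret J: prob_space "PiM I (\<lambda>_. unit_law)" by (intro prob_space_PiM prob_space_unit_law)
    show ?thesis by (simp add: J.emeasure_space_1)
  qed
  finally show ?thesis
    using \<eta> d unfolding B_def[symmetric] \<Omega>.emeasure_eq_measure by simp
qed

text \<open>The integer relations on \<open>P\<close> points of complexity at most \<open>m\<close>,
  complexity being the l1 norm. The value 0 from \<open>P\<close> on makes the set finite and lets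
  equality of functions express equality of relations.\<close>

definition int_vectors :: "nat \<Rightarrow> nat \<Rightarrow> (nat \<Rightarrow> int) set" where
  "int_vectors P m = {q. (\<forall>c\<ge>P. q c = 0) \<and> (\<Sum>c<P. \<bar>q c\<bar>) \<le> int m}"

text \<open>Raising the norm bound by 1 amounts to adding 0 or a signed unit vector, which gives
  \<open>2 * P + 1\<close> choices. What matters later is that the bound is polynomial in
  \<open>P\<close> for fixed \<open>m\<close>.\<close>

lemma card_int_vectors: "finite (int_vectors P m) \<and> card (int_vectors P m) \<le> (2 * P + 1) ^ m"
proof (induction m)
  case 0
  have "int_vectors P 0 \<subseteq> {\<lambda>_. 0}"
  proof
    fix q assume q: "q \<in> int_vectors P 0"
    then have "(\<Sum>c<P. \<bar>q c\<bar>) = 0"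
      unfolding int_vectors_def by (auto intro!: antisym sum_nonneg)
    then have "\<forall>c<P. q c = 0" by (simp add: sum_nonneg_eq_0_iff)
    with q show "q \<in> {\<lambda>_. 0}" unfolding int_vectors_def by (auto simp: fun_eq_iff) (meson not_le)
  qed
  moreover from this have "finite (int_vectors P 0)" by (rule finite_subset) simp
  moreover from calculation(1) have "card (int_vectors P 0) \<le> card {\<lambda>_::nat. 0::int}"
    by (intro card_mono) auto
  ultimately show ?case by simp
next
  case (Suc m)
  define E where "E = insert (\<lambda>_. 0) ((\<lambda>(c, s) i. if i = c then s else 0 :: int) ` ({..<P} \<times> {1, -1}))"
  have E: "finite E" "card E \<le> 2 * P + 1"
  proof -
    have "card ((\<lambda>(c, s) i. if i = c then s else 0 :: int) ` ({..<P} \<times> {1, -1})) \<le> card ({..<P} \<times> {1, -1::int})"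
      by (rule card_image_le) simp
    then show "card E \<le> 2 * P + 1"
      unfolding E_def by (subst card_insert_if) (auto simp: card_cartesian_product)
  qed (simp add: E_def)
  have "int_vectors P (Suc m) \<subseteq> (\<lambda>(q, e) i. q i + e i) ` (int_vectors P m \<times> E)"
  proof
    fix q assume q: "q \<in> int_vectors P (Suc m)"
    show "q \<in> (\<lambda>(q, e) i. q i + e i) ` (int_vectors P m \<times> E)"
    proof (cases "q \<in> int_vectors P m")
      case True
      then show ?thesis by (intro image_eqI[of _ _ "(q, \<lambda>_. 0)"]) (auto simp: E_def)
    next
      case False
      with q have "(\<Sum>c<P. \<bar>q c\<bar>) > 0" unfolding int_vectors_def by auto
      then obtain c where c: "c < P" "q c \<noteq> 0"
        by (metis abs_0 lessThan_iff less_irrefl sum.neutral)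
      define e where "e = (\<lambda>i. if i = c then sgn (q c) else 0)"
      have "sgn (q c) \<in> {1, -1}" using c by (auto simp: sgn_if)
      then have e: "e \<in> E" using c unfolding E_def e_def by force
      have "(\<Sum>i<P. \<bar>q i - e i\<bar>) = (\<Sum>i<P. \<bar>q i\<bar> - (if i = c then 1 else 0))"
        using c by (intro sum.cong refl) (auto simp: e_def sgn_if)
      also have "\<dots> = (\<Sum>i<P. \<bar>q i\<bar>) - 1" using c by (simp add: sum_subtractf)
      finally have "(\<lambda>i. q i - e i) \<in> int_vectors P m"
        using q c unfolding int_vectors_def by (auto simp: e_def)
      with e show ?thesis by (intro image_eqI[of _ _ "(\<lambda>i. q i - e i, e)"]) auto
    qed
  qed
  moreover have "finite (int_vectors P m \<times> E)" using Suc E by simp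
  moreover have "card (int_vectors P m \<times> E) \<le> (2 * P + 1) ^ Suc m"
    using Suc E mult_le_mono[of "card (int_vectors P m)" "(2 * P + 1) ^ m" "card E" "2 * P + 1"]
    by (simp add: card_cartesian_product mult.commute)
  ultimately show ?case
    using finite_subset[of "int_vectors P (Suc m)"] finite_imageI
      card_mono[of "(\<lambda>(q, e) i. q i + e i) ` (int_vectors P m \<times> E)" "int_vectors P (Suc m)"]
      card_image_le[of "int_vectors P m \<times> E" "\<lambda>(q, e) i. q i + e i"]
    by (metis (no_types, lifting) order_trans)
qed

text \<open>Hoeffding's inequality for the real and the imaginary part, each a sum of
  \<open>P\<close> independent terms in [-1, 1]; the factor 4 counts two parts with two tails
  each.\<close>

lemma exponential_sum_deviation:
  fixes b :: "nat \<Rightarrow> real"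
  assumes P: "0 < P" and \<eta>: "0 < \<eta>"
  defines "\<Omega> \<equiv> PiM {..<P} (\<lambda>_. unit_law)"
  shows "measure \<Omega> {\<omega>\<in>space \<Omega>. cmod ((\<Sum>c<P. ex (b c + t * \<omega> c)) - (\<Sum>c<P. ex (b c) * psi t)) \<ge> 2 * P * \<eta>}
     \<le> 4 * exp (- (P * \<eta>\<^sup>2 / 2))"
proof -
  interpret \<Omega>: prob_space \<Omega> unfolding \<Omega>_def by (intro prob_space_PiM prob_space_unit_law)
  have ind: "\<Omega>.indep_vars (\<lambda>_. unit_law) (\<lambda>c \<omega>. \<omega> c) {..<P}"
    unfolding \<Omega>_def using P by (intro indep_vars_PiM_coordinates prob_space_unit_law) auto
  have coord: "distr \<Omega> unit_law (\<lambda>\<omega>. \<omega> c) = unit_law" if "c < P" for c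
    unfolding \<Omega>_def using that by (intro distr_PiM_component prob_space_unit_law) auto
  have main: "\<Omega>.prob {\<omega>\<in>space \<Omega>. \<bar>(\<Sum>c<P. h (ex (b c + t * \<omega> c))) - (\<Sum>c<P. h (ex (b c) * psi t))\<bar> \<ge> P * \<eta>}
      \<le> 2 * exp (- (P * \<eta>\<^sup>2 / 2))"
    if h: "bounded_linear h" "\<And>z. \<bar>h z\<bar> \<le> cmod z" for h :: "complex \<Rightarrow> real"
  proof -
    have hm [measurable]: "h \<in> borel_measurable borel"
      using h(1) by (simp add: borel_measurable_continuous_onI linear_continuous_on)
    define X where "X = (\<lambda>c \<omega>. h (ex (b c + t * \<omega> c)) :: real)"
    have int: "\<Omega>.expectation (X c) = h (ex (b c) * psi t)" if "c < P" for c
    proof -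
      have "\<Omega>.expectation (X c) = (\<integral>x. h (ex (b c + t * x)) \<partial>distr \<Omega> unit_law (\<lambda>\<omega>. \<omega> c))"
        unfolding X_def using that by (intro integral_distr[symmetric]) (auto simp: \<Omega>_def)
      also have "\<dots> = h (\<integral>x. ex (b c + t * x) \<partial>unit_law)"
        unfolding coord[OF that]
        by (rule integral_bounded_linear[OF h(1) integrable_unit_law_ex])
      finally show ?thesis by (simp add: integral_unit_law_ex)
    qed
    interpret H: Hoeffding_ineq \<Omega> "{..<P}" X "\<lambda>_. -1" "\<lambda>_. 1" "\<Sum>c<P. \<Omega>.expectation (X c)"
    proof unfold_locales
      show "\<Omega>.indep_vars (\<lambda>_. borel) X {..<P}"
        unfolding X_def by (rule \<Omega>.indep_vars_compose2[OF ind]) measurable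
      show "AE x in \<Omega>. X i x \<in> {-1..1}" for i
        using h(2)[of "ex (b i + t * _ i)"] by (intro AE_I2) (auto simp: X_def abs_le_iff)
    qed auto
    have "\<Omega>.prob {\<omega>\<in>space \<Omega>. \<bar>(\<Sum>c<P. X c \<omega>) - (\<Sum>c<P. \<Omega>.expectation (X c))\<bar> \<ge> P * \<eta>}
       \<le> 2 * exp (-2 * (P * \<eta>)\<^sup>2 / (\<Sum>c<P. (1 - - 1)\<^sup>2))"
      using P \<eta> by (intro H.Hoeffding_ineq_abs_ge) auto
    also have "-2 * (P * \<eta>)\<^sup>2 / (\<Sum>c<P. (1 - - 1)\<^sup>2) = - (P * \<eta>\<^sup>2 / 2)"
      using P by (simp add: power2_eq_square)
    also have "(\<Sum>c<P. \<Omega>.expectation (X c)) = (\<Sum>c<P. h (ex (b c) * psi t))"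
      by (intro sum.cong int) auto
    finally show ?thesis by (simp add: X_def)
  qed
  define D where "D = (\<lambda>h \<omega>. \<bar>(\<Sum>c<P. h (ex (b c + t * \<omega> c))) - (\<Sum>c<P. h (ex (b c) * psi t))\<bar> :: real)"
  have [measurable]: "{\<omega>\<in>space \<Omega>. P * \<eta> \<le> D Re \<omega>} \<in> sets \<Omega>" "{\<omega>\<in>space \<Omega>. P * \<eta> \<le> D Im \<omega>} \<in> sets \<Omega>"
    unfolding D_def \<Omega>_def by measurable
  have "{\<omega>\<in>space \<Omega>. cmod ((\<Sum>c<P. ex (b c + t * \<omega> c)) - (\<Sum>c<P. ex (b c) * psi t)) \<ge> 2 * P * \<eta>}
      \<subseteq> {\<omega>\<in>space \<Omega>. P * \<eta> \<le> D Re \<omega>} \<union> {\<omega>\<in>space \<Omega>. P * \<eta> \<le> D Im \<omega>}"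
  proof
    fix \<omega> assume \<omega>: "\<omega> \<in> {\<omega>\<in>space \<Omega>. cmod ((\<Sum>c<P. ex (b c + t * \<omega> c)) - (\<Sum>c<P. ex (b c) * psi t)) \<ge> 2 * P * \<eta>}"
    have "cmod ((\<Sum>c<P. ex (b c + t * \<omega> c)) - (\<Sum>c<P. ex (b c) * psi t)) \<le> D Re \<omega> + D Im \<omega>"
      unfolding D_def by (rule order_trans[OF cmod_le]) simp
    with \<omega> show "\<omega> \<in> {\<omega>\<in>space \<Omega>. P * \<eta> \<le> D Re \<omega>} \<union> {\<omega>\<in>space \<Omega>. P * \<eta> \<le> D Im \<omega>}"
      by auto
  qed
  then have "\<Omega>.prob {\<omega>\<in>space \<Omega>. cmod ((\<Sum>c<P. ex (b c + t * \<omega> c)) - (\<Sum>c<P. ex (b c) * psi t)) \<ge> 2 * P * \<eta>}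
      \<le> \<Omega>.prob ({\<omega>\<in>space \<Omega>. P * \<eta> \<le> D Re \<omega>} \<union> {\<omega>\<in>space \<Omega>. P * \<eta> \<le> D Im \<omega>})"
    by (intro \<Omega>.finite_measure_mono) auto
  also have "\<dots> \<le> \<Omega>.prob {\<omega>\<in>space \<Omega>. P * \<eta> \<le> D Re \<omega>} + \<Omega>.prob {\<omega>\<in>space \<Omega>. P * \<eta> \<le> D Im \<omega>}"
    by (intro measure_Un_le) auto
  also have "\<dots> \<le> 2 * exp (- (P * \<eta>\<^sup>2 / 2)) + 2 * exp (- (P * \<eta>\<^sup>2 / 2))"
    unfolding D_def
    by (intro add_mono main bounded_linear_Re bounded_linear_Im abs_Re_le_cmod abs_Im_le_cmod)
  finally show ?thesis by simp
qed

lemma cnj_psi: "cnj (psi t) = psi (- t)"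
proof -
  have "cnj (psi t) = (\<integral>x. cnj (ex (t * x)) \<partial>unit_law)"
    unfolding psi_def
    by (rule integral_bounded_linear[OF bounded_linear_cnj, symmetric])
       (use integrable_unit_law_ex[of 0 t] in simp)
  then show ?thesis by (simp add: psi_def)
qed

text \<open>Low frequencies hardly see the new width \<open>d'\<close>; high frequencies are already
  damped by the old width \<open>d\<close>. The border \<open>t * d' = eps / 13\<close> works
  because \<open>2 * pi / 13 < 1 / 2\<close>, and the constant \<open>26 = 2 * 13\<close> then
  forces \<open>t * d \<ge> 2 / eps\<close> beyond it.\<close>

lemma psi_product_bound:
  assumes t: "0 \<le> t" and d: "0 < d" "0 < d'" and eps: "0 < eps" and small: "d' \<le> d * eps\<^sup>2 / 26"
  shows "cmod (psi (t * d)) * cmod (1 - psi (t * d')) \<le> eps / 2"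
proof (cases "t * d' \<le> eps / 13")
  case True
  have "cmod (psi (t * d)) * cmod (1 - psi (t * d')) \<le> 1 * (2 * pi * (t * d'))"
    using cmod_psi_le_1[of "t * d"] cmod_1_minus_psi_le[of "t * d'"] t d
    by (intro mult_mono) auto
  also have "\<dots> \<le> 2 * pi * (eps / 13)" using mult_left_mono[OF True, of "2 * pi"] by simp
  also have "\<dots> \<le> 2 * 3.2 * (eps / 13)" using pi_approx eps by (intro mult_right_mono) auto
  also have "\<dots> \<le> eps / 2" using eps by simp
  finally show ?thesis .
next
  case False
  then have tpos: "0 < t" using t eps by (cases "t = 0") auto
  have "cmod (1 - psi (t * d')) \<le> 2"
    using norm_triangle_ineq4[of 1 "psi (t * d')"] cmod_psi_le_1[of "t * d'"] by simp
  then have "cmod (psi (t * d)) * cmod (1 - psi (t * d')) \<le> 1 / (pi * (t * d)) * 2"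
    using cmod_psi_le_inverse[of "t * d"] tpos d by (intro mult_mono) auto
  also have "\<dots> = 2 / pi * (1 / (t * d))" by simp
  also have "\<dots> \<le> 1 * (1 / (t * d))"
    using pi_gt3 tpos d by (intro mult_right_mono) auto
  also have "\<dots> \<le> eps / 2"
  proof -
    have "(eps / 13) * d \<le> t * d' * d" using False d by (intro mult_right_mono) auto
    also have "\<dots> \<le> t * (d * eps\<^sup>2 / 26) * d" using small tpos d by (intro mult_right_mono mult_left_mono) auto
    also have "\<dots> = (eps / 13) * d * (t * d * eps / 2)" by (simp add: power2_eq_square)
    finally have "1 \<le> t * d * eps / 2"
      using eps d mult_le_cancel_left_pos[of "(eps / 13) * d" 1 "t * d * eps / 2"] by simp
    then show ?thesis using tpos d by (simp add: field_simps)
  qed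
  finally show ?thesis .
qed

text \<open>Union bound: \<open>small\<close> adds up the probabilities of a large deviation at one
  of \<open>L\<close> frequencies and of an approximate relation for some \<open>q\<close> and
  \<open>z\<close>, while leaving [0, 1] has probability 0. Hence some \<open>\<omega>\<close>
  avoids all bad events.\<close>

lemma random_refinement:
  fixes b :: "nat \<Rightarrow> real" and P K L :: nat and d \<eta> D :: real
  assumes P: "0 < P" and d: "0 < d" and \<eta>: "0 < \<eta>" and D: "0 \<le> D" and Z: "finite Z"
    and small: "real L * (4 * exp (- (P * \<eta>\<^sup>2 / 2))) +
      real ((2 * P + 1) ^ (2 * K)) * (real (card Z) * (2 * (4 * K * D) / d)) < 1"
  obtains \<omega> :: "nat \<Rightarrow> real" where
    "\<And>c. c < P \<Longrightarrow> 0 \<le> \<omega> c \<and> \<omega> c \<le> 1"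
    "\<And>n::nat. 1 \<le> n \<Longrightarrow> n \<le> L \<Longrightarrow>
       cmod ((\<Sum>c<P. ex (n * (b c + d * \<omega> c))) - (\<Sum>c<P. ex (n * b c) * psi (n * d))) < 2 * P * \<eta>"
    "\<And>q z. q \<in> int_vectors P (2 * K) \<Longrightarrow> q \<noteq> (\<lambda>_. 0) \<Longrightarrow> z \<in> Z \<Longrightarrow>
       4 * K * D < \<bar>(\<Sum>c<P. of_int (q c) * (b c + d * \<omega> c)) - of_int z\<bar>"
proof -
  define \<Omega> where "\<Omega> = PiM {..<P} (\<lambda>_. unit_law)"
  interpret \<Omega>: prob_space \<Omega> unfolding \<Omega>_def by (intro prob_space_PiM prob_space_unit_law)
  define BF where "BF = (\<lambda>n::nat. {\<omega>\<in>space \<Omega>. cmod ((\<Sum>c<P. ex (n * b c + (n * d) * \<omega> c)) - (\<Sum>c<P. ex (n * b c) * psi (n * d))) \<ge> 2 * P * \<eta>})"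
  define BS where "BS = (\<lambda>(q::nat \<Rightarrow> int, z::int). {\<omega>\<in>space \<Omega>. \<bar>(\<Sum>c<P. of_int (q c) * (b c + d * \<omega> c)) - of_int z\<bar> \<le> 4 * K * D})"
  define BC where "BC = (\<lambda>c. {\<omega>\<in>space \<Omega>. \<omega> c \<notin> {0..1}})"
  define Q where "Q = int_vectors P (2 * K) - {\<lambda>_. 0}"
  have Q: "finite Q" "card Q \<le> (2 * P + 1) ^ (2 * K)"
    using card_int_vectors[of P "2 * K"] card_mono[of "int_vectors P (2 * K)" Q] by (auto simp: Q_def)
  have BF [measurable]: "BF n \<in> sets \<Omega>" for n unfolding BF_def \<Omega>_def by measurable
  have BS [measurable]: "BS qz \<in> sets \<Omega>" for qz unfolding BS_def \<Omega>_def by (cases qz) (simp, measurable)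
  have BC [measurable]: "BC c \<in> sets \<Omega>" if "c < P" for c
  proof -
    have [measurable]: "(\<lambda>\<omega>. \<omega> c) \<in> borel_measurable \<Omega>"
      using measurable_component_singleton[of c "{..<P}" "\<lambda>_. unit_law"] that by (simp add: \<Omega>_def)
    show ?thesis unfolding BC_def by measurable
  qed
  have "\<Omega>.prob (BF n) \<le> 4 * exp (- (P * \<eta>\<^sup>2 / 2))" for n
    using exponential_sum_deviation[OF P \<eta>, of "\<lambda>c. n * b c" "n * d"] unfolding BF_def \<Omega>_def by simp
  then have F: "\<Omega>.prob (\<Union>n\<in>{1..L}. BF n) \<le> L * (4 * exp (- (P * \<eta>\<^sup>2 / 2)))"
    by (intro order_trans[OF \<Omega>.finite_measure_subadditive_finite]
          order_trans[OF sum_bounded_above[where K = "4 * exp (- (P * \<eta>\<^sup>2 / 2))"]]) auto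
  have "\<Omega>.prob (BS qz) \<le> 2 * (4 * K * D) / d" if qz: "qz \<in> Q \<times> Z" for qz
  proof -
    obtain q z where qz': "qz = (q, z)" "q \<in> Q" using qz by auto
    then have "\<exists>c<P. q c \<noteq> 0"
      unfolding Q_def int_vectors_def by (auto simp: fun_eq_iff) (meson not_le)
    then show ?thesis
      using linear_form_small_prob[of _ P q d "4 * K * D" b "of_int z"] d D
      unfolding qz' BS_def \<Omega>_def by auto
  qed
  then have S: "\<Omega>.prob (\<Union>qz\<in>Q \<times> Z. BS qz) \<le> card (Q \<times> Z) * (2 * (4 * K * D) / d)"
    using Q Z by (intro order_trans[OF \<Omega>.finite_measure_subadditive_finite]
          order_trans[OF sum_bounded_above[where K = "2 * (4 * K * D) / d"]]) auto
  also have "\<dots> \<le> real ((2 * P + 1) ^ (2 * K)) * (real (card Z) * (2 * (4 * K * D) / d))"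
    unfolding card_cartesian_product of_nat_mult mult.assoc
    using Q d D by (intro mult_right_mono) (auto simp del: of_nat_power)
  finally have S: "\<Omega>.prob (\<Union>qz\<in>Q \<times> Z. BS qz)
      \<le> real ((2 * P + 1) ^ (2 * K)) * (real (card Z) * (2 * (4 * K * D) / d))" .
  have C0: "\<Omega>.prob (BC c) = 0" if c: "c < P" for c
  proof -
    have "AE x in \<Omega>. x c \<in> {0..1}"
      unfolding \<Omega>_def using c by (intro AE_PiM_component prob_space_unit_law AE_unit_law) auto
    then have "AE x in \<Omega>. x \<notin> BC c" by eventually_elim (auto simp: BC_def)
    then show ?thesis using BC[OF c] by (simp add: \<Omega>.prob_eq_0)
  qed
  have C: "\<Omega>.prob (\<Union>c\<in>{..<P}. BC c) \<le> 0"
    using C0 by (intro order_trans[OF \<Omega>.finite_measure_subadditive_finite]) auto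
  define Bad where "Bad = (\<Union>n\<in>{1..L}. BF n) \<union> (\<Union>qz\<in>Q \<times> Z. BS qz) \<union> (\<Union>c\<in>{..<P}. BC c)"
  have mb: "(\<Union>n\<in>{1..L}. BF n) \<in> sets \<Omega>" "(\<Union>qz\<in>Q \<times> Z. BS qz) \<in> sets \<Omega>" "(\<Union>c\<in>{..<P}. BC c) \<in> sets \<Omega>"
    using Q Z BF BS BC by (auto intro!: sets.finite_UN)
  have "\<Omega>.prob Bad \<le> \<Omega>.prob (\<Union>n\<in>{1..L}. BF n) + \<Omega>.prob (\<Union>qz\<in>Q \<times> Z. BS qz) + \<Omega>.prob (\<Union>c\<in>{..<P}. BC c)"
    unfolding Bad_def using mb
    by (intro order_trans[OF measure_Un_le] add_mono order_refl) auto
  also have "\<dots> < 1" using F S C small by linarith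
  finally have "\<Omega>.prob Bad < 1" .
  then have "\<not> space \<Omega> \<subseteq> Bad"
    using mb \<Omega>.finite_measure_mono[of "space \<Omega>" Bad] \<Omega>.prob_space unfolding Bad_def by auto
  then obtain \<omega> where \<omega>: "\<omega> \<in> space \<Omega>" "\<omega> \<notin> Bad" by blast
  show thesis
  proof (rule that[of \<omega>])
    show "0 \<le> \<omega> c \<and> \<omega> c \<le> 1" if "c < P" for c
      using \<omega> that unfolding Bad_def BC_def by auto
    show "cmod ((\<Sum>c<P. ex (n * (b c + d * \<omega> c))) - (\<Sum>c<P. ex (n * b c) * psi (n * d))) < 2 * P * \<eta>"
      if "1 \<le> n" "n \<le> L" for n :: nat
    proof -
      have "\<omega> \<notin> BF n" using \<omega> that unfolding Bad_def by auto
      then show ?thesis using \<omega> unfolding BF_def by (simp add: distrib_left mult.assoc not_le)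
    qed
    show "4 * K * D < \<bar>(\<Sum>c<P. of_int (q c) * (b c + d * \<omega> c)) - of_int z\<bar>"
      if "q \<in> int_vectors P (2 * K)" "q \<noteq> (\<lambda>_. 0)" "z \<in> Z" for q z
    proof -
      have "\<omega> \<notin> BS (q, z)" using \<omega> that unfolding Bad_def Q_def by auto
      then show ?thesis using \<omega> unfolding BS_def by (simp add: not_le)
    qed
  qed
qed

text \<open>An exponential beats a polynomial. The choice \<open>k = \<eta>^2 / 4\<close> gives
  \<open>P * \<eta>^2 / 2 = k * (2 * P + 1) - k\<close>, which expresses everything through
  \<open>2 * P + 1\<close>.\<close>

lemma refinement_bound_tendsto_0:
  fixes c1 c2 :: real
  assumes \<eta>: "0 < \<eta>"
  shows "(\<lambda>P::nat. c1 / (2 * real P + 1) + (c2 * (2 * real P + 1) ^ m + 1) * (4 * exp (- (real P * \<eta>\<^sup>2 / 2)))) \<longlonglongrightarrow> 0"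
proof -
  define k where "k = \<eta>\<^sup>2 / 4"
  have k: "0 < k" using \<eta> by (simp add: k_def)
  have top: "filterlim (\<lambda>P::nat. 2 * real P + 1) at_top sequentially" by real_asymp
  have topk: "filterlim (\<lambda>P::nat. k * (2 * real P + 1)) at_top sequentially"
    by (rule filterlim_tendsto_pos_mult_at_top[OF tendsto_const k top])
  have pw: "(\<lambda>P::nat. (k * (2 * real P + 1)) ^ j / exp (k * (2 * real P + 1))) \<longlonglongrightarrow> 0" for j
    by (rule filterlim_compose[OF tendsto_power_div_exp_0 topk])
  have "(\<lambda>P::nat. c1 / (2 * real P + 1)
      + 4 * exp k * (c2 / k ^ m * ((k * (2 * real P + 1)) ^ m / exp (k * (2 * real P + 1)))
        + (k * (2 * real P + 1)) ^ 0 / exp (k * (2 * real P + 1)))) \<longlonglongrightarrow> 0 + 4 * exp k * (c2 / k ^ m * 0 + 0)"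
    by (intro tendsto_intros pw tendsto_divide_0[OF tendsto_const] filterlim_at_top_imp_at_infinity top)
  moreover have "exp (- (real P * \<eta>\<^sup>2 / 2)) = exp k / exp (k * (2 * real P + 1))" for P
    by (simp add: exp_diff[symmetric] k_def algebra_simps)
  moreover have "(c2 * x ^ m + 1) * (4 * (exp k / E))
      = 4 * exp k * (c2 / k ^ m * ((k * x) ^ m / E) + (k * x) ^ 0 / E)" for x E
    using k by (simp add: power_mult_distrib add_divide_distrib distrib_left distrib_right)
  ultimately show ?thesis by simp
qed

text \<open>The new width \<open>D P\<close> is smaller by one power of \<open>2 * P + 1\<close>
  than the reciprocal of the number of relations, so approximate relations become improbable. The
  number \<open>L P\<close> of frequencies to watch is still polynomial in \<open>P\<close>, so
  Hoeffding's bound wins as well; frequencies above \<open>L P\<close> are damped by the new width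
  itself.\<close>

lemma cell_refinement:
  fixes a :: "nat \<Rightarrow> real" and K N :: nat and d eps :: real
  assumes N: "0 < N" and d: "0 < d" and eps: "0 < eps"
  obtains M :: nat and d' :: real and a' :: "nat \<Rightarrow> real" where "2 \<le> M" "0 < d'" "d' \<le> d / 2" "d' \<le> eps"
    "\<And>c. c < N * M \<Longrightarrow> a (c div M) \<le> a' c \<and> a' c \<le> a (c div M) + d"
    "\<And>n::int. cmod ((\<Sum>c<N * M. ex (n * a' c)) / of_nat (N * M) * psi (n * d')
        - (\<Sum>j<N. ex (n * a j)) / of_nat N * psi (n * d)) \<le> eps"
    "\<And>q z. q \<in> int_vectors (N * M) (2 * K) \<Longrightarrow> q \<noteq> (\<lambda>_. 0) \<Longrightarrow>
       4 * K * d' < \<bar>(\<Sum>c<N * M. of_int (q c) * a' c) - of_int z\<bar>"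
proof -
  define A where "A = (\<Sum>j<N. \<bar>a j\<bar>) + d"
  \<comment> \<open>Chosen so that a deviation of \<open>2 * P * \<eta>\<close> becomes
    \<open>eps / 2\<close> after division by \<open>P\<close>.\<close>
  define \<eta> where "\<eta> = eps / 4"
  \<comment> \<open>The entry \<open>d * eps^2 / 26\<close> is the hypothesis of
    \<open>psi_product_bound\<close>; the entry 1 serves the integers outside
    \<open>Z\<close>.\<close>
  define d0 where "d0 = min (min (d / 2) eps) (min 1 (d * eps\<^sup>2 / 26))"
  define D where "D = (\<lambda>P::nat. d0 / (2 * real P + 1) ^ (2 * K + 1))"
  \<comment> \<open>A relation of norm at most \<open>2 * K\<close> takes a value of size at most
    \<open>2 * K * A\<close>. Integers beyond \<open>zb\<close> are therefore more than
    \<open>4 * K\<close> away from it, and only finitely many need a probability estimate.\<close>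
  define zb where "zb = nat \<lceil>2 * K * A + 4 * K\<rceil>"
  define Z where "Z = {- int zb..int zb}"
  \<comment> \<open>Beyond this frequency \<open>cmod (psi (n * D P)) \<le> eps / 4\<close>, which
    suffices together with the trivial bound 2 for the deviation.\<close>
  define L where "L = (\<lambda>P. nat \<lceil>4 / (D P * eps)\<rceil>)"
  have \<eta>: "0 < \<eta>" and d0: "0 < d0" using eps d by (auto simp: \<eta>_def d0_def)
  have D: "0 < D P" "D P \<le> d0" for P
  proof -
    have y: "1 \<le> (2 * real P + 1) ^ (2 * K + 1)" by (rule one_le_power) simp
    then have "0 < (2 * real P + 1) ^ (2 * K + 1)" by linarith
    with d0 show "0 < D P" unfolding D_def by (rule divide_pos_pos)
    show "D P \<le> d0" unfolding D_def using divide_left_mono[OF y, of d0] d0 by simp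
  qed
  define c1 where "c1 = real (card Z) * (8 * K * d0 / d)"
  define c2 where "c2 = 4 / (d0 * eps)"
  have total: "real (L P) * (4 * exp (- (P * \<eta>\<^sup>2 / 2))) +
      real ((2 * P + 1) ^ (2 * K)) * (real (card Z) * (2 * (4 * K * D P) / d))
     \<le> c1 / (2 * real P + 1) + (c2 * (2 * real P + 1) ^ (2 * K + 1) + 1) * (4 * exp (- (real P * \<eta>\<^sup>2 / 2)))" for P :: nat
  proof -
    have "real (L P) \<le> 4 / (D P * eps) + 1"
    proof -
      have "0 < 4 / (D P * eps)" using D[of P] eps by simp
      then show ?thesis unfolding L_def by linarith
    qed
    also have "4 / (D P * eps) = c2 * (2 * real P + 1) ^ (2 * K + 1)"
      by (simp add: D_def c2_def)
    finally have L: "real (L P) \<le> c2 * (2 * real P + 1) ^ (2 * K + 1) + 1" .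
    have "real ((2 * P + 1) ^ (2 * K)) * D P = d0 / (2 * real P + 1)"
    proof -
      have "y ^ (2 * K) * (d0 / y ^ (2 * K + 1)) = d0 / y" if "y \<noteq> 0" for y
        using that by simp
      from this[of "2 * real P + 1"] show ?thesis by (simp add: D_def add.commute)
    qed
    then have "(real ((2 * P + 1) ^ (2 * K)) * D P) * (real (card Z) * (8 * K / d))
        = (d0 / (2 * real P + 1)) * (real (card Z) * (8 * K / d))"
      by (rule arg_cong[of _ _ "\<lambda>x. x * (real (card Z) * (8 * K / d))"])
    then have S: "real ((2 * P + 1) ^ (2 * K)) * (real (card Z) * (2 * (4 * K * D P) / d)) = c1 / (2 * real P + 1)"
      by (simp add: c1_def mult_ac)
    have "real (L P) * (4 * exp (- (P * \<eta>\<^sup>2 / 2)))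
        \<le> (c2 * (2 * real P + 1) ^ (2 * K + 1) + 1) * (4 * exp (- (P * \<eta>\<^sup>2 / 2)))"
      by (rule mult_right_mono[OF L]) simp
    then show ?thesis unfolding S by (simp only: add.commute[of "c1 / (2 * real P + 1)"] add_right_mono)
  qed
  have "eventually (\<lambda>P. c1 / (2 * real P + 1) + (c2 * (2 * real P + 1) ^ (2 * K + 1) + 1) * (4 * exp (- (real P * \<eta>\<^sup>2 / 2))) < 1) sequentially"
    by (rule order_tendstoD(2)[OF refinement_bound_tendsto_0[OF \<eta>]]) simp
  then obtain P0 where P0: "\<And>P. P \<ge> P0 \<Longrightarrow>
      c1 / (2 * real P + 1) + (c2 * (2 * real P + 1) ^ (2 * K + 1) + 1) * (4 * exp (- (real P * \<eta>\<^sup>2 / 2))) < 1"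
    by (auto simp: eventually_sequentially)
  define M where "M = max 2 P0"
  define P where "P = N * M"
  have M: "2 \<le> M" and P: "0 < P" "P0 \<le> P"
  proof -
    have "1 * max 2 P0 \<le> N * max 2 P0" by (rule mult_le_mono1) (use N in simp)
    then have "max 2 P0 \<le> N * max 2 P0" by (simp only: mult_1)
    moreover from this have "P0 \<le> N * max 2 P0" by (rule order_trans[OF max.cobounded2])
    ultimately show "2 \<le> M" "0 < P" "P0 \<le> P" using N unfolding M_def P_def by auto
  qed
  define b where "b = (\<lambda>c. a (c div M))"
  obtain \<omega> :: "nat \<Rightarrow> real" where
    \<omega>: "\<And>c. c < P \<Longrightarrow> 0 \<le> \<omega> c \<and> \<omega> c \<le> 1"
    and F: "\<And>n::nat. 1 \<le> n \<Longrightarrow> n \<le> L P \<Longrightarrow>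
       cmod ((\<Sum>c<P. ex (n * (b c + d * \<omega> c))) - (\<Sum>c<P. ex (n * b c) * psi (n * d))) < 2 * P * \<eta>"
    and S: "\<And>q z. q \<in> int_vectors P (2 * K) \<Longrightarrow> q \<noteq> (\<lambda>_. 0) \<Longrightarrow> z \<in> Z \<Longrightarrow>
       4 * K * D P < \<bar>(\<Sum>c<P. of_int (q c) * (b c + d * \<omega> c)) - of_int z\<bar>"
  proof (rule random_refinement[OF P(1) d \<eta>, of "D P" Z "L P" K b])
    show "real (L P) * (4 * exp (- (P * \<eta>\<^sup>2 / 2))) +
      real ((2 * P + 1) ^ (2 * K)) * (real (card Z) * (2 * (4 * K * D P) / d)) < 1"
      using total[of P] P0[OF P(2)] by linarith
  qed (use D[of P] in \<open>auto simp: Z_def\<close>)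
  define a' where "a' = (\<lambda>c. b c + d * \<omega> c)"
  have a': "a (c div M) \<le> a' c \<and> a' c \<le> a (c div M) + d" if "c < P" for c
    using \<omega>[OF that] d by (auto simp: a'_def b_def mult_left_le)
  have grp: "(\<Sum>c<P. f (c div M)) = of_nat M * (\<Sum>j<N. f j)" for f :: "nat \<Rightarrow> complex"
  proof -
    have "(\<Sum>c<P. f (c div M)) = (\<Sum>j<N. \<Sum>c\<in>{j * M..<j * M + M}. f (c div M))"
      unfolding P_def by (rule sum.nat_group[symmetric])
    also have "\<dots> = (\<Sum>j<N. \<Sum>c\<in>{j * M..<j * M + M}. f j)"
      using M by (intro sum.cong refl arg_cong[of _ _ f])
        (auto simp: div_nat_eqI mult.commute)
    finally show ?thesis by (simp add: sum_distrib_left)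
  qed
  define T where "T = (\<lambda>n::real. (\<Sum>c<N * M. ex (n * a' c)) / of_nat (N * M) * psi (n * D P)
        - (\<Sum>j<N. ex (n * a j)) / of_nat N * psi (n * d))"
  have T1: "cmod (T (real n)) \<le> eps" if n: "1 \<le> n" for n :: nat
  proof -
    define av where "av = (\<Sum>c<P. ex (n * a' c)) / of_nat P"
    define \<mu> where "\<mu> = (\<Sum>j<N. ex (n * a j)) / of_nat N * psi (n * d)"
    have \<mu>: "\<mu> = (\<Sum>c<P. ex (n * b c) * psi (n * d)) / of_nat P"
    proof -
      have "(\<Sum>c<P. ex (n * b c)) = of_nat M * (\<Sum>j<N. ex (n * a j))"
        unfolding b_def by (rule grp)
      then show ?thesis using M by (simp add: \<mu>_def P_def sum_distrib_right[symmetric])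
    qed
    have avg: "cmod ((\<Sum>i\<in>{..<k}. ex (f i)) / of_nat k) \<le> 1" for k and f :: "nat \<Rightarrow> real"
      using norm_sum[of "\<lambda>i. ex (f i)" "{..<k}"] by (cases "k = 0") (auto simp: norm_divide divide_le_eq)
    have \<mu>1: "cmod \<mu> \<le> cmod (psi (n * d))"
      unfolding \<mu>_def norm_mult using avg[of "\<lambda>j. n * a j" N] by (intro mult_left_le_one_le) auto
    have 1: "cmod (av - \<mu>) * cmod (psi (n * D P)) \<le> eps / 2"
    proof (cases "n \<le> L P")
      case True
      have "cmod (av - \<mu>) = cmod ((\<Sum>c<P. ex (n * a' c)) - (\<Sum>c<P. ex (n * b c) * psi (n * d))) / P"
        unfolding av_def \<mu> diff_divide_distrib[symmetric] norm_divide by simp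
      also have "\<dots> \<le> 2 * P * \<eta> / P"
        using F[OF n True] by (intro divide_right_mono) (auto simp: a'_def)
      also have "\<dots> = eps / 2" using P by (simp add: \<eta>_def)
      finally show ?thesis
        using mult_mono[of "cmod (av - \<mu>)" "eps / 2" "cmod (psi (n * D P))" 1] cmod_psi_le_1 eps by simp
    next
      case False
      have "cmod (av - \<mu>) \<le> 2"
        using norm_triangle_ineq4[of av \<mu>] avg[of "\<lambda>c. n * a' c" P] \<mu>1 cmod_psi_le_1[of "n * d"]
        unfolding av_def by linarith
      moreover have "cmod (psi (n * D P)) \<le> eps / 4"
      proof -
        have "4 / (D P * eps) < n"
          using False unfolding L_def not_le by linarith
        then have "4 / eps \<le> n * D P" using D[of P] eps by (simp add: field_simps)
        moreover have "n * D P \<le> pi * (n * D P)"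
          using pi_gt3 D[of P] mult_right_mono[of 1 pi "n * D P"] by simp
        ultimately have "4 / eps \<le> pi * (n * D P)" by linarith
        then have "1 / (pi * (n * D P)) \<le> 1 / (4 / eps)"
          using eps D[of P] n by (intro divide_left_mono mult_pos_pos) auto
        then show ?thesis
          using cmod_psi_le_inverse[of "n * D P"] D[of P] n by simp
      qed
      ultimately have "cmod (av - \<mu>) * cmod (psi (n * D P)) \<le> 2 * (eps / 4)"
        by (intro mult_mono) auto
      then show ?thesis by simp
    qed
    have 2: "cmod \<mu> * cmod (psi (n * D P) - 1) \<le> eps / 2"
    proof -
      have "cmod \<mu> * cmod (psi (n * D P) - 1) \<le> cmod (psi (n * d)) * cmod (1 - psi (n * D P))"
        using \<mu>1 by (simp add: norm_minus_commute mult_right_mono)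
      also have "\<dots> \<le> eps / 2"
        using D[of P] by (intro psi_product_bound d eps) (auto simp: d0_def)
      finally show ?thesis .
    qed
    have "T (real n) = av * psi (n * D P) - \<mu>"
      by (simp add: T_def av_def \<mu>_def P_def)
    \<comment> \<open>The first summand is the sampling error; the second is the cost of giving the
      points the width \<open>D P\<close>, controlled through the factor \<open>psi (n * d)\<close>
      contained in \<open>\<mu>\<close>.\<close>
    also have "\<dots> = (av - \<mu>) * psi (n * D P) + \<mu> * (psi (n * D P) - 1)"
      by (simp add: algebra_simps)
    finally have "T (real n) = (av - \<mu>) * psi (n * D P) + \<mu> * (psi (n * D P) - 1)" .
    then have "cmod (T (real n)) \<le> cmod (av - \<mu>) * cmod (psi (n * D P)) + cmod \<mu> * cmod (psi (n * D P) - 1)"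
      using norm_triangle_ineq[of "(av - \<mu>) * psi (n * D P)" "\<mu> * (psi (n * D P) - 1)"]
      by (simp add: norm_mult)
    with 1 2 show ?thesis by simp
  qed
  have T0: "T 0 = 0" using N M by (simp add: T_def)
  have Tm: "T (- x) = cnj (T x)" for x
    by (simp add: T_def cnj_psi)
  have Tn: "cmod (T (real_of_int n)) \<le> eps" for n
  proof (cases n rule: int_cases3)
    case zero
    then show ?thesis using T0 eps by simp
  next
    case (pos k)
    then show ?thesis using T1[of k] by simp
  next
    case (neg k)
    then show ?thesis using T1[of k] Tm[of "real k"] by simp
  qed
  show thesis
  proof (rule that[of M "D P" a'])
    show "2 \<le> M" "0 < D P" by (rule M, rule D)
    show "D P \<le> d / 2" "D P \<le> eps" using D[of P] by (auto simp: d0_def)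
    show "a (c div M) \<le> a' c \<and> a' c \<le> a (c div M) + d" if "c < N * M" for c
      using a' that by (simp add: P_def)
    show "cmod ((\<Sum>c<N * M. ex (n * a' c)) / of_nat (N * M) * psi (n * D P)
        - (\<Sum>j<N. ex (n * a j)) / of_nat N * psi (n * d)) \<le> eps" for n :: int
      using Tn[of n] by (simp add: T_def)
    show "4 * K * D P < \<bar>(\<Sum>c<N * M. of_int (q c) * a' c) - of_int z\<bar>"
      if q: "q \<in> int_vectors (N * M) (2 * K)" "q \<noteq> (\<lambda>_. 0)" for q z
    proof (cases "z \<in> Z")
      case True
      then show ?thesis using S[of q z] q by (simp add: P_def a'_def)
    next
      case False
      have A: "\<bar>a' c\<bar> \<le> A" if "c < P" for c
      proof -
        have "c div M < N" using that M by (simp add: P_def less_mult_imp_div_less)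
        then have "\<bar>a (c div M)\<bar> \<le> (\<Sum>j<N. \<bar>a j\<bar>)" by (intro member_le_sum) auto
        then show ?thesis using a'[OF that] d by (auto simp: A_def)
      qed
      have A0: "0 \<le> A" using d by (auto simp: A_def intro!: add_nonneg_nonneg sum_nonneg)
      have "\<bar>\<Sum>c<P. of_int (q c) * a' c\<bar> \<le> (\<Sum>c<P. \<bar>of_int (q c)\<bar> * A)"
        by (rule order_trans[OF sum_abs]) (auto simp: abs_mult intro!: sum_mono mult_left_mono A)
      also have "\<dots> = of_int (\<Sum>c<P. \<bar>q c\<bar>) * A" by (simp add: sum_distrib_right)
      also have "\<dots> \<le> (2 * K) * A"
      proof (rule mult_right_mono[OF _ A0])
        have "(\<Sum>c<P. \<bar>q c\<bar>) \<le> int (2 * K)" using q by (simp add: int_vectors_def P_def)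
        then show "real_of_int (\<Sum>c<P. \<bar>q c\<bar>) \<le> real (2 * K)" by linarith
      qed
      finally have "\<bar>\<Sum>c<P. of_int (q c) * a' c\<bar> \<le> 2 * K * A" by simp
      moreover have "2 * K * A + 4 * K < \<bar>real_of_int z\<bar>"
      proof -
        have "int zb < \<bar>z\<bar>" using False unfolding Z_def by auto
        moreover have "2 * K * A + 4 * K \<le> real zb" unfolding zb_def by (rule real_nat_ceiling_ge)
        ultimately show ?thesis by linarith
      qed
      moreover have "4 * K * D P \<le> 4 * K"
        using D(2)[of P] by (simp add: d0_def mult_left_le)
      ultimately show ?thesis by (simp add: P_def)
    qed
  qed
qed

section \<open>Nested cells\<close>

lemma geometric_cauchy_limit:
  fixes f :: "nat \<Rightarrow> 'a :: banach"
  assumes f: "\<And>k. norm (f (Suc k) - f k) \<le> (1 / 2) ^ k"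
  obtains l where "f \<longlonglongrightarrow> l" "\<And>k. norm (l - f k) \<le> 2 * (1 / 2) ^ k"
proof -
  have bound: "norm (f (k + m) - f k) \<le> 2 * (1 / 2) ^ k - 2 * (1 / 2) ^ (k + m)" for k m
  proof (induction m)
    case (Suc m)
    have "norm (f (k + Suc m) - f k) \<le> norm (f (Suc (k + m)) - f (k + m)) + norm (f (k + m) - f k)"
      using norm_triangle_ineq[of "f (Suc (k + m)) - f (k + m)" "f (k + m) - f k"] by simp
    then show ?case using f[of "k + m"] Suc by simp
  qed simp
  have "Cauchy f"
  proof (rule CauchyI')
    fix e :: real assume "0 < e"
    then obtain k where k: "(1 / 2 :: real) ^ k < e / 2"
      using real_arch_pow_inv[of "e / 2" "1 / 2"] by auto
    have "norm (f m - f n) < e" if "m \<ge> k" "n > m" for m n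
    proof -
      have "norm (f n - f m) \<le> 2 * (1 / 2) ^ m - 2 * (1 / 2) ^ n"
        using bound[of m "n - m"] that by simp
      also have "\<dots> \<le> 2 * (1 / 2) ^ m" by simp
      also have "\<dots> \<le> 2 * (1 / 2) ^ k" using that by (simp add: power_decreasing)
      finally show ?thesis using k by (simp add: norm_minus_commute)
    qed
    then show "\<exists>M. \<forall>m\<ge>M. \<forall>n>m. dist (f m) (f n) < e" unfolding dist_norm by blast
  qed
  then obtain l where l: "f \<longlonglongrightarrow> l" using Cauchy_convergent_iff convergent_def by blast
  have "norm (l - f k) \<le> 2 * (1 / 2) ^ k" for k
  proof (rule tendsto_upperbound)
    show "(\<lambda>n. norm (f n - f k)) \<longlonglongrightarrow> norm (l - f k)" by (intro tendsto_intros l)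
    show "eventually (\<lambda>n. norm (f n - f k) \<le> 2 * (1 / 2) ^ k) sequentially"
      using eventually_ge_at_top[of k]
    proof eventually_elim
      case (elim n)
      then have "norm (f n - f k) \<le> 2 * (1 / 2) ^ k - 2 * (1 / 2) ^ n"
        using bound[of k "n - k"] by simp
      moreover have "0 \<le> (1 / 2 :: real) ^ n" by (rule zero_le_power) simp
      ultimately show ?case by linarith
    qed
  qed simp
  with l show thesis by (rule that)
qed

definition cell_avg :: "nat \<Rightarrow> (nat \<Rightarrow> real) \<Rightarrow> int \<Rightarrow> complex" where
  "cell_avg N a n = (\<Sum>c<N. ex (n * a c)) / of_nat N"

text \<open>\<open>N k\<close> cells of width \<open>d k\<close> with left ends \<open>a k c\<close> at level \<open>k\<close>; cell \<open>c\<close> of level \<open>Suc k\<close> starts in cell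
  \<open>c div M k\<close> of level \<open>k\<close>. The factor \<open>4 * k\<close> in \<open>separated\<close> leaves room for moving the points of two
  configurations of complexity \<open>k\<close>, each by up to \<open>2 * d k\<close>, the largest distance to a descendant.\<close>

locale cells =
  fixes N M :: "nat \<Rightarrow> nat" and d :: "nat \<Rightarrow> real" and a :: "nat \<Rightarrow> nat \<Rightarrow> real"
  assumes N_0: "N 0 = 1" and N_Suc: "N (Suc k) = N k * M k" and M: "2 \<le> M k"
    and d_0: "d 0 = 1" and d_pos: "0 < d k" and d_Suc: "d (Suc k) \<le> d k / 2"
    and nested: "c < N (Suc k) \<Longrightarrow>
      a k (c div M k) \<le> a (Suc k) c \<and> a (Suc k) c \<le> a k (c div M k) + d k"
    and fourier: "cmod (cell_avg (N (Suc k)) (a (Suc k)) n * psi (n * d (Suc k))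
      - cell_avg (N k) (a k) n * psi (n * d k)) \<le> (1 / 2) ^ k"
    and separated: "q \<in> int_vectors (N k) (2 * k) \<Longrightarrow> q \<noteq> (\<lambda>_. 0) \<Longrightarrow>
      4 * k * d k < \<bar>(\<Sum>c<N k. of_int (q c) * a k c) - of_int z\<bar>"

text \<open>Dependent choice along \<open>cell_refinement\<close>. The tolerance
  \<open>(1 / 2) ^ k\<close> is summable uniformly in the frequency, and the complexity bound grows
  with the level, so that every relation is excluded eventually.\<close>

lemma cells_exist: "\<exists>N M d a. cells N M d a"
proof -
  define P where "P = (\<lambda>(k::nat) (N::nat, M::nat, d::real, a::nat \<Rightarrow> real). 0 < N \<and> 0 < d \<and> (k = 0 \<longrightarrow> N = 1 \<and> d = 1) \<and>
      (\<forall>q z. q \<in> int_vectors N (2 * k) \<longrightarrow> q \<noteq> (\<lambda>_. 0) \<longrightarrow> 4 * k * d < \<bar>(\<Sum>c<N. of_int (q c) * a c) - of_int z\<bar>))"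
  define R where "R = (\<lambda>(k::nat) (N::nat, M::nat, d::real, a::nat \<Rightarrow> real) (N'::nat, M'::nat, d'::real, a'::nat \<Rightarrow> real).
      N' = N * M' \<and> 2 \<le> M' \<and> d' \<le> d / 2 \<and>
      (\<forall>c<N'. a (c div M') \<le> a' c \<and> a' c \<le> a (c div M') + d) \<and>
      (\<forall>n::int. cmod (cell_avg N' a' n * psi (n * d') - cell_avg N a n * psi (n * d)) \<le> (1 / 2) ^ k))"
  have "\<exists>f. \<forall>k. P k (f k) \<and> R k (f k) (f (Suc k))"
  proof (rule dependent_nat_choice)
    \<comment> \<open>The only vector of complexity 0 is zero, so the separation clause is empty at
      level 0.\<close>
    have "q = (\<lambda>_. 0)" if "q \<in> int_vectors 1 0" for q
    proof
      fix c show "q c = 0" using that unfolding int_vectors_def by (cases c) auto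
    qed
    then show "\<exists>x. P 0 x" by (intro exI[of _ "(1, 1, 1, \<lambda>_. 0)"]) (auto simp: P_def)
  next
    fix x k assume "P k x"
    obtain N M d a where x: "x = (N, M, d, a)" by (cases x)
    have "0 < N" "0 < d" using \<open>P k x\<close> by (auto simp: P_def x)
    have pos: "0 < (1 / 2 :: real) ^ k" by simp
    obtain M' and d' :: real and a' :: "nat \<Rightarrow> real" where st: "2 \<le> M'" "0 < d'" "d' \<le> d / 2"
      "\<And>c. c < N * M' \<Longrightarrow> a (c div M') \<le> a' c \<and> a' c \<le> a (c div M') + d"
      "\<And>n::int. cmod ((\<Sum>c<N * M'. ex (n * a' c)) / of_nat (N * M') * psi (n * d')
        - (\<Sum>j<N. ex (n * a j)) / of_nat N * psi (n * d)) \<le> (1 / 2) ^ k"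
      "\<And>q z. q \<in> int_vectors (N * M') (2 * Suc k) \<Longrightarrow> q \<noteq> (\<lambda>_. 0) \<Longrightarrow>
       4 * Suc k * d' < \<bar>(\<Sum>c<N * M'. of_int (q c) * a' c) - of_int z\<bar>"
      by (rule cell_refinement[OF \<open>0 < N\<close> \<open>0 < d\<close> pos, of a "Suc k"]) (rule that; assumption)
    then show "\<exists>y. P (Suc k) y \<and> R k x y"
      using \<open>0 < N\<close> by (intro exI[of _ "(N * M', M', d', a')"]) (auto simp: P_def R_def x cell_avg_def)
  qed
  then obtain f where f: "\<And>k. P k (f k)" "\<And>k. R k (f k) (f (Suc k))" by blast
  \<comment> \<open>The record of level \<open>k + 1\<close> stores the factor by which level
    \<open>k\<close> was split, hence the \<open>Suc\<close> in \<open>M\<close> alone.\<close>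
  define N M d a where "N = (\<lambda>k. fst (f k))" and "M = (\<lambda>k. fst (snd (f (Suc k))))"
    and "d = (\<lambda>k. fst (snd (snd (f k))))" and "a = (\<lambda>k. snd (snd (snd (f k))))"
  have fk: "f k = (N k, fst (snd (f k)), d k, a k)" for k
    by (simp add: N_def d_def a_def)
  have P: "P k (N k, fst (snd (f k)), d k, a k)" for k using f(1)[of k] fk[of k] by simp
  have R: "R k (N k, fst (snd (f k)), d k, a k) (N (Suc k), M k, d (Suc k), a (Suc k))" for k
    using f(2)[of k] fk[of k] fk[of "Suc k"] by (simp add: M_def)
  have "cells N M d a"
  proof
    show "N 0 = 1" "d 0 = 1" using P[of 0] by (auto simp: P_def)
    show "N (Suc k) = N k * M k" "2 \<le> M k" "d (Suc k) \<le> d k / 2" for k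
      using R[of k] by (auto simp: R_def)
    show "0 < d k" for k using P[of k] by (auto simp: P_def)
    show "a k (c div M k) \<le> a (Suc k) c \<and> a (Suc k) c \<le> a k (c div M k) + d k" if "c < N (Suc k)" for c k
      using R[of k] that unfolding R_def by blast
    show "cmod (cell_avg (N (Suc k)) (a (Suc k)) n * psi (n * d (Suc k)) - cell_avg (N k) (a k) n * psi (n * d k)) \<le> (1 / 2) ^ k" for k n
      using R[of k] unfolding R_def by blast
    show "4 * k * d k < \<bar>(\<Sum>c<N k. of_int (q c) * a k c) - of_int z\<bar>"
      if "q \<in> int_vectors (N k) (2 * k)" "q \<noteq> (\<lambda>_. 0)" for q k z
    proof -
      have "real (4 * k) * d k < \<bar>(\<Sum>c<N k. of_int (q c) * a k c) - of_int z\<bar>"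
        using P[of k] that unfolding P_def by blast
      then show ?thesis by simp
    qed
  qed
  then show ?thesis by blast
qed

lemma sum_list_divide_distrib: "(\<Sum>x\<leftarrow>xs. f x) / c = (\<Sum>x\<leftarrow>xs. f x / c :: 'a :: field)"
  by (induction xs) (simp_all add: add_divide_distrib)

text \<open>Spectral representation: the variable of index \<open>n\<close> corresponds to the
  character \<open>ex (n * t)\<close> in L2 of \<sigma>, so this is the image of a linear
  combination of the process.\<close>

definition trig_list :: "(int \<times> real) list \<Rightarrow> real \<Rightarrow> complex" where
  "trig_list xs t = (\<Sum>(n, r)\<leftarrow>xs. of_real r * ex (of_int n * t))"

context cells
begin

lemma d_le: "d k \<le> (1 / 2) ^ k"
proof (induction k)
  case (Suc k)
  then show ?case using d_Suc[of k] by simp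
qed (simp add: d_0)

lemma d_tendsto_0: "d \<longlonglongrightarrow> 0"
proof (rule tendsto_sandwich[OF _ _ tendsto_const])
  show "(\<lambda>k. (1 / 2 :: real) ^ k) \<longlonglongrightarrow> 0" by (rule LIMSEQ_realpow_zero) auto
qed (use d_le d_pos in \<open>auto intro!: always_eventually less_imp_le\<close>)

lemma N_ge: "2 ^ k \<le> N k"
proof (induction k)
  case (Suc k)
  then show ?case using M[of k] mult_le_mono[of "2 ^ k" "N k" 2 "M k"] by (simp add: N_Suc mult.commute)
qed (simp add: N_0)

lemma N_pos [simp]: "0 < N k"
  using N_ge[of k] by (metis less_le_trans pos2 zero_less_power)

lemma N_at_top: "filterlim N at_top sequentially"
proof (rule filterlim_at_top_mono)
  show "filterlim (\<lambda>k. 2 ^ k :: nat) at_top sequentially"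
    by (rule filterlim_subseq) (auto simp: strict_mono_def)
qed (simp add: N_ge)

text \<open>The number of descendants at level \<open>L\<close> of a cell of level \<open>k\<close>;
  thus \<open>c div width k L\<close> is the ancestor of \<open>c\<close>.\<close>

definition width :: "nat \<Rightarrow> nat \<Rightarrow> nat" where "width k L = (\<Prod>i\<in>{k..<L}. M i)"

lemma width_pos [simp]: "0 < width k L"
  unfolding width_def using M by (intro prod_pos) (metis less_le_trans pos2)

lemma width_Suc: "k \<le> L \<Longrightarrow> width k (Suc L) = width k L * M L"
  by (simp add: width_def)

lemma N_width: "k \<le> L \<Longrightarrow> N L = N k * width k L"
proof (induction L rule: dec_induct)
  case base
  then show ?case by (simp add: width_def)
next
  case (step L)
  then show ?case by (simp add: N_Suc width_Suc)
qed

lemma ancestor_lt: "k \<le> L \<Longrightarrow> c < N L \<Longrightarrow> c div width k L < N k"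
  using N_width[of k L] by (simp add: less_mult_imp_div_less)

lemma ancestor_close:
  assumes "k \<le> L" "c < N L"
  shows "\<bar>a L c - a k (c div width k L)\<bar> \<le> 2 * d k"
proof -
  \<comment> \<open>The correction \<open>- 2 * d L\<close> closes the induction: the next level
    moves a point by at most \<open>d L\<close>, and
    \<open>d L \<le> 2 * d L - 2 * d (Suc L)\<close>.\<close>
  have "a k (c div width k L) \<le> a L c \<and> a L c \<le> a k (c div width k L) + 2 * d k - 2 * d L"
    using assms
  proof (induction L arbitrary: c rule: dec_induct)
    case base
    then show ?case by (simp add: width_def)
  next
    case (step L)
    define c' where "c' = c div M L"
    have c': "c' < N L" unfolding c'_def using step.prems by (simp add: N_Suc less_mult_imp_div_less)
    have "c' div width k L = c div width k (Suc L)"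
      using step.hyps by (simp add: c'_def width_Suc div_mult2_eq[symmetric] mult.commute)
    moreover have "a L c' \<le> a (Suc L) c \<and> a (Suc L) c \<le> a L c' + d L"
      using nested[OF step.prems] by (simp add: c'_def)
    ultimately show ?case using step.IH[OF c'] d_Suc[of L] by simp
  qed
  then show ?thesis using d_pos[of L] by simp
qed

text \<open>With the factor \<open>psi\<close> the averages change by at most
  \<open>(1 / 2) ^ k\<close> per level, hence converge; for fixed \<open>n\<close> this factor tends
  to 1 and may be dropped.\<close>

lemma gamma_exists: "\<exists>g. (\<lambda>k. cell_avg (N k) (a k) n) \<longlonglongrightarrow> g \<and>
   (\<forall>k. cmod (g - cell_avg (N k) (a k) n * psi (n * d k)) \<le> 2 * (1 / 2) ^ k)"
proof -
  obtain g where g: "(\<lambda>k. cell_avg (N k) (a k) n * psi (n * d k)) \<longlonglongrightarrow> g"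
    "\<And>k. cmod (g - cell_avg (N k) (a k) n * psi (n * d k)) \<le> 2 * (1 / 2) ^ k"
    by (rule geometric_cauchy_limit[of "\<lambda>k. cell_avg (N k) (a k) n * psi (n * d k)"]) (auto intro: fourier)
  have "(\<lambda>k. cell_avg (N k) (a k) n * (1 - psi (n * d k))) \<longlonglongrightarrow> 0"
  proof (rule Lim_null_comparison)
    have "cmod (cell_avg (N k) (a k) n) \<le> 1" for k
      using norm_sum[of "\<lambda>c. ex (n * a k c)" "{..<N k}"]
      by (auto simp: cell_avg_def norm_divide divide_le_eq)
    then show "eventually (\<lambda>k. cmod (cell_avg (N k) (a k) n * (1 - psi (n * d k))) \<le> 1 * (2 * pi * \<bar>n * d k\<bar>)) sequentially"
      unfolding norm_mult by (intro always_eventually allI mult_mono cmod_1_minus_psi_le) auto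
    have "(\<lambda>k. 1 * (2 * pi * \<bar>n * d k\<bar>)) \<longlonglongrightarrow> 1 * (2 * pi * \<bar>real_of_int n * 0\<bar>)"
      by (intro tendsto_intros d_tendsto_0)
    then show "(\<lambda>k. 1 * (2 * pi * \<bar>n * d k\<bar>)) \<longlonglongrightarrow> 0" by simp
  qed
  from tendsto_add[OF this g(1)] have "(\<lambda>k. cell_avg (N k) (a k) n) \<longlonglongrightarrow> g"
    by (simp add: right_diff_distrib)
  with g(2) show ?thesis by blast
qed

text \<open>The Fourier coefficients of \<sigma>.\<close>

definition gam :: "int \<Rightarrow> complex" where
  "gam n = (SOME g. (\<lambda>k. cell_avg (N k) (a k) n) \<longlonglongrightarrow> g \<and>
   (\<forall>k. cmod (g - cell_avg (N k) (a k) n * psi (n * d k)) \<le> 2 * (1 / 2) ^ k))"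

lemma gam: "(\<lambda>k. cell_avg (N k) (a k) n) \<longlonglongrightarrow> gam n"
   "cmod (gam n - cell_avg (N k) (a k) n * psi (n * d k)) \<le> 2 * (1 / 2) ^ k"
  using someI_ex[OF gamma_exists[of n]] unfolding gam_def by blast+

lemma gam_0: "gam 0 = 1"
proof -
  have "cell_avg (N k) (a k) 0 = 1" for k using N_pos[of k] by (simp add: cell_avg_def)
  then have "(\<lambda>k. cell_avg (N k) (a k) 0) \<longlonglongrightarrow> 1" by simp
  with gam(1)[of 0] show ?thesis by (rule LIMSEQ_unique)
qed

lemma gam_uminus: "gam (- n) = cnj (gam n)"
proof (rule LIMSEQ_unique[OF gam(1)])
  have "cell_avg (N k) (a k) (- n) = cnj (cell_avg (N k) (a k) n)" for k
    by (simp add: cell_avg_def)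
  then show "(\<lambda>k. cell_avg (N k) (a k) (- n)) \<longlonglongrightarrow> cnj (gam n)"
    by (simp add: lim_cnj gam(1))
qed

text \<open>Uniformly in the frequency, \<open>gam\<close> is within \<open>2 * (1 / 2) ^ k\<close>
  of the Fourier coefficient of a mixture of uniform laws on intervals of width \<open>d k\<close>,
  which decays like the reciprocal of the frequency.\<close>

lemma gam_tendsto_0: "(\<lambda>i::nat. gam (int i + m)) \<longlonglongrightarrow> 0"
proof (rule tendstoI)
  fix e :: real assume e: "0 < e"
  then obtain k where k: "(1 / 2 :: real) ^ k < e / 4"
    using real_arch_pow_inv[of "e / 4" "1 / 2"] by auto
  have "filterlim (\<lambda>i::nat. pi * \<bar>real_of_int (int i + m) * d k\<bar>) at_top sequentially"
  proof -
    have "filterlim (\<lambda>i::nat. pi * d k * \<bar>real_of_int (int i + m)\<bar>) at_top sequentially"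
    proof (rule filterlim_tendsto_pos_mult_at_top[OF tendsto_const])
      show "0 < pi * d k" using d_pos by simp
      show "filterlim (\<lambda>i::nat. \<bar>real_of_int (int i + m)\<bar>) at_top sequentially"
      proof (rule filterlim_at_top_mono)
        show "filterlim (\<lambda>i::nat. of_int m + real i) at_top sequentially"
          by (rule filterlim_tendsto_add_at_top[OF tendsto_const filterlim_real_sequentially])
      qed (auto intro!: always_eventually)
    qed
    then show ?thesis using d_pos[of k] by (simp add: abs_mult mult_ac)
  qed
  then have "eventually (\<lambda>i::nat. 2 / e < pi * \<bar>real_of_int (int i + m) * d k\<bar>) sequentially"
    by (simp add: filterlim_at_top_dense)
  then show "eventually (\<lambda>i::nat. dist (gam (int i + m)) 0 < e) sequentially"
  proof eventually_elim
    case (elim i)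
    define t where "t = real_of_int (int i + m) * d k"
    have pos: "0 < pi * \<bar>t\<bar>" using elim e less_trans[of 0 "2 / e"] by (simp add: t_def)
    have "cmod (cell_avg (N k) (a k) (int i + m)) \<le> 1"
      using norm_sum[of "\<lambda>c. ex ((int i + m) * a k c)" "{..<N k}"]
      by (auto simp: cell_avg_def norm_divide divide_le_eq)
    then have "cmod (cell_avg (N k) (a k) (int i + m) * psi t) \<le> cmod (psi t)"
      by (simp add: norm_mult mult_left_le_one_le)
    also have "\<dots> \<le> 1 / (pi * \<bar>t\<bar>)" using pos by (intro cmod_psi_le_inverse) auto
    also have "\<dots> < e / 2"
    proof -
      have "2 / e < pi * \<bar>t\<bar>" using elim by (simp only: t_def)
      then show ?thesis using e pos by (simp add: field_simps)
    qed
    finally have "cmod (gam (int i + m)) < e / 2 + 2 * (1 / 2) ^ k"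
      using gam(2)[of "int i + m" k] norm_triangle_ineq[of "gam (int i + m) - cell_avg (N k) (a k) (int i + m) * psi t" "cell_avg (N k) (a k) (int i + m) * psi t"]
      by (simp add: t_def)
    then show ?case using k by simp
  qed
qed

text \<open>The real part symmetrises \<sigma>, as the spectral measure of a real sequence requires;
  this is the origin of the labels of both signs.\<close>

definition cov :: "int \<Rightarrow> int \<Rightarrow> real" where "cov n m = Re (gam (n - m))"

lemma cov_sym: "cov n m = cov m n"
  using gam_uminus[of "m - n"] by (simp add: cov_def)

text \<open>For an atomic measure the form is an average of squared moduli. In the limit this yields
  both the positivity of \<open>cov\<close> and the isometry from linear combinations to
  trigonometric sums.\<close>

lemma quad_form_cell_avg:
  "quad_form (\<lambda>n m. Re (cell_avg (N k) (a k) (n - m))) xs = (\<Sum>c<N k. (cmod (trig_list xs (a k c)))\<^sup>2) / N k"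
proof -
  have sq: "complex_of_real ((cmod (trig_list xs t))\<^sup>2) = (\<Sum>(n, r)\<leftarrow>xs. \<Sum>(m, s)\<leftarrow>xs. of_real (r * s) * ex (of_int (n - m) * t))" for t
  proof -
    have "cnj (trig_list xs t) = (\<Sum>(m, s)\<leftarrow>xs. of_real s * ex (- (of_int m * t)))"
      unfolding trig_list_def by (induction xs) auto
    then have "complex_of_real ((cmod (trig_list xs t))\<^sup>2)
        = (\<Sum>(n, r)\<leftarrow>xs. of_real r * ex (of_int n * t)) * (\<Sum>(m, s)\<leftarrow>xs. of_real s * ex (- (of_int m * t)))"
      using complex_norm_square[of "trig_list xs t"] by (simp add: trig_list_def)
    also have "\<dots> = (\<Sum>(n, r)\<leftarrow>xs. \<Sum>(m, s)\<leftarrow>xs. (of_real r * ex (of_int n * t)) * (of_real s * ex (- (of_int m * t))))"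
      by (simp add: case_prod_unfold sum_list_mult_const sum_list_const_mult)
    also have "\<dots> = (\<Sum>(n, r)\<leftarrow>xs. \<Sum>(m, s)\<leftarrow>xs. of_real (r * s) * ex (of_int (n - m) * t))"
      by (intro arg_cong[of _ _ sum_list] map_cong refl)
         (auto simp: ex_add[symmetric] algebra_simps intro!: arg_cong[of _ _ sum_list] map_cong)
    finally show ?thesis .
  qed
  have Re_sum_list: "Re (sum_list zs) = sum_list (map Re zs)" for zs by (induction zs) auto
  have "(cmod (trig_list xs t))\<^sup>2 = (\<Sum>(n, r)\<leftarrow>xs. \<Sum>(m, s)\<leftarrow>xs. r * s * Re (ex (of_int (n - m) * t)))" for t
    using arg_cong[OF sq[of t], of Re]
    by (simp add: Re_sum_list o_def case_prod_unfold)
  then have "(\<Sum>c<N k. (cmod (trig_list xs (a k c)))\<^sup>2) / N k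
     = (\<Sum>c<N k. (\<Sum>(n, r)\<leftarrow>xs. \<Sum>(m, s)\<leftarrow>xs. r * s * Re (ex (of_int (n - m) * a k c)) / N k))"
    by (simp add: sum_divide_distrib case_prod_unfold sum_list_divide_distrib)
  also have "\<dots> = quad_form (\<lambda>n m. Re (cell_avg (N k) (a k) (n - m))) xs"
    by (simp add: quad_form_def cell_avg_def case_prod_unfold sum_list_sum_swap[symmetric]
        sum_distrib_left sum_divide_distrib Re_divide_of_nat)
  finally show ?thesis by simp
qed

lemma tendsto_sum_list:
  assumes "\<And>x. x \<in> set xs \<Longrightarrow> ((\<lambda>k. f k x) \<longlongrightarrow> (g x :: 'b :: topological_comm_monoid_add)) F"
  shows "((\<lambda>k. \<Sum>x\<leftarrow>xs. f k x) \<longlongrightarrow> (\<Sum>x\<leftarrow>xs. g x)) F"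
  using assms by (induction xs) (auto intro!: tendsto_add)

lemma quad_form_tendsto:
  "(\<lambda>k. (\<Sum>c<N k. (cmod (trig_list xs (a k c)))\<^sup>2) / N k) \<longlonglongrightarrow> quad_form cov xs"
  unfolding quad_form_cell_avg[symmetric] unfolding quad_form_def cov_def case_prod_unfold
  by (intro tendsto_sum_list tendsto_intros gam)

lemma quad_form_nonneg: "0 \<le> quad_form cov xs"
  by (rule tendsto_lowerbound[OF quad_form_tendsto]) (auto intro!: always_eventually sum_nonneg divide_nonneg_nonneg)

end

section \<open>Configurations on cells\<close>

text \<open>The prescribed values form a continuous function on a finite disjoint union of compact
  sets, and Tietze extends it without increasing the bound. The global bound serves the
  configurations whose eigenvalue lies in no prescribed arc or in a wrong one.\<close>

lemma trig_poly_interpolation: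
  fixes U :: "'i \<Rightarrow> complex set" and v :: "'i \<Rightarrow> complex"
  assumes I: "finite I" and U: "\<And>i. i \<in> I \<Longrightarrow> compact (U i)" "\<And>i. i \<in> I \<Longrightarrow> U i \<subseteq> sphere 0 1"
    and disj: "\<And>i j z. i \<in> I \<Longrightarrow> j \<in> I \<Longrightarrow> z \<in> U i \<Longrightarrow> z \<in> U j \<Longrightarrow> i = j"
    and v: "\<And>i. i \<in> I \<Longrightarrow> cmod (v i) \<le> B" and B: "0 \<le> B" and \<eta>: "0 < \<eta>"
  obtains A c where "finite A"
    "\<And>z. cmod z = 1 \<Longrightarrow> cmod (\<Sum>k\<in>A. c k * z powi (k::int)) \<le> B + \<eta>"
    "\<And>i z. i \<in> I \<Longrightarrow> z \<in> U i \<Longrightarrow> cmod ((\<Sum>k\<in>A. c k * z powi (k::int)) - v i) \<le> \<eta>"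
proof -
  define f where "f = (\<lambda>z. v (SOME i. i \<in> I \<and> z \<in> U i))"
  have f: "f z = v i" if "i \<in> I" "z \<in> U i" for i z
  proof -
    have "(SOME i. i \<in> I \<and> z \<in> U i) = i"
      using that disj by (intro some_equality) blast+
    then show ?thesis by (simp add: f_def)
  qed
  have cl: "closed (\<Union>i\<in>I. U i)" using I U by (intro closed_UN compact_imp_closed) auto
  have "continuous_on (\<Union>i\<in>I. U i) f"
  proof (rule continuous_on_closed_Union[OF I])
    show "closed (U i)" if "i \<in> I" for i using U that by (intro compact_imp_closed)
    show "continuous_on (U i) f" if "i \<in> I" for i
      using f[OF that] by (subst continuous_on_cong[OF refl, of _ _ "\<lambda>_. v i"]) auto
  qed
  then obtain g where g: "continuous_on UNIV g" "\<And>z. z \<in> (\<Union>i\<in>I. U i) \<Longrightarrow> g z = f z" "\<And>z. cmod (g z) \<le> B"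
  proof (rule Tietze[of _ f UNIV B])
    show "closedin (top_of_set UNIV) (\<Union>i\<in>I. U i)" using cl by simp
    show "norm (f z) \<le> B" if "z \<in> (\<Union>i\<in>I. U i)" for z using that f v by auto
  qed (use B in auto)
  have "continuous_on (sphere 0 1) g" using g(1) continuous_on_subset by blast
  then obtain A c where A: "finite A" "\<And>z. cmod z = 1 \<Longrightarrow> cmod ((\<Sum>k\<in>A. c k * z powi (k::int)) - g z) < \<eta>"
    by (rule trig_poly_approx[OF _ \<eta>]) blast
  show thesis
  proof (rule that[OF A(1)])
    fix z :: complex assume z: "cmod z = 1"
    show "cmod (\<Sum>k\<in>A. c k * z powi k) \<le> B + \<eta>"
      using norm_triangle_ineq[of "(\<Sum>k\<in>A. c k * z powi k) - g z" "g z"] A(2)[OF z] g(3)[of z] by simp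
  next
    fix i z assume i: "i \<in> I" "z \<in> U i"
    have "cmod z = 1" using U(2)[OF i(1)] i(2) by auto
    moreover have "g z = v i" using g(2)[of z] f[OF i] UN_I[of i I z U] i by simp
    ultimately show "cmod ((\<Sum>k\<in>A. c k * z powi k) - v i) \<le> \<eta>"
      using A(2)[of z] by simp
  qed
qed

text \<open>At most one label is nonzero, so the sum equals it and all other factors are
  \<open>g 0 = 1\<close>.\<close>

lemma prod_eq_apply_sum_single:
  fixes \<kappa> :: "'c \<Rightarrow> int" and g :: "int \<Rightarrow> 'b :: comm_monoid_mult"
  assumes "finite F" and "\<And>c c'. c \<in> F \<Longrightarrow> c' \<in> F \<Longrightarrow> c \<noteq> c' \<Longrightarrow> \<kappa> c = 0 \<or> \<kappa> c' = 0" and "g 0 = 1"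
  shows "g (\<Sum>c\<in>F. \<kappa> c) = (\<Prod>c\<in>F. g (\<kappa> c))"
  using assms(1,2)
proof (induction F rule: finite_induct)
  case (insert c F)
  show ?case
  proof (cases "\<kappa> c = 0")
    case True
    then show ?thesis using insert.IH insert.hyps insert.prems assms(3) by auto
  next
    case False
    then have "\<kappa> c' = 0" if "c' \<in> F" for c'
      using insert.prems[of c c'] insert.hyps that False by auto
    then show ?thesis using insert.hyps assms(3) by simp
  qed
qed (use assms in simp)

text \<open>\<open>h m\<close> and \<open>tt m\<close> are the one-particle amplitudes, at label \<open>m\<close>, of the vector to be approximated
  and of the cyclic vector.\<close>

locale spectral_data = cells +
  fixes h :: "int \<Rightarrow> real \<Rightarrow> complex" and tt q :: "int \<Rightarrow> real" and C T R :: real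
  assumes h_0: "h 0 t = 1" and h_le: "cmod (h m t) \<le> q m"
    and h_lipschitz: "cmod (h m s - h m t) \<le> q m * (C * \<bar>s - t\<bar>)"
    and tt_0: "tt 0 = 1" and tt_pos: "0 < tt m" and tt_le: "tt m \<le> q m"
    and q_0: "q 0 = 1" and q_le: "q m \<le> R * tt m" and R: "1 \<le> R" and C: "0 \<le> C" and T: "0 \<le> T"
    and q_sum: "(\<Sum>m\<in>{-K..K} - {0}. (1 + \<bar>real_of_int m\<bar>) * (q m)\<^sup>2) \<le> T"
begin

text \<open>A label \<open>m \<noteq> 0\<close> and its negative share the weight \<open>1 / N L\<close> of a cell.\<close>

definition wgt :: "nat \<Rightarrow> int \<Rightarrow> real" where
  "wgt L m = (if m = 0 then 1 else 1 / (2 * N L))"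

definition confs :: "nat \<Rightarrow> int \<Rightarrow> (nat \<Rightarrow> int) set" where
  "confs L K = PiE {..<N L} (\<lambda>_. {-K..K})"

definition conf_wgt :: "nat \<Rightarrow> (nat \<Rightarrow> int) \<Rightarrow> real" where
  "conf_wgt L \<kappa> = (\<Prod>c<N L. wgt L (\<kappa> c))"

definition conf_fun :: "nat \<Rightarrow> (nat \<Rightarrow> int) \<Rightarrow> complex" where
  "conf_fun L \<kappa> = (\<Prod>c<N L. h (\<kappa> c) (a L c))"

definition conf_tt :: "nat \<Rightarrow> (nat \<Rightarrow> int) \<Rightarrow> real" where
  "conf_tt L \<kappa> = (\<Prod>c<N L. tt (\<kappa> c))"

definition conf_q :: "nat \<Rightarrow> (nat \<Rightarrow> int) \<Rightarrow> real" where
  "conf_q L \<kappa> = (\<Prod>c<N L. q (\<kappa> c))"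

definition conf_pos :: "nat \<Rightarrow> (nat \<Rightarrow> int) \<Rightarrow> real" where
  "conf_pos L \<kappa> = (\<Sum>c<N L. of_int (\<kappa> c) * a L c)"

text \<open>This l1 norm, not the number of particles, is the quantity that \<open>separated\<close>
  bounds.\<close>

definition compl :: "nat \<Rightarrow> (nat \<Rightarrow> int) \<Rightarrow> int" where
  "compl L \<kappa> = (\<Sum>c<N L. \<bar>\<kappa> c\<bar>)"

text \<open>As \<open>q\<close> dominates both \<open>tt\<close> and \<open>h\<close>, this weight
  controls both vectors. It is a product weight resembling a Poisson law of particles, with moments
  bounded independently of \<open>L\<close> and \<open>K\<close>.\<close>

definition nu :: "nat \<Rightarrow> (nat \<Rightarrow> int) \<Rightarrow> real" where
  "nu L \<kappa> = conf_wgt L \<kappa> * (conf_q L \<kappa>)\<^sup>2"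

lemma q_pos: "0 < q m" using tt_pos[of m] tt_le[of m] by simp

lemma wgt_pos: "0 < wgt L m" by (simp add: wgt_def)

lemma conf_wgt_pos: "0 < conf_wgt L \<kappa>" unfolding conf_wgt_def by (intro prod_pos wgt_pos)
lemma conf_q_pos: "0 < conf_q L \<kappa>" unfolding conf_q_def by (intro prod_pos q_pos)
lemma conf_tt_pos: "0 < conf_tt L \<kappa>" unfolding conf_tt_def by (intro prod_pos tt_pos)
lemma conf_tt_le: "conf_tt L \<kappa> \<le> conf_q L \<kappa>"
  unfolding conf_tt_def conf_q_def by (intro prod_mono) (use tt_pos tt_le in \<open>auto intro: less_imp_le\<close>)
lemma conf_fun_le: "cmod (conf_fun L \<kappa>) \<le> conf_q L \<kappa>"
  unfolding conf_fun_def conf_q_def prod_norm[symmetric] by (intro prod_mono) (auto intro: h_le)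

text \<open>The sum factorises over the cells. A cell in \<open>D\<close> contributes at most
  \<open>T / (2 * N L)\<close> because \<open>f\<close> vanishes at label 0, every other cell at
  most \<open>1 + T / (2 * N L)\<close>, and the product of the latter is at most
  \<open>exp (T / 2)\<close>.\<close>

lemma nu_moment:
  assumes D: "D \<subseteq> {..<N L}" and f: "\<And>m. 0 \<le> f m" "f 0 = 0" "\<And>m. f m \<le> 1 + \<bar>real_of_int m\<bar>"
  shows "(\<Sum>\<kappa>\<in>confs L K. nu L \<kappa> * (\<Prod>c\<in>D. f (\<kappa> c))) \<le> exp (T / 2) * (T / (2 * N L)) ^ card D"
proof (cases "0 \<le> K")
  case False
  then have "confs L K = {}" unfolding confs_def by (intro PiE_eq_empty_iff[THEN iffD2]) (auto intro: exI[of _ 0])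
  then show ?thesis using T by simp
next
  case K: True
  define v where "v = (\<lambda>m. wgt L m * (q m)\<^sup>2)"
  have v: "0 \<le> v m" for m unfolding v_def using wgt_pos[of L m] by simp
  have split0: "(\<Sum>m\<in>{-K..K}. g m) = g 0 + (\<Sum>m\<in>{-K..K} - {0}. g m)" for g :: "int \<Rightarrow> real"
    using K by (subst sum.remove[of _ 0]) auto
  have s1: "(\<Sum>m\<in>{-K..K}. v m * f m) \<le> T / (2 * N L)"
  proof -
    have "(\<Sum>m\<in>{-K..K}. v m * f m) \<le> (\<Sum>m\<in>{-K..K} - {0}. (1 + \<bar>real_of_int m\<bar>) * (q m)\<^sup>2 / (2 * N L))"
    proof -
      have "v m * f m \<le> (1 + \<bar>real_of_int m\<bar>) * (q m)\<^sup>2 / (2 * N L)" if "m \<noteq> 0" for m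
        using mult_right_mono[OF f(3)[of m], of "(q m)\<^sup>2 / (2 * N L)"] that
        by (simp add: v_def wgt_def mult_ac)
      then show ?thesis unfolding split0 using f(2) by (auto intro!: sum_mono)
    qed
    also have "\<dots> \<le> T / (2 * N L)"
      unfolding sum_divide_distrib[symmetric] by (intro divide_right_mono q_sum) auto
    finally show ?thesis .
  qed
  have s2: "(\<Sum>m\<in>{-K..K}. v m) \<le> 1 + T / (2 * N L)"
  proof -
    have "(\<Sum>m\<in>{-K..K}. v m) \<le> 1 + (\<Sum>m\<in>{-K..K} - {0}. (1 + \<bar>real_of_int m\<bar>) * (q m)\<^sup>2 / (2 * N L))"
    proof -
      have "v m \<le> (1 + \<bar>real_of_int m\<bar>) * (q m)\<^sup>2 / (2 * N L)" if "m \<noteq> 0" for m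
        using mult_right_mono[of 1 "1 + \<bar>real_of_int m\<bar>" "(q m)\<^sup>2 / (2 * N L)"] that
        by (simp add: v_def wgt_def)
      moreover have "v 0 = 1" by (simp add: v_def wgt_def q_0)
      ultimately show ?thesis unfolding split0 by (auto intro!: sum_mono)
    qed
    also have "\<dots> \<le> 1 + T / (2 * N L)"
      unfolding sum_divide_distrib[symmetric] by (intro add_left_mono divide_right_mono q_sum) auto
    finally show ?thesis .
  qed
  have s3: "1 \<le> (\<Sum>m\<in>{-K..K}. v m)"
    unfolding split0 using v by (auto simp: v_def wgt_def q_0 intro!: sum_nonneg)
  have finD: "finite D" using D finite_subset by blast
  have "(\<Sum>\<kappa>\<in>confs L K. nu L \<kappa> * (\<Prod>c\<in>D. f (\<kappa> c)))
      = (\<Sum>\<kappa>\<in>confs L K. \<Prod>c<N L. v (\<kappa> c) * (if c \<in> D then f (\<kappa> c) else 1))"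
  proof (intro sum.cong refl)
    fix \<kappa>
    have "(\<Prod>c\<in>D. f (\<kappa> c)) = (\<Prod>c<N L. if c \<in> D then f (\<kappa> c) else 1)"
      using D by (subst prod.inter_restrict[symmetric]) (auto simp: Int_absorb1)
    then show "nu L \<kappa> * (\<Prod>c\<in>D. f (\<kappa> c)) = (\<Prod>c<N L. v (\<kappa> c) * (if c \<in> D then f (\<kappa> c) else 1))"
      by (simp add: nu_def conf_wgt_def conf_q_def v_def prod.distrib prod_power_distrib)
  qed
  also have "\<dots> = (\<Prod>c<N L. \<Sum>m\<in>{-K..K}. v m * (if c \<in> D then f m else 1))"
    unfolding confs_def by (rule prod_sum_PiE[symmetric]) auto
  also have "\<dots> = (\<Prod>c<N L. if c \<in> D then \<Sum>m\<in>{-K..K}. v m * f m else \<Sum>m\<in>{-K..K}. v m)"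
    by (intro prod.cong refl) auto
  also have "\<dots> = (\<Sum>m\<in>{-K..K}. v m * f m) ^ card D * (\<Sum>m\<in>{-K..K}. v m) ^ card ({..<N L} - D)"
    using D by (simp add: prod.If_cases Int_absorb1 Diff_eq)
  also have "\<dots> \<le> (T / (2 * N L)) ^ card D * exp (T / 2)"
  proof (intro mult_mono power_mono s1)
    have "(\<Sum>m\<in>{-K..K}. v m) ^ card ({..<N L} - D) \<le> (\<Sum>m\<in>{-K..K}. v m) ^ N L"
      using card_mono[of "{..<N L}" "{..<N L} - D"] by (intro power_increasing s3) auto
    also have "\<dots> \<le> (1 + T / (2 * N L)) ^ N L"
      using s3 by (intro power_mono s2) auto
    also have "\<dots> \<le> exp (T / (2 * N L)) ^ N L"
      using T by (intro power_mono exp_ge_add_one_self) auto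
    also have "\<dots> = exp (T / 2)"
      unfolding exp_of_nat_mult[symmetric] by simp
    finally show "(\<Sum>m\<in>{-K..K}. v m) ^ card ({..<N L} - D) \<le> exp (T / 2)" .
  qed (use v f T in \<open>auto intro!: sum_nonneg zero_le_power\<close>)
  finally show ?thesis by (simp add: mult.commute)
qed

lemma nu_total: "(\<Sum>\<kappa>\<in>confs L K. nu L \<kappa>) \<le> exp (T / 2)"
  using nu_moment[of "{}" L "\<lambda>m. \<bar>real_of_int m\<bar>" K] by simp

lemma nu_complexity: "(\<Sum>\<kappa>\<in>confs L K. nu L \<kappa> * real_of_int (compl L \<kappa>)) \<le> exp (T / 2) * (T / 2)"
proof -
  have "(\<Sum>\<kappa>\<in>confs L K. nu L \<kappa> * real_of_int (compl L \<kappa>))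
      = (\<Sum>c<N L. \<Sum>\<kappa>\<in>confs L K. nu L \<kappa> * (\<Prod>c\<in>{c}. \<bar>real_of_int (\<kappa> c)\<bar>))"
    unfolding compl_def by (subst sum.swap) (simp add: sum_distrib_left)
  also have "\<dots> \<le> (\<Sum>c<N L. exp (T / 2) * (T / (2 * N L)) ^ card {c})"
    by (intro sum_mono nu_moment) auto
  also have "\<dots> = exp (T / 2) * (T / 2)" by simp
  finally show ?thesis .
qed

section \<open>Collisions and passage to a coarser level\<close>

definition coll_pairs :: "nat \<Rightarrow> nat \<Rightarrow> (nat \<times> nat) set" where
  "coll_pairs k L = {(c, c'). c < N L \<and> c' < N L \<and> c \<noteq> c' \<and> c div width k L = c' div width k L}"

text \<open>A count rather than a predicate: its mean under \<open>nu\<close> is a second moment,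
  and a value below 1 means that there is no collision.\<close>

definition collisions :: "nat \<Rightarrow> nat \<Rightarrow> (nat \<Rightarrow> int) \<Rightarrow> real" where
  "collisions k L \<kappa> = (\<Sum>(c, c')\<in>coll_pairs k L. of_bool (\<kappa> c \<noteq> 0) * of_bool (\<kappa> c' \<noteq> 0))"

lemma card_coll_pairs:
  assumes "k \<le> L"
  shows "finite (coll_pairs k L)" "card (coll_pairs k L) * N k \<le> N L * N L"
proof -
  define w where "w = width k L"
  have w: "0 < w" by (simp add: w_def)
  have sub: "coll_pairs k L \<subseteq> Sigma {..<N L} (\<lambda>c. {c div w * w..<c div w * w + w})"
  proof clarify
    fix c c' assume "(c, c') \<in> coll_pairs k L"
    then have *: "c < N L" "c' div w = c div w" by (auto simp: coll_pairs_def w_def)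
    have "c' div w * w \<le> c'" "c' < c' div w * w + w"
      using w by (auto simp: dividend_less_div_times add.commute)
    with * show "c \<in> {..<N L} \<and> c' \<in> {c div w * w..<c div w * w + w}" by auto
  qed
  show "finite (coll_pairs k L)" by (rule finite_subset[OF sub]) auto
  have "card (coll_pairs k L) \<le> N L * w"
    using card_mono[OF _ sub] by (simp add: card_SigmaI)
  then have "card (coll_pairs k L) * N k \<le> N L * w * N k" by (rule mult_right_mono) simp
  also have "\<dots> = N L * N L" using N_width[OF assms] by (simp add: w_def mult_ac)
  finally show "card (coll_pairs k L) * N k \<le> N L * N L" .
qed

text \<open>Two given cells are both occupied with weight of order \<open>(T / (2 * N L))^2\<close>,
  and at most \<open>(N L)^2 / N k\<close> pairs share an ancestor. The result is small for large
  \<open>k\<close>, uniformly in \<open>L\<close>.\<close>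

lemma nu_collisions:
  assumes "k \<le> L"
  shows "(\<Sum>\<kappa>\<in>confs L K. nu L \<kappa> * collisions k L \<kappa>) \<le> exp (T / 2) * (T\<^sup>2 / (4 * N k))"
proof -
  have "(\<Sum>\<kappa>\<in>confs L K. nu L \<kappa> * collisions k L \<kappa>)
      = (\<Sum>p\<in>coll_pairs k L. \<Sum>\<kappa>\<in>confs L K. nu L \<kappa> * (\<Prod>c\<in>{fst p, snd p}. of_bool (\<kappa> c \<noteq> 0)))"
    unfolding collisions_def
    by (subst sum.swap)
       (auto simp: sum_distrib_left coll_pairs_def intro!: sum.cong)
  also have "\<dots> \<le> (\<Sum>p\<in>coll_pairs k L. exp (T / 2) * (T / (2 * N L)) ^ card {fst p, snd p})"
    by (intro sum_mono nu_moment) (auto simp: coll_pairs_def)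
  also have "\<dots> = (\<Sum>p\<in>coll_pairs k L. exp (T / 2) * (T / (2 * N L))\<^sup>2)"
    by (intro sum.cong refl) (auto simp: coll_pairs_def power2_eq_square)
  also have "\<dots> = exp (T / 2) * T\<^sup>2 / 4 * (real (card (coll_pairs k L)) / (real (N L) * real (N L)))"
    by (simp add: power2_eq_square)
  also have "\<dots> \<le> exp (T / 2) * T\<^sup>2 / 4 * (1 / N k)"
  proof (rule mult_left_mono)
    have "real (card (coll_pairs k L)) * real (N k) \<le> real (N L) * real (N L)"
      using card_coll_pairs(2)[OF assms] unfolding of_nat_mult[symmetric] of_nat_le_iff .
    then show "real (card (coll_pairs k L)) / (real (N L) * real (N L)) \<le> 1 / N k"
      by (simp add: divide_simps)
  qed simp
  finally show ?thesis by simp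
qed

text \<open>Labels in one cell add up, in accordance with the eigenvalue. Particles are misread only
  in collisions: labels 1 and 2 in one cell look like the label 3.\<close>

definition coarse :: "nat \<Rightarrow> nat \<Rightarrow> (nat \<Rightarrow> int) \<Rightarrow> nat \<Rightarrow> int" where
  "coarse k L \<kappa> j = (\<Sum>c\<in>{c. c < N L \<and> c div width k L = j}. \<kappa> c)"

lemma sum_fibres:
  assumes "k \<le> L"
  shows "(\<Sum>j<N k. \<Sum>c\<in>{c. c < N L \<and> c div width k L = j}. f c j) = (\<Sum>c<N L. f c (c div width k L) :: 'b :: comm_monoid_add)"
proof -
  have "(\<Sum>j<N k. \<Sum>c\<in>{c. c < N L \<and> c div width k L = j}. f c j)
     = (\<Sum>j<N k. \<Sum>c\<in>{c \<in> {..<N L}. c div width k L = j}. f c (c div width k L))"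
    by (intro sum.cong) auto
  also have "\<dots> = (\<Sum>c<N L. f c (c div width k L))"
    using ancestor_lt[OF assms] by (intro sum.group) auto
  finally show ?thesis .
qed

lemma prod_fibres:
  assumes "k \<le> L"
  shows "(\<Prod>j<N k. \<Prod>c\<in>{c. c < N L \<and> c div width k L = j}. f c j) = (\<Prod>c<N L. f c (c div width k L) :: 'b :: comm_monoid_mult)"
proof -
  have "(\<Prod>j<N k. \<Prod>c\<in>{c. c < N L \<and> c div width k L = j}. f c j)
     = (\<Prod>j<N k. \<Prod>c\<in>{c \<in> {..<N L}. c div width k L = j}. f c (c div width k L))"
    by (intro prod.cong) auto
  also have "\<dots> = (\<Prod>c<N L. f c (c div width k L))"
    using ancestor_lt[OF assms] by (intro prod.group) auto
  finally show ?thesis .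
qed

lemma compl_coarse: "k \<le> L \<Longrightarrow> compl k (coarse k L \<kappa>) \<le> compl L \<kappa>"
  unfolding compl_def coarse_def
  using sum_fibres[of k L "\<lambda>c j. \<bar>\<kappa> c\<bar>"] sum_abs
    sum_mono[of "{..<N k}" "\<lambda>j. \<bar>\<Sum>c\<in>{c. c < N L \<and> c div width k L = j}. \<kappa> c\<bar>"
      "\<lambda>j. \<Sum>c\<in>{c. c < N L \<and> c div width k L = j}. \<bar>\<kappa> c\<bar>"]
  by auto

lemma coarse_int_vectors:
  assumes "k \<le> L" "compl L \<kappa> \<le> int m"
  shows "coarse k L \<kappa> \<in> int_vectors (N k) m"
proof -
  have "coarse k L \<kappa> c = 0" if "N k \<le> c" for c
    unfolding coarse_def using ancestor_lt[OF assms(1)] that by (intro sum.neutral) fastforce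
  then show ?thesis
    using compl_coarse[OF assms(1), of \<kappa>] assms(2) unfolding int_vectors_def compl_def by auto
qed

lemma conf_pos_coarse:
  assumes "k \<le> L"
  shows "\<bar>conf_pos L \<kappa> - conf_pos k (coarse k L \<kappa>)\<bar> \<le> 2 * d k * compl L \<kappa>"
proof -
  have "conf_pos k (coarse k L \<kappa>) = (\<Sum>c<N L. of_int (\<kappa> c) * a k (c div width k L))"
    unfolding conf_pos_def coarse_def of_int_sum sum_distrib_right by (rule sum_fibres[OF assms])
  then have "\<bar>conf_pos L \<kappa> - conf_pos k (coarse k L \<kappa>)\<bar> = \<bar>\<Sum>c<N L. of_int (\<kappa> c) * (a L c - a k (c div width k L))\<bar>"
    by (simp add: conf_pos_def right_diff_distrib sum_subtractf)
  also have "\<dots> \<le> (\<Sum>c<N L. \<bar>of_int (\<kappa> c)\<bar> * (2 * d k))"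
    by (rule order_trans[OF sum_abs])
       (auto simp: abs_mult intro!: sum_mono mult_left_mono ancestor_close[OF assms])
  also have "\<dots> = 2 * d k * compl L \<kappa>"
    by (simp add: compl_def sum_distrib_left mult_ac)
  finally show ?thesis .
qed

lemma collision_free:
  assumes "collisions k L \<kappa> < 1" "k \<le> L" "c < N L" "c' < N L" "c \<noteq> c'" "c div width k L = c' div width k L"
  shows "\<kappa> c = 0 \<or> \<kappa> c' = 0"
proof (rule ccontr)
  assume "\<not> ?thesis"
  moreover have "(c, c') \<in> coll_pairs k L" using assms by (auto simp: coll_pairs_def)
  moreover have "of_bool (\<kappa> c \<noteq> 0) * of_bool (\<kappa> c' \<noteq> 0) \<le> collisions k L \<kappa>"
    unfolding collisions_def
    using member_le_sum[of "(c, c')" "coll_pairs k L" "\<lambda>(c, c'). of_bool (\<kappa> c \<noteq> 0) * of_bool (\<kappa> c' \<noteq> 0) :: real"]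
      card_coll_pairs(1)[OF assms(2)] calculation by auto
  ultimately show False using assms(1) by auto
qed

lemma prod_coarse:
  fixes g :: "int \<Rightarrow> nat \<Rightarrow> 'b :: comm_monoid_mult"
  assumes "collisions k L \<kappa> < 1" "k \<le> L" "\<And>j. g 0 j = 1"
  shows "(\<Prod>j<N k. g (coarse k L \<kappa> j) j) = (\<Prod>c<N L. g (\<kappa> c) (c div width k L))"
proof -
  have "(\<Prod>j<N k. g (coarse k L \<kappa> j) j) = (\<Prod>j<N k. \<Prod>c\<in>{c. c < N L \<and> c div width k L = j}. g (\<kappa> c) j)"
    unfolding coarse_def
    using collision_free[OF assms(1,2)] assms(3)
    by (intro prod.cong refl prod_eq_apply_sum_single) auto
  also have "\<dots> = (\<Prod>c<N L. g (\<kappa> c) (c div width k L))"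
    by (rule prod_fibres[OF assms(2)])
  finally show ?thesis .
qed

text \<open>Division by \<open>q\<close> brings all factors into the unit disc, where a difference
  of products is at most the sum of the differences. Only occupied cells contribute, so the
  complexity bounds this sum.\<close>

lemma conf_fun_coarse:
  assumes "collisions k L \<kappa> < 1" "k \<le> L"
  shows "cmod (conf_fun L \<kappa> - conf_fun k (coarse k L \<kappa>)) \<le> conf_q L \<kappa> * (2 * C * d k * compl L \<kappa>)"
proof -
  have eq: "conf_fun k (coarse k L \<kappa>) = (\<Prod>c<N L. h (\<kappa> c) (a k (c div width k L)))"
    unfolding conf_fun_def using prod_coarse[OF assms, of "\<lambda>m j. h m (a k j)"] by (simp add: h_0)
  define z where "z = (\<lambda>c. h (\<kappa> c) (a L c) / q (\<kappa> c))"
  define w where "w = (\<lambda>c. h (\<kappa> c) (a k (c div width k L)) / q (\<kappa> c))"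
  have nz: "complex_of_real (q m) \<noteq> 0" for m using q_pos[of m] by simp
  have "cmod ((\<Prod>c<N L. z c) - (\<Prod>c<N L. w c)) \<le> (\<Sum>c<N L. cmod (z c - w c))"
    by (rule norm_prod_diff) (auto simp: z_def w_def norm_divide divide_le_eq h_le q_pos abs_of_pos[OF q_pos])
  also have "\<dots> \<le> (\<Sum>c<N L. \<bar>of_int (\<kappa> c)\<bar> * (2 * C * d k))"
  proof (rule sum_mono)
    fix c assume c: "c \<in> {..<N L}"
    show "cmod (z c - w c) \<le> \<bar>of_int (\<kappa> c)\<bar> * (2 * C * d k)"
    proof (cases "\<kappa> c = 0")
      case True
      then show ?thesis by (simp add: z_def w_def h_0)
    next
      case False
      have "cmod (z c - w c) = cmod (h (\<kappa> c) (a L c) - h (\<kappa> c) (a k (c div width k L))) / q (\<kappa> c)"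
        unfolding z_def w_def diff_divide_distrib[symmetric] norm_divide using q_pos[of "\<kappa> c"] by simp
      also have "\<dots> \<le> C * \<bar>a L c - a k (c div width k L)\<bar>"
        using h_lipschitz[of "\<kappa> c" "a L c" "a k (c div width k L)"] q_pos[of "\<kappa> c"] by (simp add: divide_le_eq mult_ac)
      also have "\<dots> \<le> C * (2 * d k)" using c C ancestor_close[OF assms(2)] by (intro mult_left_mono) auto
      also have "\<dots> = 1 * (2 * C * d k)" by simp
      also have "\<dots> \<le> \<bar>of_int (\<kappa> c)\<bar> * (2 * C * d k)"
        using False C d_pos[of k] by (intro mult_right_mono) auto
      finally show ?thesis .
    qed
  qed
  also have "\<dots> = 2 * C * d k * compl L \<kappa>" by (simp add: compl_def sum_distrib_left mult_ac)
  finally have "cmod ((\<Prod>c<N L. z c) - (\<Prod>c<N L. w c)) \<le> 2 * C * d k * compl L \<kappa>" .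
  moreover have "conf_fun L \<kappa> - conf_fun k (coarse k L \<kappa>) = conf_q L \<kappa> * ((\<Prod>c<N L. z c) - (\<Prod>c<N L. w c))"
    unfolding eq using nz by (simp add: conf_fun_def conf_q_def z_def w_def right_diff_distrib prod.distrib[symmetric])
  ultimately show ?thesis
    using conf_q_pos[of L \<kappa>] by (simp add: norm_mult)
qed

end

lemma ex_eq_1D:
  assumes "ex t = 1"
  obtains z :: int where "t = of_int z"
proof -
  have "cos (2 * pi * t) = 1" using assms by (simp add: ex_def complex_eq_iff)
  then obtain z :: int where "2 * pi * t = real_of_int z * 2 * pi" by (auto simp: cos_one_2pi_int)
  then show thesis by (intro that[of z]) simp
qed

section \<open>Interpolation of amplitude ratios by a trigonometric polynomial\<close>

context spectral_data
begin

text \<open>Each particle costs at most a factor \<open>R\<close> in the ratio of \<open>q\<close>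
  to \<open>tt\<close>, and the complexity is at least the number of particles.\<close>

lemma conf_q_le: "conf_q L \<kappa> \<le> R ^ nat (compl L \<kappa>) * conf_tt L \<kappa>"
proof -
  have qR: "q m \<le> R ^ nat \<bar>m\<bar> * tt m" for m
  proof (cases "m = 0")
    case False
    then have "R \<le> R ^ nat \<bar>m\<bar>" using R by (intro self_le_power) auto
    then have "R * tt m \<le> R ^ nat \<bar>m\<bar> * tt m" using tt_pos[of m] by (intro mult_right_mono) auto
    with q_le[of m] show ?thesis by simp
  qed (simp add: q_0 tt_0)
  have "conf_q L \<kappa> \<le> (\<Prod>c<N L. R ^ nat \<bar>\<kappa> c\<bar> * tt (\<kappa> c))"
    unfolding conf_q_def by (intro prod_mono conjI qR) (simp add: less_imp_le q_pos)
  also have "\<dots> = R ^ (\<Sum>c<N L. nat \<bar>\<kappa> c\<bar>) * conf_tt L \<kappa>"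
    by (simp add: prod.distrib power_sum conf_tt_def)
  also have "(\<Sum>c<N L. nat \<bar>\<kappa> c\<bar>) = nat (compl L \<kappa>)"
  proof -
    have "compl L \<kappa> = int (\<Sum>c<N L. nat \<bar>\<kappa> c\<bar>)" by (simp add: compl_def)
    then show ?thesis by (simp only: nat_int)
  qed
  finally show ?thesis .
qed

text \<open>Equal eigenvalues would make \<open>\<kappa> - \<kappa>'\<close> an approximate integer
  relation of complexity at most \<open>2 * k\<close>, with an error of twice the radius
  \<open>2 * d k * k\<close>; this is exactly what \<open>separated\<close> forbids.\<close>

lemma arcs_disjoint:
  assumes \<kappa>: "\<kappa> \<in> int_vectors (N k) k" "\<kappa>' \<in> int_vectors (N k) k"
    and s: "\<bar>s - conf_pos k \<kappa>\<bar> \<le> 2 * d k * k" "\<bar>s' - conf_pos k \<kappa>'\<bar> \<le> 2 * d k * k"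
    and eq: "ex s = ex s'"
  shows "\<kappa> = \<kappa>'"
proof (rule ccontr)
  assume ne: "\<kappa> \<noteq> \<kappa>'"
  have "ex (s - s') = ex s * cnj (ex s')" using ex_add[of s "- s'"] by simp
  also have "\<dots> = 1" unfolding eq by (simp add: ex_add[symmetric])
  finally obtain z :: int where z: "s - s' = of_int z" by (rule ex_eq_1D)
  define r where "r = (\<lambda>c. \<kappa> c - \<kappa>' c)"
  have "(\<Sum>c<N k. \<bar>r c\<bar>) \<le> (\<Sum>c<N k. \<bar>\<kappa> c\<bar> + \<bar>\<kappa>' c\<bar>)"
    unfolding r_def by (intro sum_mono abs_triangle_ineq4)
  then have "r \<in> int_vectors (N k) (2 * k)"
    using \<kappa> unfolding int_vectors_def by (auto simp: r_def sum.distrib)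
  moreover have "r \<noteq> (\<lambda>_. 0)" using ne by (auto simp: r_def fun_eq_iff)
  ultimately have "4 * real k * d k < \<bar>(\<Sum>c<N k. of_int (r c) * a k c) - of_int z\<bar>"
    using separated[of r k z] by simp
  also have "(\<Sum>c<N k. of_int (r c) * a k c) = conf_pos k \<kappa> - conf_pos k \<kappa>'"
    by (simp add: r_def conf_pos_def left_diff_distrib sum_subtractf)
  finally have "2 * (2 * d k * k) < \<bar>conf_pos k \<kappa> - conf_pos k \<kappa>' - of_int z\<bar>" by (simp add: mult_ac)
  then show False using s z by linarith
qed

text \<open>Configurations of level \<open>L\<close> are compared with their images at level \<open>k\<close>. Those of complexity at most
  \<open>P\<close> without collisions contribute the first term; the second and third bound, by moments, the
  configurations of complexity above \<open>P\<close> and above \<open>k\<close>, and the last those with two particles in one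
  cell of level \<open>k\<close>.\<close>

lemma trig_poly_configurations_bound:
  fixes P k :: nat
  assumes P: "1 \<le> P" and k: "1 \<le> k" and \<eta>: "0 < \<eta>" "\<eta> \<le> 1"
  obtains A c where "finite A"
    "\<And>L K. k \<le> L \<Longrightarrow>
      (\<Sum>\<kappa>\<in>confs L K. conf_wgt L \<kappa> *
         (cmod ((\<Sum>i\<in>A. c i * ex (conf_pos L \<kappa>) powi (i::int)) * conf_tt L \<kappa> - conf_fun L \<kappa>))\<^sup>2)
      \<le> exp (T / 2) * (\<eta> + 2 * C * d k * k)\<^sup>2 + 4 / P * (exp (T / 2) * (T / 2))
        + (R ^ P + 2)\<^sup>2 * (exp (T / 2) * (T / 2) / k + exp (T / 2) * (T\<^sup>2 / (4 * N k)))"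
proof -
  define I where "I = int_vectors (N k) k"
  define U where "U = (\<lambda>\<kappa>. ex ` {conf_pos k \<kappa> - 2 * d k * k..conf_pos k \<kappa> + 2 * d k * k})"
  \<comment> \<open>The target is the ratio of the two amplitudes. Cutting it off above
    \<open>P\<close> keeps it below \<open>R ^ P\<close>, a bound independent of \<open>k\<close>,
    so that \<open>k\<close> can be chosen after \<open>P\<close>.\<close>
  define v where "v = (\<lambda>\<kappa>. if compl k \<kappa> \<le> int P then conf_fun k \<kappa> / conf_tt k \<kappa> else 0)"
  have Uk: "compact (U \<kappa>)" "U \<kappa> \<subseteq> sphere 0 1" for \<kappa>
    unfolding U_def
    by (intro compact_continuous_image compact_Icc) (auto simp: ex_def[abs_def] intro!: continuous_intros)
  have disj: "\<kappa> = \<kappa>'" if asm: "\<kappa> \<in> I" "\<kappa>' \<in> I" "z \<in> U \<kappa>" "z \<in> U \<kappa>'" for \<kappa> \<kappa>' z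
  proof -
    have "\<exists>s. z = ex s \<and> \<bar>s - conf_pos k \<kappa>\<bar> \<le> 2 * d k * k" if zU: "z \<in> U \<kappa>" for \<kappa>
    proof -
      obtain s where "s \<in> {conf_pos k \<kappa> - 2 * d k * k..conf_pos k \<kappa> + 2 * d k * k}" "z = ex s"
        using zU unfolding U_def by blast
      then show ?thesis by (intro exI[of _ s]) (auto simp: abs_le_iff)
    qed
    then obtain s s' where "z = ex s" "\<bar>s - conf_pos k \<kappa>\<bar> \<le> 2 * d k * k" "z = ex s'" "\<bar>s' - conf_pos k \<kappa>'\<bar> \<le> 2 * d k * k"
      using asm(3,4) by metis
    then show ?thesis using arcs_disjoint[of \<kappa> k \<kappa>' s s'] asm(1,2) by (simp add: I_def)
  qed
  have vB: "cmod (v \<kappa>) \<le> R ^ P" for \<kappa>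
  proof (cases "compl k \<kappa> \<le> int P")
    case True
    have "cmod (conf_fun k \<kappa>) \<le> R ^ nat (compl k \<kappa>) * conf_tt k \<kappa>"
      using conf_fun_le conf_q_le by (rule order_trans)
    also have "\<dots> \<le> R ^ P * conf_tt k \<kappa>"
      using True R conf_tt_pos[of k \<kappa>] by (intro mult_right_mono power_increasing) auto
    finally show ?thesis
      using True conf_tt_pos[of k \<kappa>] by (simp add: v_def norm_divide divide_le_eq abs_of_pos)
  qed (use R in \<open>simp add: v_def\<close>)
  have finI: "finite I" unfolding I_def using card_int_vectors by blast
  have RP: "0 \<le> R ^ P" using R by simp
  have "\<exists>A c. finite A \<and> (\<forall>z. cmod z = 1 \<longrightarrow> cmod (\<Sum>i\<in>A. c i * z powi (i::int)) \<le> R ^ P + \<eta>) \<and>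
      (\<forall>\<kappa>\<in>I. \<forall>z\<in>U \<kappa>. cmod ((\<Sum>i\<in>A. c i * z powi (i::int)) - v \<kappa>) \<le> \<eta>)"
  proof (rule trig_poly_interpolation[of I U v "R ^ P" \<eta>])
    show "i = j" if "i \<in> I" "j \<in> I" "z \<in> U i" "z \<in> U j" for i j z
      using disj that by blast
  qed (use finI Uk vB RP \<eta>(1) in blast)+
  then obtain A c where A: "finite A"
    and bound: "\<And>z. cmod z = 1 \<Longrightarrow> cmod (\<Sum>i\<in>A. c i * z powi (i::int)) \<le> R ^ P + \<eta>"
    and near: "\<And>\<kappa> z. \<kappa> \<in> I \<Longrightarrow> z \<in> U \<kappa> \<Longrightarrow> cmod ((\<Sum>i\<in>A. c i * z powi (i::int)) - v \<kappa>) \<le> \<eta>"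
    by blast
  show thesis
  proof (rule that[OF A])
    fix L K assume L: "k \<le> L"
    define \<phi> where "\<phi> = (\<lambda>z. \<Sum>i\<in>A. c i * z powi i)"
    define G where "G = (\<eta> + 2 * C * d k * k)\<^sup>2"
    \<comment> \<open>The polynomial is at most \<open>R ^ P + 1\<close>, and \<open>conf_tt\<close>
      and \<open>conf_fun\<close> are at most \<open>conf_q\<close>; hence \<open>B\<close> times
      the square of \<open>conf_q\<close> bounds the error of any configuration.\<close>
    define B where "B = (R ^ P + 2)\<^sup>2"
    have pt: "(cmod (\<phi> (ex (conf_pos L \<kappa>)) * conf_tt L \<kappa> - conf_fun L \<kappa>))\<^sup>2
      \<le> (conf_q L \<kappa>)\<^sup>2 * (G + 4 / P * compl L \<kappa> + B * (compl L \<kappa> / k + collisions k L \<kappa>))" for \<kappa>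
    proof -
      define z where "z = \<phi> (ex (conf_pos L \<kappa>))"
      define Q where "Q = conf_q L \<kappa>"
      define t where "t = conf_tt L \<kappa>"
      define co where "co = coarse k L \<kappa>"
      define e where "e = cmod (z * t - conf_fun L \<kappa>)"
      have Q: "0 < Q" unfolding Q_def by (rule conf_q_pos)
      have t: "0 < t" "t \<le> Q" unfolding Q_def t_def by (rule conf_tt_pos, rule conf_tt_le)
      have X: "cmod (conf_fun L \<kappa>) \<le> Q" unfolding Q_def by (rule conf_fun_le)
      have tri: "e \<le> cmod z * t + Q"
        unfolding e_def using norm_triangle_ineq4[of "z * t" "conf_fun L \<kappa>"] X t by (simp add: norm_mult)
      have z: "cmod z \<le> R ^ P + 1" unfolding z_def \<phi>_def using bound[of "ex (conf_pos L \<kappa>)"] \<eta> by simp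
      have e0: "0 \<le> e" by (simp add: e_def)
      have cm0: "0 \<le> compl L \<kappa>" unfolding compl_def by (intro sum_nonneg) auto
      have cl0: "0 \<le> collisions k L \<kappa>" unfolding collisions_def by (intro sum_nonneg) auto
      have G0: "0 \<le> G" and B0: "0 \<le> B" by (simp_all add: G_def B_def)
      have nn: "0 \<le> 4 / P * compl L \<kappa>" "0 \<le> compl L \<kappa> / k" using cm0 by simp_all
      have "e\<^sup>2 \<le> Q\<^sup>2 * (G + 4 / P * compl L \<kappa> + B * (compl L \<kappa> / k + collisions k L \<kappa>))"
      proof (cases "compl L \<kappa> \<le> int k \<and> collisions k L \<kappa> < 1")
        \<comment> \<open>The comparison with level \<open>k\<close> fails here. The crude bound is
          charged to \<open>compl L \<kappa> / k + collisions k L \<kappa>\<close>, which is at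
          least 1, in the manner of Markov's inequality.\<close>
        case False
        then consider "\<not> compl L \<kappa> \<le> int k" | "1 \<le> collisions k L \<kappa>" by linarith
        then have "1 \<le> compl L \<kappa> / k + collisions k L \<kappa>"
        proof cases
          case 1
          then have "1 \<le> compl L \<kappa> / k" using k by simp
          with cl0 show ?thesis by simp
        qed (use nn in linarith)
        then have "B * 1 \<le> B * (compl L \<kappa> / k + collisions k L \<kappa>)" using B0 by (rule mult_left_mono)
        then have "B \<le> G + 4 / P * compl L \<kappa> + B * (compl L \<kappa> / k + collisions k L \<kappa>)"
          using G0 nn(1) by linarith
        moreover have "e\<^sup>2 \<le> Q\<^sup>2 * B"
        proof -
          have "cmod z * t \<le> (R ^ P + 1) * Q" using z t RP by (intro mult_mono) auto
          with tri have "e \<le> Q * (R ^ P + 2)" by (simp add: algebra_simps)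
          then have "e\<^sup>2 \<le> (Q * (R ^ P + 2))\<^sup>2" using e0 by (intro power_mono)
          then show ?thesis by (simp add: power_mult_distrib B_def)
        qed
        ultimately show ?thesis by (meson mult_left_mono order_trans zero_le_power2)
      next
        case True
        have coI: "co \<in> I" unfolding co_def I_def using coarse_int_vectors[OF L] True by simp
        have "2 * d k * compl L \<kappa> \<le> 2 * d k * k" using True d_pos[of k] by (intro mult_left_mono) auto
        then have "\<bar>conf_pos L \<kappa> - conf_pos k co\<bar> \<le> 2 * d k * k"
          using conf_pos_coarse[OF L, of \<kappa>] unfolding co_def by linarith
        then have "ex (conf_pos L \<kappa>) \<in> U co" unfolding U_def by (auto simp: abs_le_iff)
        then have zv: "cmod (z - v co) \<le> \<eta>" unfolding z_def \<phi>_def by (rule near[OF coI])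
        \<comment> \<open>\<open>tt\<close> does not depend on positions, so this amplitude passes
          to level \<open>k\<close> without error.\<close>
        have tco: "t = conf_tt k co"
          unfolding t_def co_def conf_tt_def using prod_coarse[of k L \<kappa> "\<lambda>m j. tt m"] True L tt_0 by simp
        show ?thesis
        proof (cases "compl k co \<le> int P")
          case small: True
          have "v co * t = conf_fun k co" using small t by (simp add: v_def tco[symmetric])
          then have "z * t - conf_fun L \<kappa> = (z - v co) * t - (conf_fun L \<kappa> - conf_fun k co)"
            by (simp add: left_diff_distrib)
          then have "e = cmod ((z - v co) * t - (conf_fun L \<kappa> - conf_fun k co))" by (simp only: e_def)
          also have "\<dots> \<le> cmod ((z - v co) * t) + cmod (conf_fun L \<kappa> - conf_fun k co)"
            by (rule norm_triangle_ineq4)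
          also have "cmod ((z - v co) * t) = cmod (z - v co) * t" using t by (simp add: norm_mult)
          finally have "e \<le> cmod (z - v co) * t + cmod (conf_fun L \<kappa> - conf_fun k co)" .
          also have "\<dots> \<le> \<eta> * Q + Q * (2 * C * d k * compl L \<kappa>)"
            using zv t \<eta> conf_fun_coarse[of k L \<kappa>] True L unfolding co_def Q_def
            by (intro add_mono mult_mono) auto
          also have "\<dots> \<le> \<eta> * Q + Q * (2 * C * d k * k)"
            using True C d_pos[of k] Q by (intro add_left_mono mult_left_mono) auto
          also have "\<dots> = Q * (\<eta> + 2 * C * d k * k)" by (simp add: algebra_simps)
          finally have "e\<^sup>2 \<le> (Q * (\<eta> + 2 * C * d k * k))\<^sup>2" using e0 by (intro power_mono)
          also have "\<dots> = Q\<^sup>2 * G" by (simp add: power_mult_distrib G_def)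
          also have "\<dots> \<le> Q\<^sup>2 * (G + 4 / P * compl L \<kappa> + B * (compl L \<kappa> / k + collisions k L \<kappa>))"
            using nn cl0 B0 by (intro mult_left_mono) auto
          finally show ?thesis .
        next
          \<comment> \<open>Above the cut-off the target is 0, the polynomial is at most 1 and the
            error at most \<open>2 * Q\<close>; the term \<open>4 / P\<close> times the complexity
            absorbs its square.\<close>
          case False
          then have "v co = 0" by (simp add: v_def)
          with zv \<eta> have "cmod z \<le> 1" by simp
          then have "cmod z * t \<le> 1 * Q" using t by (intro mult_mono) auto
          with tri have "e \<le> 2 * Q" by simp
          then have "e\<^sup>2 \<le> (2 * Q)\<^sup>2" using e0 by (intro power_mono)
          also have "\<dots> = Q\<^sup>2 * 4" by (simp add: power_mult_distrib)
          also have "\<dots> \<le> Q\<^sup>2 * (G + 4 / P * compl L \<kappa> + B * (compl L \<kappa> / k + collisions k L \<kappa>))"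
          proof (rule mult_left_mono)
            have "int P \<le> compl L \<kappa>" using False compl_coarse[OF L, of \<kappa>] by (simp add: co_def)
            then have "real P \<le> compl L \<kappa>" by linarith
            then have "4 \<le> 4 / P * compl L \<kappa>" using P by (simp add: field_simps)
            moreover have "0 \<le> B * (compl L \<kappa> / k + collisions k L \<kappa>)" using nn cl0 B0 by simp
            ultimately show "4 \<le> G + 4 / P * compl L \<kappa> + B * (compl L \<kappa> / k + collisions k L \<kappa>)"
              using G0 by linarith
          qed simp
          finally show ?thesis .
        qed
      qed
      then show ?thesis by (simp add: e_def z_def t_def Q_def)
    qed
    have "(\<Sum>\<kappa>\<in>confs L K. conf_wgt L \<kappa> * (cmod (\<phi> (ex (conf_pos L \<kappa>)) * conf_tt L \<kappa> - conf_fun L \<kappa>))\<^sup>2)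
      \<le> (\<Sum>\<kappa>\<in>confs L K. conf_wgt L \<kappa> * ((conf_q L \<kappa>)\<^sup>2 *
          (G + 4 / P * compl L \<kappa> + B * (compl L \<kappa> / k + collisions k L \<kappa>))))"
      by (intro sum_mono mult_left_mono pt) (simp add: less_imp_le conf_wgt_pos)
    also have "\<dots> = G * (\<Sum>\<kappa>\<in>confs L K. nu L \<kappa>) + 4 / P * (\<Sum>\<kappa>\<in>confs L K. nu L \<kappa> * compl L \<kappa>)
        + B * (1 / k * (\<Sum>\<kappa>\<in>confs L K. nu L \<kappa> * compl L \<kappa>) + (\<Sum>\<kappa>\<in>confs L K. nu L \<kappa> * collisions k L \<kappa>))"
      unfolding sum_distrib_left sum.distrib[symmetric]
      by (intro sum.cong refl) (simp add: nu_def algebra_simps)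
    also have "\<dots> \<le> G * exp (T / 2) + 4 / P * (exp (T / 2) * (T / 2))
        + B * (1 / k * (exp (T / 2) * (T / 2)) + exp (T / 2) * (T\<^sup>2 / (4 * N k)))"
      by (intro add_mono mult_left_mono nu_total nu_complexity nu_collisions L) (auto simp: G_def B_def)
    finally show "(\<Sum>\<kappa>\<in>confs L K. conf_wgt L \<kappa> *
         (cmod ((\<Sum>i\<in>A. c i * ex (conf_pos L \<kappa>) powi i) * conf_tt L \<kappa> - conf_fun L \<kappa>))\<^sup>2)
      \<le> exp (T / 2) * (\<eta> + 2 * C * d k * k)\<^sup>2 + 4 / P * (exp (T / 2) * (T / 2))
        + (R ^ P + 2)\<^sup>2 * (exp (T / 2) * (T / 2) / k + exp (T / 2) * (T\<^sup>2 / (4 * N k)))"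
      by (simp add: \<phi>_def G_def B_def mult.commute)
  qed
qed

text \<open>\<open>P\<close> is chosen for the tail, then \<open>k\<close> against the constant
  \<open>R ^ P\<close>. The bound is uniform in \<open>L\<close> and \<open>K\<close>, so the
  polynomial stays fixed while both tend to infinity.\<close>

theorem trig_poly_approximates_configurations:
  assumes \<epsilon>: "0 < \<epsilon>"
  obtains A c k where "finite A"
    "\<And>L K. k \<le> L \<Longrightarrow>
      (\<Sum>\<kappa>\<in>confs L K. conf_wgt L \<kappa> *
         (cmod ((\<Sum>i\<in>A. c i * ex (conf_pos L \<kappa>) powi (i::int)) * conf_tt L \<kappa> - conf_fun L \<kappa>))\<^sup>2) \<le> \<epsilon>"
proof -
  define E where "E = exp (T / 2)"
  obtain P :: nat where P: "4 * (E * (T / 2)) / (\<epsilon> / 2) < real P" using reals_Archimedean2 by blast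
  have "0 \<le> 4 * (E * (T / 2)) / (\<epsilon> / 2)" using T \<epsilon> by (simp add: E_def)
  with P have P1: "1 \<le> P" by linarith
  have tail: "4 / P * (E * (T / 2)) \<le> \<epsilon> / 2"
    using P P1 \<epsilon> by (simp add: field_simps)
  have kd: "(\<lambda>k. d k * real k) \<longlonglongrightarrow> 0"
  proof (rule tendsto_sandwich[OF _ _ tendsto_const])
    show "(\<lambda>k::nat. (1 / 2) ^ k * real k) \<longlonglongrightarrow> 0" by real_asymp
    show "eventually (\<lambda>k. 0 \<le> d k * real k) sequentially"
      using less_imp_le[OF d_pos] by (intro always_eventually allI mult_nonneg_nonneg) auto
    show "eventually (\<lambda>k. d k * real k \<le> (1 / 2) ^ k * real k) sequentially"
      by (intro always_eventually allI mult_right_mono d_le) auto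
  qed
  have Nk: "filterlim (\<lambda>k. real (N k)) at_top sequentially"
    by (rule filterlim_compose[OF filterlim_real_sequentially N_at_top])
  have "(\<lambda>k. E * (1 / real k + 2 * C * (d k * k))\<^sup>2
        + (R ^ P + 2)\<^sup>2 * (E * (T / 2) * (1 / real k) + E * (T\<^sup>2 / 4) * (1 / real (N k))))
      \<longlonglongrightarrow> E * (0 + 2 * C * 0)\<^sup>2 + (R ^ P + 2)\<^sup>2 * (E * (T / 2) * 0 + E * (T\<^sup>2 / 4) * 0)"
    by (intro tendsto_intros kd tendsto_divide_0[OF tendsto_const] filterlim_at_top_imp_at_infinity
          Nk filterlim_real_sequentially)
  then have "eventually (\<lambda>k. E * (1 / real k + 2 * C * (d k * k))\<^sup>2
        + (R ^ P + 2)\<^sup>2 * (E * (T / 2) * (1 / real k) + E * (T\<^sup>2 / 4) * (1 / real (N k))) < \<epsilon> / 2) sequentially"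
    using \<epsilon> by (intro order_tendstoD(2)) auto
  then obtain k where k: "1 \<le> k" "E * (1 / real k + 2 * C * (d k * k))\<^sup>2
        + (R ^ P + 2)\<^sup>2 * (E * (T / 2) * (1 / real k) + E * (T\<^sup>2 / 4) * (1 / real (N k))) < \<epsilon> / 2"
    using eventually_conj[OF _ eventually_ge_at_top[of 1]] eventually_happens'[OF sequentially_bot] by blast
  obtain A c where A: "finite A"
    "\<And>L K. k \<le> L \<Longrightarrow>
      (\<Sum>\<kappa>\<in>confs L K. conf_wgt L \<kappa> *
         (cmod ((\<Sum>i\<in>A. c i * ex (conf_pos L \<kappa>) powi (i::int)) * conf_tt L \<kappa> - conf_fun L \<kappa>))\<^sup>2)
      \<le> exp (T / 2) * (1 / real k + 2 * C * d k * k)\<^sup>2 + 4 / P * (exp (T / 2) * (T / 2))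
        + (R ^ P + 2)\<^sup>2 * (exp (T / 2) * (T / 2) / k + exp (T / 2) * (T\<^sup>2 / (4 * N k)))"
    by (rule trig_poly_configurations_bound[OF P1 k(1), of "1 / real k"]) (use k(1) in \<open>auto simp: divide_simps\<close>)
  show thesis
  proof (rule that[OF A(1)])
    fix L K assume "k \<le> L"
    from A(2)[OF this, of K]
    have "(\<Sum>\<kappa>\<in>confs L K. conf_wgt L \<kappa> *
         (cmod ((\<Sum>i\<in>A. c i * ex (conf_pos L \<kappa>) powi (i::int)) * conf_tt L \<kappa> - conf_fun L \<kappa>))\<^sup>2)
      \<le> (E * (1 / real k + 2 * C * (d k * k))\<^sup>2
        + (R ^ P + 2)\<^sup>2 * (E * (T / 2) * (1 / real k) + E * (T\<^sup>2 / 4) * (1 / real (N k))))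
        + 4 / P * (E * (T / 2))"
      by (simp add: E_def mult.assoc)
    also have "\<dots> \<le> \<epsilon>" using tail k(2) by linarith
    finally show "(\<Sum>\<kappa>\<in>confs L K. conf_wgt L \<kappa> *
         (cmod ((\<Sum>i\<in>A. c i * ex (conf_pos L \<kappa>) powi (i::int)) * conf_tt L \<kappa> - conf_fun L \<kappa>))\<^sup>2) \<le> \<epsilon>" .
  qed
qed

end

section \<open>Measure preservation and mixing from exponentials\<close>

lemma generated_by_sets:
  assumes "generated_by M Y"
  shows "sets M = sigma_sets (space M) (range (\<lambda>(j, b). {x\<in>space M. Y j x < b}))"
proof
  define G where "G = range (\<lambda>(j, b). {x\<in>space M. Y j x < b})"
  have G: "G \<subseteq> Pow (space M)" unfolding G_def by auto
  have "Y j \<in> borel_measurable (sigma (space M) G)" for j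
  proof (rule borel_measurable_iff_less[THEN iffD2], intro allI)
    fix b
    have "{x\<in>space M. Y j x < b} \<in> G"
      unfolding G_def by (rule range_eqI[of _ _ "(j, b)"]) simp
    then show "{w \<in> space (sigma (space M) G). Y j w < b} \<in> sets (sigma (space M) G)"
      using G by simp
  qed
  then show "sets M \<subseteq> sigma_sets (space M) G"
    using assms[unfolded generated_by_def, THEN conjunct2, rule_format, of "sigma (space M) G"] G by simp
  have [measurable]: "Y j \<in> borel_measurable M" for j using assms by (simp add: generated_by_def)
  have "G \<subseteq> sets M" unfolding G_def by auto
  then show "sigma_sets (space M) G \<subseteq> sets M" by (rule sets.sigma_sets_subset)
qed

lemma measurable_generated_by:
  assumes M: "generated_by M Y" and g: "g \<in> space N \<rightarrow> space M"
    and Y: "\<And>j. (\<lambda>x. Y j (g x)) \<in> borel_measurable N"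
  shows "g \<in> measurable N M"
proof (rule measurable_sigma_sets[OF generated_by_sets[OF M] _ g])
  fix B assume "B \<in> range (\<lambda>(j, b). {x\<in>space M. Y j x < b})"
  then obtain j b where "B = {x\<in>space M. Y j x < b}" by auto
  then have "g -` B \<inter> space N = {x\<in>space N. Y j (g x) < b}" using g by auto
  then show "g -` B \<inter> space N \<in> sets N" using Y[of j] by simp
qed auto

lemma borel_measurable_cis_lin_comb:
  assumes "\<And>j. Y j \<in> borel_measurable M"
  shows "(\<lambda>x. cis (lin_comb Y xs x)) \<in> borel_measurable M"
proof -
  have "(\<lambda>x. lin_comb Y xs x) \<in> borel_measurable M"
    unfolding lin_comb_def by (induction xs) (use assms in auto)
  then show ?thesis unfolding cis_conv_exp by measurable
qed

lemma generated_by_measurable: "generated_by M Y \<Longrightarrow> Y j \<in> borel_measurable M"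
  by (simp add: generated_by_def)

lemma (in prob_space) integral_indicator_complex:
  assumes "A \<in> sets M"
  shows "(\<integral>x. indicator A x \<partial>M) = complex_of_real (measure M A)"
proof -
  have "(\<integral>x. complex_of_real (indicator A x) \<partial>M) = of_real (\<integral>x. indicator A x \<partial>M)"
    by (rule integral_complex_of_real)
  moreover have "(\<lambda>x. complex_of_real (indicator A x)) = indicator A"
    by (auto simp: indicator_def fun_eq_iff)
  ultimately show ?thesis using assms by simp
qed

definition bdd_meas :: "'a measure \<Rightarrow> ('a \<Rightarrow> complex) \<Rightarrow> bool" where
  "bdd_meas M f \<longleftrightarrow> f \<in> borel_measurable M \<and> (\<exists>C. \<forall>x\<in>space M. cmod (f x) \<le> C)"

lemma (in prob_space) bdd_meas_integrable: "bdd_meas M f \<Longrightarrow> integrable M f"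
  unfolding bdd_meas_def by (auto intro!: integrable_const_bound AE_I2)

lemma bdd_meas_add: "bdd_meas M f \<Longrightarrow> bdd_meas M g \<Longrightarrow> bdd_meas M (\<lambda>x. f x + g x)"
proof -
  assume f: "bdd_meas M f" and g: "bdd_meas M g"
  then obtain A B where "\<And>x. x \<in> space M \<Longrightarrow> cmod (f x) \<le> A" "\<And>x. x \<in> space M \<Longrightarrow> cmod (g x) \<le> B"
    unfolding bdd_meas_def by blast
  then have "\<forall>x\<in>space M. cmod (f x + g x) \<le> A + B" by (blast intro: norm_triangle_mono)
  with f g show ?thesis unfolding bdd_meas_def by auto
qed

lemma bdd_meas_scale: "bdd_meas M f \<Longrightarrow> bdd_meas M (\<lambda>x. c * f x)"
  unfolding bdd_meas_def
  by (auto simp: norm_mult intro!: exI[of _ "cmod c * _"] mult_left_mono)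

lemma bdd_meas_mult:
  assumes "bdd_meas M f" "bdd_meas M g"
  shows "bdd_meas M (\<lambda>x. f x * g x)"
proof -
  obtain A B where AB: "\<And>x. x \<in> space M \<Longrightarrow> cmod (f x) \<le> A" "\<And>x. x \<in> space M \<Longrightarrow> cmod (g x) \<le> B"
    using assms unfolding bdd_meas_def by blast
  have "cmod (f x * g x) \<le> A * B" if "x \<in> space M" for x
    unfolding norm_mult using AB[OF that] by (intro mult_mono) (auto intro: order_trans[OF norm_ge_zero])
  then show ?thesis using assms unfolding bdd_meas_def by auto
qed

lemma bdd_meas_limit:
  assumes "\<And>n::nat. bdd_meas M (F n)" "\<And>n x. x \<in> space M \<Longrightarrow> cmod (F n x) \<le> C"
    "\<And>x. x \<in> space M \<Longrightarrow> (\<lambda>n. F n x) \<longlonglongrightarrow> f x"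
  shows "bdd_meas M f"
proof -
  have "f \<in> borel_measurable M"
    by (rule borel_measurable_LIMSEQ_metric[of F]) (use assms in \<open>auto simp: bdd_meas_def\<close>)
  moreover have "cmod (f x) \<le> C" if "x \<in> space M" for x
    by (rule tendsto_upperbound[OF tendsto_norm[OF assms(3)[OF that]]])
       (use assms(2)[OF that] in auto)
  ultimately show ?thesis unfolding bdd_meas_def by blast
qed

lemma bdd_meas_compose:
  assumes "bdd_meas M f" "S \<in> measurable N M"
  shows "bdd_meas N (\<lambda>x. f (S x))"
  using assms measurable_space[OF assms(2)] unfolding bdd_meas_def by (auto intro: measurable_compose)

lemma bdd_meas_exp:
  assumes "generated_by M Y"
  shows "bdd_meas M (\<lambda>x. cis (lin_comb Y xs x))"
  unfolding bdd_meas_def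
  using borel_measurable_cis_lin_comb[of Y M, OF generated_by_measurable[OF assms]] by auto

lemma (in prob_space) bdd_meas_L1_limit:
  assumes "\<And>n::nat. bdd_meas M (F n)" "\<And>n x. x \<in> space M \<Longrightarrow> cmod (F n x) \<le> C"
    "\<And>x. x \<in> space M \<Longrightarrow> (\<lambda>n. F n x) \<longlonglongrightarrow> f x"
  shows "(\<lambda>n. \<integral>x. cmod (f x - F n x) \<partial>M) \<longlonglongrightarrow> 0"
    and "(\<lambda>n. \<integral>x. (cmod (f x - F n x))\<^sup>2 \<partial>M) \<longlonglongrightarrow> 0"
    and "(\<lambda>n. \<integral>x. F n x \<partial>M) \<longlonglongrightarrow> (\<integral>x. f x \<partial>M)"
proof -
  have f: "bdd_meas M f" by (rule bdd_meas_limit[OF assms])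
  have fm [measurable]: "f \<in> borel_measurable M" and Fm [measurable]: "F n \<in> borel_measurable M" for n
    using f assms(1)[of n] by (auto simp: bdd_meas_def)
  have fC: "cmod (f x) \<le> C" if "x \<in> space M" for x
    by (rule tendsto_upperbound[OF tendsto_norm[OF assms(3)[OF that]]])
       (use assms(2)[OF that] in auto)
  have d2: "cmod (f x - F n x) \<le> 2 * C" if "x \<in> space M" for x n
    using norm_triangle_ineq4[of "f x" "F n x"] fC[OF that] assms(2)[OF that, of n] by simp
  have lim: "(\<lambda>n. cmod (f x - F n x)) \<longlonglongrightarrow> 0" if "x \<in> space M" for x
    using tendsto_norm[OF tendsto_diff[OF tendsto_const[of "f x"] assms(3)[OF that]]] by simp
  have "(\<lambda>n. \<integral>x. cmod (f x - F n x) \<partial>M) \<longlonglongrightarrow> (\<integral>x. 0 \<partial>M)"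
    by (rule integral_dominated_convergence[where w = "\<lambda>_. 2 * C"]) (use d2 lim in \<open>auto intro!: AE_I2\<close>)
  then show "(\<lambda>n. \<integral>x. cmod (f x - F n x) \<partial>M) \<longlonglongrightarrow> 0" by simp
  have "(\<lambda>n. \<integral>x. (cmod (f x - F n x))\<^sup>2 \<partial>M) \<longlonglongrightarrow> (\<integral>x. 0 \<partial>M)"
  proof (rule integral_dominated_convergence[where w = "\<lambda>_. (2 * C)\<^sup>2"])
    show "AE x in M. (\<lambda>n. (cmod (f x - F n x))\<^sup>2) \<longlonglongrightarrow> 0"
      using tendsto_power[OF lim, of _ 2] by (intro AE_I2) simp
    show "AE x in M. norm ((cmod (f x - F n x))\<^sup>2) \<le> (2 * C)\<^sup>2" for n
      using power_mono[OF d2, of _ n 2] by (intro AE_I2) simp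
  qed auto
  then show "(\<lambda>n. \<integral>x. (cmod (f x - F n x))\<^sup>2 \<partial>M) \<longlonglongrightarrow> 0" by simp
  show "(\<lambda>n. \<integral>x. F n x \<partial>M) \<longlonglongrightarrow> (\<integral>x. f x \<partial>M)"
    by (rule integral_dominated_convergence[where w = "\<lambda>_. C"]) (use assms in \<open>auto intro!: AE_I2\<close>)
qed

lemma measure_preserving_by_exponentials:
  assumes M: "prob_space M" and gen: "generated_by M Y" and S: "S \<in> measurable M M"
    and cf: "\<And>xs. (\<integral>x. cis (lin_comb Y xs (S x)) \<partial>M) = (\<integral>x. cis (lin_comb Y xs x) \<partial>M)"
  shows "distr M M S = M"
proof -
  interpret prob_space M by fact
  define V where "V = {f. bdd_meas M f \<and> (\<integral>x. f (S x) \<partial>M) = (\<integral>x. f x \<partial>M)}"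
  have "bp_closed (space M) V"
    unfolding bp_closed_def
  proof (intro conjI ballI allI impI)
    fix f g assume fg: "f \<in> V" "g \<in> V"
    then have "integrable M f" "integrable M g" "integrable M (\<lambda>x. f (S x))" "integrable M (\<lambda>x. g (S x))"
      unfolding V_def by (auto intro: bdd_meas_integrable bdd_meas_compose[OF _ S])
    then show "(\<lambda>x. f x + g x) \<in> V" using fg unfolding V_def by (auto intro: bdd_meas_add)
  next
    fix c f assume "f \<in> V"
    then show "(\<lambda>x. c * f x) \<in> V" unfolding V_def by (auto intro: bdd_meas_scale)
  next
    fix F :: "nat \<Rightarrow> 'a \<Rightarrow> complex" and f C
    assume F: "\<forall>n. F n \<in> V" "\<forall>n. \<forall>x\<in>space M. cmod (F n x) \<le> C" "\<forall>x\<in>space M. (\<lambda>n. F n x) \<longlonglongrightarrow> f x"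
    then have b: "bdd_meas M (F n)" for n unfolding V_def by blast
    have l1: "(\<lambda>n. \<integral>x. F n x \<partial>M) \<longlonglongrightarrow> (\<integral>x. f x \<partial>M)"
      by (rule bdd_meas_L1_limit(3)[of F C f]) (use F b in auto)
    have "(\<lambda>n. \<integral>x. F n (S x) \<partial>M) \<longlonglongrightarrow> (\<integral>x. f (S x) \<partial>M)"
      by (rule bdd_meas_L1_limit(3)[of "\<lambda>n x. F n (S x)" C "\<lambda>x. f (S x)"])
         (use F b bdd_meas_compose[OF _ S] measurable_space[OF S] in auto)
    then have "(\<lambda>n. \<integral>x. F n x \<partial>M) \<longlonglongrightarrow> (\<integral>x. f (S x) \<partial>M)"
      using F(1) unfolding V_def by simp
    then have "(\<integral>x. f (S x) \<partial>M) = (\<integral>x. f x \<partial>M)" using l1 by (rule LIMSEQ_unique)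
    moreover have "bdd_meas M f" by (rule bdd_meas_limit[of M F C f]) (use F b in auto)
    ultimately show "f \<in> V" unfolding V_def by simp
  qed
  moreover have "(\<lambda>x. cis (lin_comb Y xs x)) \<in> V" for xs
    unfolding V_def using cf bdd_meas_exp[OF gen] by simp
  ultimately have V: "indicator A \<in> V" if "A \<in> sets M" for A
    using bp_indicator[OF gen _ _ that] by blast
  show ?thesis
  proof (rule measure_eqI)
    fix A assume "A \<in> sets (distr M M S)"
    then have A [measurable]: "A \<in> sets M" by simp
    have "complex_of_real (measure M (S -` A \<inter> space M)) = (\<integral>x. indicator (S -` A \<inter> space M) x \<partial>M)"
      by (intro integral_indicator_complex[symmetric] measurable_sets[OF S A])
    also have "\<dots> = (\<integral>x. indicator A (S x) \<partial>M)"
      by (intro Bochner_Integration.integral_cong refl) (auto simp: indicator_def)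
    also have "\<dots> = (\<integral>x. indicator A x \<partial>M)" using V[OF A] unfolding V_def by simp
    also have "\<dots> = complex_of_real (measure M A)" by (rule integral_indicator_complex[OF A])
    finally have "measure M (S -` A \<inter> space M) = measure M A" by (simp only: of_real_eq_iff)
    then show "emeasure (distr M M S) A = emeasure M A"
      using S A by (simp add: emeasure_distr emeasure_eq_measure)
  qed simp
qed

text \<open>A bound by the L1 norm with one constant for all \<open>n\<close> makes convergence to 0
  stable under bounded limits, as these are limits in L1.\<close>

lemma (in prob_space) bp_closed_null_functionals:
  fixes \<Lambda> :: "nat \<Rightarrow> ('a \<Rightarrow> complex) \<Rightarrow> complex"
  assumes add: "\<And>n f g. bdd_meas M f \<Longrightarrow> bdd_meas M g \<Longrightarrow> \<Lambda> n (\<lambda>x. f x + g x) = \<Lambda> n f + \<Lambda> n g"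
    and scale: "\<And>n c f. bdd_meas M f \<Longrightarrow> \<Lambda> n (\<lambda>x. c * f x) = c * \<Lambda> n f"
    and bound: "\<And>n f. bdd_meas M f \<Longrightarrow> cmod (\<Lambda> n f) \<le> K * (\<integral>x. cmod (f x) \<partial>M)"
  shows "bp_closed (space M) {f. bdd_meas M f \<and> (\<lambda>n. \<Lambda> n f) \<longlonglongrightarrow> 0}"
  unfolding bp_closed_def
proof (intro conjI ballI allI impI)
  fix f g assume "f \<in> {f. bdd_meas M f \<and> (\<lambda>n. \<Lambda> n f) \<longlonglongrightarrow> 0}" "g \<in> {f. bdd_meas M f \<and> (\<lambda>n. \<Lambda> n f) \<longlonglongrightarrow> 0}"
  then show "(\<lambda>x. f x + g x) \<in> {f. bdd_meas M f \<and> (\<lambda>n. \<Lambda> n f) \<longlonglongrightarrow> 0}"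
    using tendsto_add[of "\<lambda>n. \<Lambda> n f" 0 sequentially "\<lambda>n. \<Lambda> n g" 0] by (auto simp: add intro: bdd_meas_add)
next
  fix c f assume "f \<in> {f. bdd_meas M f \<and> (\<lambda>n. \<Lambda> n f) \<longlonglongrightarrow> 0}"
  then show "(\<lambda>x. c * f x) \<in> {f. bdd_meas M f \<and> (\<lambda>n. \<Lambda> n f) \<longlonglongrightarrow> 0}"
    using tendsto_mult[OF tendsto_const[of c], of "\<lambda>n. \<Lambda> n f" 0 sequentially] by (auto simp: scale intro: bdd_meas_scale)
next
  fix F :: "nat \<Rightarrow> 'a \<Rightarrow> complex" and f C
  assume F: "\<forall>n. F n \<in> {f. bdd_meas M f \<and> (\<lambda>n. \<Lambda> n f) \<longlonglongrightarrow> 0}"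
    "\<forall>n. \<forall>x\<in>space M. cmod (F n x) \<le> C" "\<forall>x\<in>space M. (\<lambda>n. F n x) \<longlonglongrightarrow> f x"
  have Fb: "bdd_meas M (F j)" for j using F(1) by blast
  have f: "bdd_meas M f" by (rule bdd_meas_limit[of M F C f]) (use F in auto)
  have L1: "(\<lambda>j. K * (\<integral>x. cmod (f x - F j x) \<partial>M)) \<longlonglongrightarrow> K * 0"
    by (intro tendsto_intros bdd_meas_L1_limit(1)[of F C f]) (use F in auto)
  have diff: "cmod (\<Lambda> n f - \<Lambda> n (F j)) \<le> K * (\<integral>x. cmod (f x - F j x) \<partial>M)" for n j
  proof -
    have "\<Lambda> n (\<lambda>x. f x + (-1) * F j x) = \<Lambda> n f + (-1) * \<Lambda> n (F j)"
      using add[OF f bdd_meas_scale[OF Fb]] scale[OF Fb] by metis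
    then show ?thesis using bound[OF bdd_meas_add[OF f bdd_meas_scale[OF Fb]], of n "-1" j] by simp
  qed
  have "(\<lambda>n. \<Lambda> n f) \<longlonglongrightarrow> 0"
  proof (rule tendstoI)
    fix e :: real assume e: "0 < e"
    then have "eventually (\<lambda>j. K * (\<integral>x. cmod (f x - F j x) \<partial>M) < e / 2) sequentially"
      using order_tendstoD(2)[OF L1, of "e / 2"] by simp
    then obtain j where j: "K * (\<integral>x. cmod (f x - F j x) \<partial>M) < e / 2"
      using eventually_happens'[OF sequentially_bot] by blast
    have "eventually (\<lambda>n. dist (\<Lambda> n (F j)) 0 < e / 2) sequentially"
      using F(1) e by (intro tendstoD) auto
    then show "eventually (\<lambda>n. dist (\<Lambda> n f) 0 < e) sequentially"
    proof eventually_elim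
      case (elim n)
      then show ?case
        using diff[of n j] j norm_triangle_ineq[of "\<Lambda> n f - \<Lambda> n (F j)" "\<Lambda> n (F j)"] by simp
    qed
  qed
  with f show "f \<in> {f. bdd_meas M f \<and> (\<lambda>n. \<Lambda> n f) \<longlonglongrightarrow> 0}" by simp
qed

text \<open>The monotone class argument runs twice: first an indicator replaces the left exponential
  against a fixed exponential on the right, then an indicator replaces the right one against the
  indicator on the left.\<close>

lemma mixing_by_exponentials:
  assumes M: "prob_space M" and gen: "generated_by M Y" and T: "invertible_mpt M T"
    and cf: "\<And>xs ys. (\<lambda>n. \<integral>x. cis (lin_comb Y xs ((T ^^ n) x)) * cis (lin_comb Y ys x) \<partial>M) \<longlonglongrightarrow>
       (\<integral>x. cis (lin_comb Y xs x) \<partial>M) * (\<integral>x. cis (lin_comb Y ys x) \<partial>M)"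
  shows "mixing M T"
proof -
  interpret prob_space M by fact
  have Tm: "T \<in> measurable M M" and dT: "distr M M T = M" and inj: "inj_on T (space M)" and TS: "T ` space M = space M"
    using T by (auto simp: invertible_mpt_def measure_preserving_map_def bij_betw_def)
  have Tn [measurable]: "(T ^^ n) \<in> measurable M M" for n
  proof (induction n)
    case (Suc n)
    from measurable_comp[OF this Tm] show ?case by (simp only: funpow.simps(2))
  qed (simp add: id_def)
  have dTn: "distr M M (T ^^ n) = M" for n
  proof (induction n)
    case (Suc n)
    have "distr M M (T \<circ> T ^^ n) = distr (distr M M (T ^^ n)) M T"
      by (rule distr_distr[symmetric]) (auto intro: Tm)
    also have "\<dots> = M" using Suc dT by simp
    finally show ?case by (simp only: funpow.simps(2))
  qed (simp add: id_def distr_id2)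
  have int_Tn: "(\<integral>x. f ((T ^^ n) x) \<partial>M) = (\<integral>x. f x \<partial>M)" if "f \<in> borel_measurable M" for f :: "'a \<Rightarrow> 'c :: {banach, second_countable_topology}" and n
    using integral_distr[OF Tn that, of n] by (simp add: dTn)
  define \<Lambda> where "\<Lambda> = (\<lambda>f g n. (\<integral>x. f ((T ^^ n) x) * g x \<partial>M) - (\<integral>x. f x \<partial>M) * (\<integral>x. g x \<partial>M) :: complex)"
  have int: "integrable M (\<lambda>x. f ((T ^^ n) x) * g x)" if "bdd_meas M f" "bdd_meas M g" for f g n
    using that by (intro bdd_meas_integrable bdd_meas_mult bdd_meas_compose[OF _ Tn])
  have addl: "\<Lambda> (\<lambda>x. f x + f' x) g n = \<Lambda> f g n + \<Lambda> f' g n" if "bdd_meas M f" "bdd_meas M f'" "bdd_meas M g" for f f' g n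
    using int that by (simp add: \<Lambda>_def ring_distribs bdd_meas_integrable)
  have addr: "\<Lambda> f (\<lambda>x. g x + g' x) n = \<Lambda> f g n + \<Lambda> f g' n" if "bdd_meas M f" "bdd_meas M g'" "bdd_meas M g" for f g g' n
    using int that by (simp add: \<Lambda>_def ring_distribs bdd_meas_integrable)
  have scl: "\<Lambda> (\<lambda>x. c * f x) g n = c * \<Lambda> f g n" for c f g n
    by (simp add: \<Lambda>_def mult.assoc right_diff_distrib)
  have scr: "\<Lambda> f (\<lambda>x. c * g x) n = c * \<Lambda> f g n" for c f g n
    by (simp add: \<Lambda>_def mult.left_commute[of _ c] right_diff_distrib)
  have bound: "cmod (\<Lambda> f g n) \<le> (A * (\<integral>x. cmod (g x) \<partial>M)) + A * (\<integral>x. cmod (g x) \<partial>M)"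
    if fg: "bdd_meas M f" "bdd_meas M g" and A: "\<And>x. x \<in> space M \<Longrightarrow> cmod (f x) \<le> A" for f g n A
  proof -
    have gi: "integrable M (\<lambda>x. cmod (g x))" using bdd_meas_integrable[OF fg(2)] by simp
    have "cmod (\<integral>x. f ((T ^^ n) x) * g x \<partial>M) \<le> (\<integral>x. cmod (f ((T ^^ n) x) * g x) \<partial>M)"
      by (rule integral_norm_bound)
    also have "\<dots> \<le> (\<integral>x. A * cmod (g x) \<partial>M)"
    proof (rule integral_mono)
      show "integrable M (\<lambda>x. cmod (f ((T ^^ n) x) * g x))" by (rule integrable_norm[OF int[OF fg]])
      show "cmod (f ((T ^^ n) x) * g x) \<le> A * cmod (g x)" if "x \<in> space M" for x
        unfolding norm_mult using A measurable_space[OF Tn that] by (intro mult_right_mono) auto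
    qed (use gi in simp)
    finally have 1: "cmod (\<integral>x. f ((T ^^ n) x) * g x \<partial>M) \<le> A * (\<integral>x. cmod (g x) \<partial>M)" by simp
    have "cmod (\<integral>x. f x \<partial>M) \<le> (\<integral>x. cmod (f x) \<partial>M)" by (rule integral_norm_bound)
    also have "\<dots> \<le> (\<integral>x. A \<partial>M)"
      using bdd_meas_integrable[OF fg(1)] A by (intro integral_mono) auto
    finally have "cmod (\<integral>x. f x \<partial>M) \<le> A" by (simp add: prob_space)
    moreover have "cmod (\<integral>x. g x \<partial>M) \<le> (\<integral>x. cmod (g x) \<partial>M)" by (rule integral_norm_bound)
    ultimately have "cmod ((\<integral>x. f x \<partial>M) * (\<integral>x. g x \<partial>M)) \<le> A * (\<integral>x. cmod (g x) \<partial>M)"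
      unfolding norm_mult by (intro mult_mono) (auto intro: order_trans[OF norm_ge_zero])
    with 1 show ?thesis
      unfolding \<Lambda>_def using norm_triangle_ineq4 order_trans add_mono by (metis (no_types, lifting))
  qed
  \<comment> \<open>For the argument that is moved by \<open>T ^^ n\<close>, invariance of the
    measure removes the dependence on \<open>n\<close> from the L1 norm.\<close>
  have bound': "cmod (\<Lambda> f g n) \<le> 2 * A * (\<integral>x. cmod (f x) \<partial>M)"
    if fg: "bdd_meas M f" "bdd_meas M g" and A: "\<And>x. x \<in> space M \<Longrightarrow> cmod (g x) \<le> A" for f g n A
  proof -
    have fi: "integrable M (\<lambda>x. cmod (f x))" using bdd_meas_integrable[OF fg(1)] by simp
    have fTi: "integrable M (\<lambda>x. cmod (f ((T ^^ n) x)))"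
      using bdd_meas_integrable[OF bdd_meas_compose[OF fg(1) Tn]] by simp
    have "cmod (\<integral>x. f ((T ^^ n) x) * g x \<partial>M) \<le> (\<integral>x. cmod (f ((T ^^ n) x) * g x) \<partial>M)"
      by (rule integral_norm_bound)
    also have "\<dots> \<le> (\<integral>x. A * cmod (f ((T ^^ n) x)) \<partial>M)"
    proof (rule integral_mono)
      show "integrable M (\<lambda>x. cmod (f ((T ^^ n) x) * g x))" by (rule integrable_norm[OF int[OF fg]])
      show "cmod (f ((T ^^ n) x) * g x) \<le> A * cmod (f ((T ^^ n) x))" if "x \<in> space M" for x
        unfolding norm_mult mult.commute[of A] using A[OF that] by (intro mult_left_mono) auto
    qed (use fTi in simp)
    also have "\<dots> = A * (\<integral>x. cmod (f x) \<partial>M)"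
      using int_Tn[of "\<lambda>x. cmod (f x)" n] fi by simp
    finally have 1: "cmod (\<integral>x. f ((T ^^ n) x) * g x \<partial>M) \<le> A * (\<integral>x. cmod (f x) \<partial>M)" .
    have "cmod (\<integral>x. g x \<partial>M) \<le> (\<integral>x. cmod (g x) \<partial>M)" by (rule integral_norm_bound)
    also have "\<dots> \<le> (\<integral>x. A \<partial>M)"
      using bdd_meas_integrable[OF fg(2)] A by (intro integral_mono) auto
    finally have "cmod (\<integral>x. g x \<partial>M) \<le> A" by (simp add: prob_space)
    moreover have "cmod (\<integral>x. f x \<partial>M) \<le> (\<integral>x. cmod (f x) \<partial>M)" by (rule integral_norm_bound)
    ultimately have "cmod ((\<integral>x. g x \<partial>M) * (\<integral>x. f x \<partial>M)) \<le> A * (\<integral>x. cmod (f x) \<partial>M)"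
      unfolding norm_mult by (intro mult_mono) (auto intro: order_trans[OF norm_ge_zero])
    then have 2: "cmod ((\<integral>x. f x \<partial>M) * (\<integral>x. g x \<partial>M)) \<le> A * (\<integral>x. cmod (f x) \<partial>M)"
      by (simp add: mult.commute)
    have "cmod (\<Lambda> f g n) \<le> cmod (\<integral>x. f ((T ^^ n) x) * g x \<partial>M) + cmod ((\<integral>x. f x \<partial>M) * (\<integral>x. g x \<partial>M))"
      unfolding \<Lambda>_def by (rule norm_triangle_ineq4)
    with 1 2 show ?thesis by simp
  qed
  have E: "bdd_meas M (\<lambda>x. cis (lin_comb Y xs x))" for xs by (rule bdd_meas_exp[OF gen])
  have IE: "bdd_meas M (indicator A) \<and> (\<lambda>n. \<Lambda> (indicator A) (\<lambda>x. cis (lin_comb Y ys x)) n) \<longlonglongrightarrow> 0"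
    if A: "A \<in> sets M" for A ys
  proof -
    have "bp_closed (space M) {f. bdd_meas M f \<and> (\<lambda>n. \<Lambda> f (\<lambda>x. cis (lin_comb Y ys x)) n) \<longlonglongrightarrow> 0}"
    proof (rule bp_closed_null_functionals[where K = 2])
      show "cmod (\<Lambda> f (\<lambda>x. cis (lin_comb Y ys x)) n) \<le> 2 * (\<integral>x. cmod (f x) \<partial>M)" if "bdd_meas M f" for n f
        using bound'[OF that E[of ys], of 1 n] by simp
    qed (use addl[OF _ _ E] scl in auto)
    moreover have "(\<lambda>x. cis (lin_comb Y xs x)) \<in> {f. bdd_meas M f \<and> (\<lambda>n. \<Lambda> f (\<lambda>x. cis (lin_comb Y ys x)) n) \<longlonglongrightarrow> 0}" for xs
      using E LIM_zero[OF cf[of xs ys]] unfolding \<Lambda>_def by blast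
    ultimately show ?thesis using bp_indicator[OF gen _ _ A] by blast
  qed
  have II: "(\<lambda>n. \<Lambda> (indicator A) (indicator B) n) \<longlonglongrightarrow> 0" if A: "A \<in> sets M" and B: "B \<in> sets M" for A B
  proof -
    have bA: "bdd_meas M (indicator A)" using IE[OF A] by blast
    have "bp_closed (space M) {g. bdd_meas M g \<and> (\<lambda>n. \<Lambda> (indicator A) g n) \<longlonglongrightarrow> 0}"
    proof (rule bp_closed_null_functionals[where K = 2])
      show "cmod (\<Lambda> (indicator A) g n) \<le> 2 * (\<integral>x. cmod (g x) \<partial>M)" if "bdd_meas M g" for n g
        using bound[OF bA that, of 1 n] by (simp add: indicator_def)
    qed (use addr[OF bA] scr in auto)
    moreover have "(\<lambda>x. cis (lin_comb Y xs x)) \<in> {g. bdd_meas M g \<and> (\<lambda>n. \<Lambda> (indicator A) g n) \<longlonglongrightarrow> 0}" for xs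
      using E IE[OF A] by blast
    ultimately show ?thesis using bp_indicator[OF gen _ _ B] by blast
  qed
  \<comment> \<open>Forward images become preimages: by injectivity the preimage of the set on the
    left is \<open>A\<close> intersected with the preimage of \<open>B\<close>. This exchanges the
    roles of \<open>A\<close> and \<open>B\<close> in \<open>\<Lambda>\<close>.\<close>
  have key: "complex_of_real (measure M ((T ^^ n) ` A \<inter> B)) = (\<integral>x. indicator B ((T ^^ n) x) * indicator A x \<partial>M)"
    if A: "A \<in> sets M" and B: "B \<in> sets M" for A B n
  proof -
    have inj_n: "inj_on (T ^^ n) (space M)"
    proof (induction n)
      case (Suc n)
      have "(T ^^ n) ` space M \<subseteq> space M" using measurable_space[OF Tn] by auto
      then show ?case
        using comp_inj_on[OF Suc inj_on_subset[OF inj]] by (simp only: funpow.simps(2))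
    qed simp
    \<comment> \<open>Forward images are measurable because they are preimages under the measurable
      inverse.\<close>
    have img: "(T ^^ n) ` A \<in> sets M"
    proof (induction n)
      case (Suc n)
      define C where "C = (T ^^ n) ` A"
      have C: "C \<in> sets M" "C \<subseteq> space M" using Suc sets.sets_into_space unfolding C_def by auto
      have inv: "the_inv_into (space M) T \<in> measurable M M" using T by (simp add: invertible_mpt_def)
      have "T ` C = the_inv_into (space M) T -` C \<inter> space M"
        using C(2) inj TS by (auto simp: the_inv_into_f_f subset_iff) 
          (metis f_the_inv_into_f image_eqI)
      then have "T ` C \<in> sets M" using measurable_sets[OF inv C(1)] by simp
      then show ?case by (simp add: C_def image_comp)
    qed (use A in simp)
    have As: "A \<subseteq> space M" using A sets.sets_into_space by blast
    have "(T ^^ n) -` ((T ^^ n) ` A \<inter> B) \<inter> space M = A \<inter> ((T ^^ n) -` B \<inter> space M)"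
      using As inj_n by (auto simp: inj_on_def subset_iff)
    then have "measure M ((T ^^ n) ` A \<inter> B) = measure M (A \<inter> ((T ^^ n) -` B \<inter> space M))"
      using measure_distr[OF Tn, of "(T ^^ n) ` A \<inter> B" n] img B by (simp add: dTn)
    moreover have "A \<inter> ((T ^^ n) -` B \<inter> space M) \<in> sets M" using A B Tn by measurable
    ultimately have "complex_of_real (measure M ((T ^^ n) ` A \<inter> B)) = (\<integral>x. indicator (A \<inter> ((T ^^ n) -` B \<inter> space M)) x \<partial>M)"
      by (simp add: integral_indicator_complex)
    also have "\<dots> = (\<integral>x. indicator B ((T ^^ n) x) * indicator A x \<partial>M)"
      by (intro Bochner_Integration.integral_cong refl) (auto simp: indicator_def)
    finally show ?thesis .
  qed
  show ?thesis
    unfolding mixing_def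
  proof (intro ballI)
    fix A B assume A: "A \<in> sets M" and B: "B \<in> sets M"
    have "(\<lambda>n. complex_of_real (measure M ((T ^^ n) ` A \<inter> B)) - of_real (measure M A * measure M B)) \<longlonglongrightarrow> 0"
      using II[OF B A] unfolding \<Lambda>_def key[OF A B, symmetric] using A B by (simp add: mult.commute integral_indicator_complex)
    then have "(\<lambda>n. complex_of_real (measure M ((T ^^ n) ` A \<inter> B))) \<longlonglongrightarrow> of_real (measure M A * measure M B)"
      by (rule LIM_zero_cancel)
    then show "(\<lambda>n. measure M ((T ^^ n) ` A \<inter> B)) \<longlonglongrightarrow> measure M A * measure M B"
      by (simp only: tendsto_of_real_iff)
  qed
qed

section \<open>The Gaussian shift\<close>

lemma exp_minus_linear_bound:
  fixes x :: real
  assumes "\<bar>x\<bar> \<le> 1"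
  shows "\<bar>exp x - (1 + x)\<bar> \<le> x\<^sup>2"
proof -
  have "exp x \<le> 1 + x + x\<^sup>2"
  proof (cases "0 \<le> x")
    case True
    then show ?thesis using assms by (intro exp_bound) auto
  next
    case False
    have "exp x = 1 / exp (- x)" by (simp add: exp_minus field_simps)
    also have "\<dots> \<le> 1 / (1 - x)"
      using False exp_ge_add_one_self[of "- x"] by (intro divide_left_mono) auto
    also have "\<dots> \<le> 1 + x + x\<^sup>2"
    proof -
      have "1 \<le> (1 + x + x\<^sup>2) * (1 - x)"
        using False mult_nonpos_nonneg[of x "x * x"] by (simp add: algebra_simps power2_eq_square)
      then show ?thesis using False by (simp add: divide_le_eq)
    qed
    finally show ?thesis .
  qed
  then show ?thesis using exp_ge_add_one_self[of x] by (simp add: abs_le_iff)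
qed

text \<open>Dividing all factors by \<open>s = exp (B / n)\<close> brings them into the unit ball,
  so the products differ by at most \<open>n * (B / n)^2\<close>; undoing the division costs
  \<open>s ^ n = exp B\<close> for \<open>n\<close> factors.\<close>

lemma exp_avg_minus_prod_tendsto_0:
  fixes p :: "nat \<Rightarrow> nat \<Rightarrow> real"
  assumes N: "filterlim N at_top sequentially" and p: "\<And>L c. \<bar>p L c\<bar> \<le> B"
  shows "(\<lambda>L. exp ((\<Sum>c<N L. p L c) / N L) - (\<Prod>c<N L. 1 + p L c / N L)) \<longlonglongrightarrow> 0"
proof (rule Lim_null_comparison)
  have B: "0 \<le> B" using p[of 0 0] by simp
  have NR: "filterlim (\<lambda>L. real (N L)) at_top sequentially"
    by (rule filterlim_compose[OF filterlim_real_sequentially N])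
  show "(\<lambda>L. exp B * (B\<^sup>2 / N L)) \<longlonglongrightarrow> 0"
    using tendsto_mult[OF tendsto_const[of "exp B"] tendsto_divide_0[OF tendsto_const[of "B\<^sup>2"] filterlim_at_top_imp_at_infinity[OF NR]]]
    by simp
  have "eventually (\<lambda>L. max 1 B \<le> real (N L)) sequentially"
    using NR[unfolded filterlim_at_top, rule_format, of "max 1 B"] .
  then show "eventually (\<lambda>L. norm (exp ((\<Sum>c<N L. p L c) / N L) - (\<Prod>c<N L. 1 + p L c / N L)) \<le> exp B * (B\<^sup>2 / N L)) sequentially"
  proof eventually_elim
    case (elim L)
    define n where "n = real (N L)"
    have n: "1 \<le> n" "B \<le> n" "0 < n" using elim by (auto simp: n_def)
    define x where "x = (\<lambda>c. p L c / n)"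
    define s where "s = exp (B / n)"
    have s: "0 < s" "1 \<le> s" "1 + B / n \<le> s" using B n by (simp_all add: s_def)
    have x: "\<bar>x c\<bar> \<le> B / n" for c using p[of L c] n by (simp add: x_def divide_right_mono abs_divide)
    have x1: "\<bar>x c\<bar> \<le> 1" for c
      using order_trans[OF x[of c], of 1] n by simp
    have d: "\<bar>exp (x c) / s - (1 + x c) / s\<bar> \<le> (B / n)\<^sup>2" for c
    proof -
      have "\<bar>exp (x c) / s - (1 + x c) / s\<bar> = \<bar>exp (x c) - (1 + x c)\<bar> / s"
        using s by (simp add: diff_divide_distrib[symmetric] abs_divide)
      also have "\<dots> \<le> \<bar>exp (x c) - (1 + x c)\<bar> / 1" using s by (intro divide_left_mono) auto
      also have "\<dots> \<le> (x c)\<^sup>2" using exp_minus_linear_bound[OF x1[of c]] by simp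
      also have "\<dots> \<le> (B / n)\<^sup>2" using power_mono[OF x[of c], of 2] by simp
      finally show ?thesis .
    qed
    have "norm ((\<Prod>c<N L. exp (x c) / s) - (\<Prod>c<N L. (1 + x c) / s)) \<le> (\<Sum>c<N L. norm (exp (x c) / s - (1 + x c) / s))"
    proof (rule norm_prod_diff)
      fix c
      have "exp (x c) \<le> s" unfolding s_def using x[of c] by simp
      then show "norm (exp (x c) / s) \<le> 1" using s by simp
      have "\<bar>1 + x c\<bar> \<le> s" using x[of c] s(3) by linarith
      then show "norm ((1 + x c) / s) \<le> 1" using s by simp
    qed
    also have "\<dots> \<le> (\<Sum>c<N L. (B / n)\<^sup>2)" using d by (intro sum_mono) auto
    also have "\<dots> = B\<^sup>2 / n" using n by (simp add: n_def power2_eq_square)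
    finally have le: "norm ((\<Prod>c<N L. exp (x c) / s) - (\<Prod>c<N L. (1 + x c) / s)) \<le> B\<^sup>2 / n" .
    have sN: "s ^ N L = exp B"
      unfolding s_def exp_of_nat_mult[symmetric] using n by (simp add: n_def)
    have "exp ((\<Sum>c<N L. p L c) / N L) - (\<Prod>c<N L. 1 + p L c / N L)
        = exp B * ((\<Prod>c<N L. exp (x c) / s) - (\<Prod>c<N L. (1 + x c) / s))"
      using s by (simp add: prod_dividef sN[symmetric] right_diff_distrib exp_sum[symmetric] x_def n_def sum_divide_distrib)
    then have "norm (exp ((\<Sum>c<N L. p L c) / N L) - (\<Prod>c<N L. 1 + p L c / N L))
        = exp B * norm ((\<Prod>c<N L. exp (x c) / s) - (\<Prod>c<N L. (1 + x c) / s))"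
      by (simp only: norm_mult) simp
    also have "\<dots> \<le> exp B * (B\<^sup>2 / n)" using le by (rule mult_left_mono) simp
    finally show ?case by (simp only: n_def)
  qed
qed

lemma lin_comb_neg: "lin_comb Y (map (\<lambda>(j, r). (j, - r)) xs) w = - lin_comb Y xs w"
  by (induction xs) auto

lemma trig_list_simps [simp]:
  "trig_list [] t = 0" "trig_list ((n, r) # xs) t = of_real r * ex (of_int n * t) + trig_list xs t"
  "trig_list (xs @ ys) t = trig_list xs t + trig_list ys t"
  by (simp_all add: trig_list_def)

lemma trig_list_neg: "trig_list (map (\<lambda>(j, r). (j, - r)) xs) t = - trig_list xs t"
  by (induction xs) auto

lemma trig_list_bound: "cmod (trig_list xs t) \<le> (\<Sum>(n, r)\<leftarrow>xs. \<bar>r\<bar>)"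
proof (induction xs)
  case (Cons p xs)
  then show ?case
    by (cases p) (auto simp: norm_mult intro!: order_trans[OF norm_triangle_ineq])
qed simp

lemma trig_list_lipschitz: "cmod (trig_list xs s - trig_list xs t) \<le> (\<Sum>(n, r)\<leftarrow>xs. \<bar>r\<bar> * (2 * pi * \<bar>of_int n\<bar>)) * \<bar>s - t\<bar>"
proof (induction xs)
  case (Cons p xs)
  obtain n r where p: "p = (n, r)" by (cases p)
  have "cmod (trig_list (p # xs) s - trig_list (p # xs) t)
      \<le> cmod (of_real r * (ex (of_int n * s) - ex (of_int n * t))) + cmod (trig_list xs s - trig_list xs t)"
    using norm_triangle_ineq[of "of_real r * (ex (of_int n * s) - ex (of_int n * t))" "trig_list xs s - trig_list xs t"]
    by (simp add: p algebra_simps)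
  also have "cmod (of_real r * (ex (of_int n * s) - ex (of_int n * t))) \<le> \<bar>r\<bar> * (2 * pi * \<bar>of_int n * s - of_int n * t\<bar>)"
    unfolding norm_mult using cmod_ex_diff_le by (simp add: mult_left_mono)
  also have "\<bar>of_int n * s - of_int n * t\<bar> = \<bar>of_int n\<bar> * \<bar>s - t\<bar>"
    by (simp add: right_diff_distrib[symmetric] abs_mult)
  finally show ?case using Cons by (simp add: p algebra_simps)
qed simp

definition proj :: "nat \<Rightarrow> ((nat \<times> int) \<times> real) list \<Rightarrow> (int \<times> real) list" where
  "proj j xs = map (\<lambda>p. (snd (fst p), snd p)) (filter (\<lambda>p. fst (fst p) = j) xs)"

lemma proj_simps [simp]:
  "proj j [] = []" "proj j (((i, n), r) # xs) = (if i = j then (n, r) # proj j xs else proj j xs)"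
  "proj j (xs @ ys) = proj j xs @ proj j ys"
  by (simp_all add: proj_def)

lemma proj_neg: "proj j (map (\<lambda>(j, r). (j, - r)) xs) = map (\<lambda>(j, r). (j, - r)) (proj j xs)"
  by (induction xs) auto

definition coords_below :: "nat \<Rightarrow> ((nat \<times> int) \<times> real) list \<Rightarrow> bool" where
  "coords_below J xs \<longleftrightarrow> (\<forall>p\<in>set xs. fst (fst p) < J)"

lemma coords_below_simps [simp]:
  "coords_below J []" "coords_below J (((i, n), r) # xs) \<longleftrightarrow> i < J \<and> coords_below J xs"
  "coords_below J (xs @ ys) \<longleftrightarrow> coords_below J xs \<and> coords_below J ys"
  "coords_below J (map (\<lambda>(j, r). (j, - r)) xs) \<longleftrightarrow> coords_below J xs"
  by (auto simp: coords_below_def)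

lemma coords_below_mono: "coords_below J xs \<Longrightarrow> J \<le> K \<Longrightarrow> coords_below K xs"
  by (auto simp: coords_below_def)

lemma proj_above: "coords_below J xs \<Longrightarrow> J \<le> j \<Longrightarrow> proj j xs = []"
  by (auto simp: coords_below_def proj_def filter_empty_conv)

text \<open>Only the law of a generating sequence and the action of \<open>T\<close> on it are
  prescribed; the carrier stays abstract until the end.\<close>

locale gaussian_system = cells N mult d a + prob_space M
  for N mult :: "nat \<Rightarrow> nat" and d :: "nat \<Rightarrow> real" and a :: "nat \<Rightarrow> nat \<Rightarrow> real" and M :: "'a measure" +
  fixes y :: "int \<Rightarrow> 'a \<Rightarrow> real" and T :: "'a \<Rightarrow> 'a"
  assumes gen: "generated_by M y"
    and T_bij: "bij_betw T (space M) (space M)"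
    and y_T: "x \<in> space M \<Longrightarrow> y n (T x) = y (n + 1) x"
    and cf: "(\<integral>x. cis (lin_comb y xs x) \<partial>M) = exp (- quad_form cov xs / 2)"
begin

definition Ti :: "'a \<Rightarrow> 'a" where "Ti = the_inv_into (space M) T"

lemma T_space: "x \<in> space M \<Longrightarrow> T x \<in> space M"
  using T_bij by (auto simp: bij_betw_def)

lemma Ti_space: "x \<in> space M \<Longrightarrow> Ti x \<in> space M"
  and T_Ti: "x \<in> space M \<Longrightarrow> T (Ti x) = x"
  and Ti_T: "x \<in> space M \<Longrightarrow> Ti (T x) = x"
  using T_bij unfolding Ti_def bij_betw_def
  by (auto intro: the_inv_into_into f_the_inv_into_f the_inv_into_f_f)

lemma y_Ti: "x \<in> space M \<Longrightarrow> y n (Ti x) = y (n - 1) x"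
  using y_T[OF Ti_space, of x "n - 1"] by (simp add: T_Ti)

lemma y_meas [measurable]: "y n \<in> borel_measurable M"
  by (rule generated_by_measurable[OF gen])

lemma T_meas [measurable]: "T \<in> measurable M M"
proof (rule measurable_generated_by[OF gen])
  show "(\<lambda>x. y n (T x)) \<in> borel_measurable M" for n
    by (subst measurable_cong[OF y_T]) auto
qed (auto intro: T_space)

lemma Ti_meas [measurable]: "Ti \<in> measurable M M"
proof (rule measurable_generated_by[OF gen])
  show "(\<lambda>x. y n (Ti x)) \<in> borel_measurable M" for n
    by (subst measurable_cong[OF y_Ti]) auto
qed (auto intro: Ti_space)

definition shift :: "int \<Rightarrow> (int \<times> real) list \<Rightarrow> (int \<times> real) list" where
  "shift k xs = map (\<lambda>(n, r). (n + k, r)) xs"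

lemma shift_simps [simp]: "shift k [] = []" "shift k ((n, r) # xs) = (n + k, r) # shift k xs"
  by (simp_all add: shift_def)

lemma Tn_space: "x \<in> space M \<Longrightarrow> (T ^^ n) x \<in> space M"
  by (induction n) (auto intro: T_space)

lemma y_Tn: "x \<in> space M \<Longrightarrow> y n ((T ^^ k) x) = y (n + int k) x"
  by (induction k arbitrary: n) (auto simp: y_T Tn_space algebra_simps)

lemma lin_comb_Tn: "x \<in> space M \<Longrightarrow> lin_comb y xs ((T ^^ k) x) = lin_comb y (shift (int k) xs) x"
  by (induction xs) (auto simp: y_Tn)

lemma quad_form_shift: "quad_form cov (shift k xs) = quad_form cov xs"
  by (simp add: quad_form_def shift_def cov_def o_def case_prod_unfold)

lemma T_invertible: "invertible_mpt M T"
proof -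
  have "distr M M T = M"
  proof (rule measure_preserving_by_exponentials[OF prob_space_axioms gen T_meas])
    fix xs
    have "(\<integral>x. cis (lin_comb y xs (T x)) \<partial>M) = (\<integral>x. cis (lin_comb y (shift 1 xs) x) \<partial>M)"
      using lin_comb_Tn[of _ xs 1] by (intro Bochner_Integration.integral_cong refl) auto
    then show "(\<integral>x. cis (lin_comb y xs (T x)) \<partial>M) = (\<integral>x. cis (lin_comb y xs x) \<partial>M)"
      by (simp add: cf quad_form_shift)
  qed
  then show ?thesis
    using T_bij T_meas Ti_meas by (simp add: invertible_mpt_def measure_preserving_map_def Ti_def)
qed

lemma quad_form_append:
  "quad_form cov (xs @ ys) = quad_form cov xs + quad_form cov ys + 2 * (\<Sum>(n, r)\<leftarrow>xs. \<Sum>(m, s)\<leftarrow>ys. r * s * cov n m)"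
proof -
  have "(\<Sum>p\<leftarrow>xs. \<Sum>q\<leftarrow>ys. f p q) = (\<Sum>q\<leftarrow>ys. \<Sum>p\<leftarrow>xs. f p q :: real)"
    for f :: "int \<times> real \<Rightarrow> int \<times> real \<Rightarrow> real" and xs ys
    by (induction xs) (auto simp: sum_list_addf)
  note swap = this
  define F where "F = (\<lambda>p q. snd p * snd q * cov (fst p) (fst q))"
  have sym: "F q p = F p q" for p q
    unfolding F_def using cov_sym[of "fst p" "fst q"] by simp
  have "(\<Sum>p\<leftarrow>ys. \<Sum>q\<leftarrow>xs. F p q) = (\<Sum>q\<leftarrow>xs. \<Sum>p\<leftarrow>ys. F q p)"
    by (subst swap) (simp only: sym)
  moreover have "quad_form cov zs = (\<Sum>p\<leftarrow>zs. \<Sum>q\<leftarrow>zs. F p q)" for zs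
    by (simp add: quad_form_def F_def case_prod_unfold)
  moreover have "(\<Sum>(n, r)\<leftarrow>xs. \<Sum>(m, s)\<leftarrow>ys. r * s * cov n m) = (\<Sum>p\<leftarrow>xs. \<Sum>q\<leftarrow>ys. F p q)"
    by (simp add: F_def case_prod_unfold)
  ultimately show ?thesis by (simp add: sum_list_addf)
qed

text \<open>Only the cross covariances \<open>cov (n + int k) m\<close> depend on the time
  \<open>k\<close>, and they vanish in the limit because \<open>gam\<close> does; the joint
  characteristic function then factorises.\<close>

lemma T_mixing: "mixing M T"
proof (rule mixing_by_exponentials[OF prob_space_axioms gen T_invertible])
  fix xs ys
  have eq: "(\<integral>x. cis (lin_comb y xs ((T ^^ k) x)) * cis (lin_comb y ys x) \<partial>M)
      = exp (- (quad_form cov xs + quad_form cov ys + 2 * (\<Sum>(n, r)\<leftarrow>xs. \<Sum>(m, s)\<leftarrow>ys. r * s * cov (n + int k) m)) / 2)" for k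
  proof -
    have "(\<integral>x. cis (lin_comb y xs ((T ^^ k) x)) * cis (lin_comb y ys x) \<partial>M)
        = (\<integral>x. cis (lin_comb y (shift (int k) xs @ ys) x) \<partial>M)"
      by (intro Bochner_Integration.integral_cong refl) (simp add: lin_comb_Tn cis_mult)
    also have "\<dots> = exp (- quad_form cov (shift (int k) xs @ ys) / 2)" by (rule cf)
    also have "quad_form cov (shift (int k) xs @ ys) = quad_form cov xs + quad_form cov ys + 2 * (\<Sum>(n, r)\<leftarrow>xs. \<Sum>(m, s)\<leftarrow>ys. r * s * cov (n + int k) m)"
      unfolding quad_form_append quad_form_shift by (simp add: shift_def o_def case_prod_unfold)
    finally show ?thesis .
  qed
  have "(\<lambda>k. cov (n + int k) m) \<longlonglongrightarrow> 0" for n m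
    using tendsto_Re[OF gam_tendsto_0[of "n - m"]] by (simp add: cov_def algebra_simps)
  then have "(\<lambda>k. \<Sum>(n, r)\<leftarrow>xs. \<Sum>(m, s)\<leftarrow>ys. r * s * cov (n + int k) m) \<longlonglongrightarrow> (\<Sum>(n, r)\<leftarrow>xs. \<Sum>(m, s)\<leftarrow>ys. r * s * 0)"
    unfolding case_prod_unfold by (intro tendsto_sum_list tendsto_intros)
  then have lim: "(\<lambda>k. \<Sum>(n, r)\<leftarrow>xs. \<Sum>(m, s)\<leftarrow>ys. r * s * cov (n + int k) m) \<longlonglongrightarrow> 0"
    by (simp add: case_prod_unfold)
  have "(\<lambda>k. complex_of_real (exp (- (quad_form cov xs + quad_form cov ys + 2 * (\<Sum>(n, r)\<leftarrow>xs. \<Sum>(m, s)\<leftarrow>ys. r * s * cov (n + int k) m)) / 2)))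
     \<longlonglongrightarrow> complex_of_real (exp (- (quad_form cov xs + quad_form cov ys + 2 * 0) / 2))"
    by (intro tendsto_intros lim) auto
  also have "complex_of_real (exp (- (quad_form cov xs + quad_form cov ys + 2 * 0) / 2))
     = (\<integral>x. cis (lin_comb y xs x) \<partial>M) * (\<integral>x. cis (lin_comb y ys x) \<partial>M)"
    unfolding cf of_real_mult[symmetric] exp_add[symmetric] by (simp add: field_simps)
  finally show "(\<lambda>k. \<integral>x. cis (lin_comb y xs ((T ^^ k) x)) * cis (lin_comb y ys x) \<partial>M)
     \<longlonglongrightarrow> (\<integral>x. cis (lin_comb y xs x) \<partial>M) * (\<integral>x. cis (lin_comb y ys x) \<partial>M)"
    unfolding eq .
qed

lemma y_0_std_normal: "distr M borel (y 0) = std_normal_distribution"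
proof -
  have rd: "real_distribution (distr M borel (y 0))" by (intro real_distribution_distr) simp
  show ?thesis
  proof (rule Levy_uniqueness[OF rd real_dist_normal_dist], rule ext)
    fix t
    have "char (distr M borel (y 0)) t = (\<integral>x. cis (lin_comb y [(0, t)] x) \<partial>M)"
      unfolding char_def by (subst integral_distr) (auto simp: cis_conv_exp)
    also have "\<dots> = complex_of_real (exp (- (t\<^sup>2) / 2))"
      unfolding cf by (simp add: quad_form_def cov_def gam_0 power2_eq_square)
    finally show "char (distr M borel (y 0)) t = char std_normal_distribution t"
      by (simp add: char_std_normal_distribution)
  qed
qed

text \<open>\<open>y 0\<close> has a density bounded by 1, so a slab of length
  \<open>h = measure M A / 2\<close> has measure at most \<open>h\<close>. Countably many slabs
  cover \<open>A\<close>, and one of them cuts off a part of positive measure.\<close>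

lemma M_nonatomic: "nonatomic M"
  unfolding nonatomic_def
proof (intro ballI impI)
  fix A assume A: "A \<in> sets M" and pos: "0 < measure M A"
  have dist: "emeasure M (y 0 -` B \<inter> space M) = emeasure std_normal_distribution B" if "B \<in> sets borel" for B
    using emeasure_distr[of "y 0" M borel B] that by (simp add: y_0_std_normal)
  have small: "measure M (y 0 -` {u<..u + h} \<inter> space M) \<le> h" if "0 \<le> h" for u h
  proof -
    have "emeasure std_normal_distribution {u<..u + h} = (\<integral>\<^sup>+x. ennreal (std_normal_density x) * indicator {u<..u + h} x \<partial>lborel)"
      by (subst emeasure_density) auto
    also have "\<dots> \<le> (\<integral>\<^sup>+x. indicator {u<..u + h} x \<partial>lborel)"
    proof (intro nn_integral_mono)
      fix x :: real
      have "1 * exp (- x\<^sup>2 / 2) \<le> sqrt (2 * pi) * 1"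
        using pi_gt3 by (intro mult_mono) auto
      then have "std_normal_density x \<le> 1" by (simp add: std_normal_density_def divide_le_eq)
      then have "ennreal (std_normal_density x) \<le> 1" by simp
      then show "ennreal (std_normal_density x) * indicator {u<..u + h} x \<le> indicator {u<..u + h} x"
        by (simp split: split_indicator)
    qed
    also have "\<dots> = ennreal h" using that by simp
    finally have le: "emeasure std_normal_distribution {u<..u + h} \<le> ennreal h" .
    have "ennreal (measure M (y 0 -` {u<..u + h} \<inter> space M)) = emeasure std_normal_distribution {u<..u + h}"
      using dist[of "{u<..u + h}"] by (simp add: emeasure_eq_measure)
    with le have "ennreal (measure M (y 0 -` {u<..u + h} \<inter> space M)) \<le> ennreal h" by simp
    then show ?thesis using that by (simp only: ennreal_le_iff)
  qed
  define h where "h = measure M A / 2"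
  have h: "0 < h" using pos by (simp add: h_def)
  define B where "B = (\<lambda>i::int. A \<inter> (y 0 -` {i * h<..i * h + h} \<inter> space M))"
  have B [measurable]: "B i \<in> sets M" for i
    unfolding B_def using A by (intro sets.Int measurable_sets[OF y_meas]) auto
  have cover: "A = (\<Union>i. B i)"
  proof
    show "A \<subseteq> (\<Union>i. B i)"
    proof
      fix x assume x: "x \<in> A"
      define i where "i = \<lceil>y 0 x / h\<rceil> - 1"
      have "of_int i < y 0 x / h" "y 0 x / h \<le> of_int i + 1" unfolding i_def by linarith+
      then have "i * h < y 0 x" "y 0 x \<le> i * h + h" using h by (simp_all add: field_simps)
      then have "x \<in> B i" using x A sets.sets_into_space unfolding B_def by auto
      then show "x \<in> (\<Union>i. B i)" by blast
    qed
  qed (auto simp: B_def)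
  have "\<exists>i. 0 < measure M (B i)"
  proof (rule ccontr)
    assume "\<not> ?thesis"
    then have "B i \<in> null_sets M" for i
      by (intro null_setsI) (auto simp: emeasure_eq_measure not_less measure_le_0_iff)
    then have "A \<in> null_sets M" unfolding cover by (rule null_sets_UN)
    with pos show False by (simp add: measure_def null_setsD1)
  qed
  then obtain i where i: "0 < measure M (B i)" by blast
  have "measure M (B i) \<le> measure M (y 0 -` {i * h<..i * h + h} \<inter> space M)"
    unfolding B_def by (intro finite_measure_mono measurable_sets[OF y_meas]) auto
  also have "\<dots> \<le> h" using small[of h] h by simp
  also have "\<dots> < measure M A" using pos by (simp add: h_def)
  finally show "\<exists>B\<in>sets M. B \<subseteq> A \<and> 0 < measure M B \<and> measure M B < measure M A"
    using i B by (intro bexI[of _ "B i"]) (auto simp: B_def)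
qed

end

section \<open>Square-integrable functions\<close>

text \<open>The square of \<open>l2_norm\<close>, which avoids square roots in the estimates.\<close>

definition sqn :: "'a measure \<Rightarrow> ('a \<Rightarrow> complex) \<Rightarrow> real" where
  "sqn M f = (\<integral>x. (cmod (f x))\<^sup>2 \<partial>M)"

lemma sqn_nonneg: "0 \<le> sqn M f"
  unfolding sqn_def by (rule integral_nonneg_AE) simp

lemma norm_add_square_le: "(cmod (u + v))\<^sup>2 \<le> 2 * (cmod u)\<^sup>2 + 2 * (cmod v)\<^sup>2"
proof -
  have "(cmod (u + v))\<^sup>2 \<le> (cmod u + cmod v)\<^sup>2"
    by (intro power_mono norm_triangle_ineq) simp
  also have "\<dots> \<le> 2 * (cmod u)\<^sup>2 + 2 * (cmod v)\<^sup>2"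
    using zero_le_power2[of "cmod u - cmod v"] by (simp add: power2_eq_square algebra_simps)
  finally show ?thesis .
qed

lemma l2_space_add:
  assumes "f \<in> l2_space M" "g \<in> l2_space M"
  shows "(\<lambda>x. f x + g x) \<in> l2_space M"
proof -
  have [measurable]: "f \<in> borel_measurable M" "g \<in> borel_measurable M"
    and int: "integrable M (\<lambda>x. (cmod (f x))\<^sup>2)" "integrable M (\<lambda>x. (cmod (g x))\<^sup>2)"
    using assms by (auto simp: l2_space_def)
  have "integrable M (\<lambda>x. 2 * (cmod (f x))\<^sup>2 + 2 * (cmod (g x))\<^sup>2)" using int by simp
  then have "integrable M (\<lambda>x. (cmod (f x + g x))\<^sup>2)"
    by (rule Bochner_Integration.integrable_bound) (auto simp: norm_add_square_le)
  then show ?thesis by (simp add: l2_space_def)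
qed

lemma l2_space_scale: "f \<in> l2_space M \<Longrightarrow> (\<lambda>x. c * f x) \<in> l2_space M"
  by (auto simp: l2_space_def norm_mult power_mult_distrib)

lemma l2_space_diff: "f \<in> l2_space M \<Longrightarrow> g \<in> l2_space M \<Longrightarrow> (\<lambda>x. f x - g x) \<in> l2_space M"
  using l2_space_add[OF _ l2_space_scale[of g M "-1"], of f] by simp

lemma sqn_add_le:
  assumes "f \<in> l2_space M" "g \<in> l2_space M"
  shows "sqn M (\<lambda>x. f x + g x) \<le> 2 * sqn M f + 2 * sqn M g"
proof -
  have int: "integrable M (\<lambda>x. (cmod (f x))\<^sup>2)" "integrable M (\<lambda>x. (cmod (g x))\<^sup>2)" "integrable M (\<lambda>x. (cmod (f x + g x))\<^sup>2)"
    using assms l2_space_add[OF assms] by (auto simp: l2_space_def)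
  have "sqn M (\<lambda>x. f x + g x) \<le> (\<integral>x. 2 * (cmod (f x))\<^sup>2 + 2 * (cmod (g x))\<^sup>2 \<partial>M)"
    unfolding sqn_def using int by (intro integral_mono norm_add_square_le) auto
  also have "\<dots> = 2 * sqn M f + 2 * sqn M g" using int by (simp add: sqn_def)
  finally show ?thesis .
qed

lemma sqn_scale: "sqn M (\<lambda>x. c * f x) = (cmod c)\<^sup>2 * sqn M f"
  by (simp add: sqn_def norm_mult power_mult_distrib)

lemma l2_closure_iff:
  "f \<in> l2_closure M S \<longleftrightarrow> f \<in> l2_space M \<and> (\<forall>\<epsilon>>0. \<exists>h\<in>S. sqn M (\<lambda>x. f x - h x) < \<epsilon>)"
proof -
  have eq: "l2_norm M (\<lambda>x. f x - h x) = sqrt (sqn M (\<lambda>x. f x - h x))" for h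
    by (simp add: l2_norm_def sqn_def)
  have "(\<forall>\<epsilon>>0. \<exists>h\<in>S. sqrt (sqn M (\<lambda>x. f x - h x)) < \<epsilon>) \<longleftrightarrow> (\<forall>\<epsilon>>0. \<exists>h\<in>S. sqn M (\<lambda>x. f x - h x) < \<epsilon>)"
    (is "?L \<longleftrightarrow> ?R")
  proof
    assume L: ?L
    show ?R
    proof (intro allI impI)
      fix \<epsilon> :: real assume "0 < \<epsilon>"
      then obtain h where "h \<in> S" "sqrt (sqn M (\<lambda>x. f x - h x)) < sqrt \<epsilon>" using L real_sqrt_gt_0_iff by blast
      then show "\<exists>h\<in>S. sqn M (\<lambda>x. f x - h x) < \<epsilon>" by auto
    qed
  next
    assume R: ?R
    show ?L
    proof (intro allI impI)
      fix \<epsilon> :: real assume e: "0 < \<epsilon>"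
      then obtain h where "h \<in> S" "sqn M (\<lambda>x. f x - h x) < \<epsilon>\<^sup>2" using R zero_less_power by blast
      then show "\<exists>h\<in>S. sqrt (sqn M (\<lambda>x. f x - h x)) < \<epsilon>"
        using real_less_lsqrt[OF _ , of \<epsilon>] e by (intro bexI[of _ h]) (auto intro!: real_less_lsqrt)
    qed
  qed
  then show ?thesis unfolding l2_closure_def by (simp add: eq)
qed

lemma l2_closure_limit:
  assumes f: "f \<in> l2_space M" and S: "S \<subseteq> l2_space M"
    and app: "\<And>\<epsilon>. 0 < \<epsilon> \<Longrightarrow> \<exists>g\<in>l2_closure M S. sqn M (\<lambda>x. f x - g x) < \<epsilon>"
  shows "f \<in> l2_closure M S"
  unfolding l2_closure_iff
proof (intro conjI f allI impI)
  fix \<epsilon> :: real assume e: "0 < \<epsilon>"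
  then obtain g where g: "g \<in> l2_closure M S" "sqn M (\<lambda>x. f x - g x) < \<epsilon> / 4" using app[of "\<epsilon> / 4"] by auto
  then obtain h where h: "h \<in> S" "sqn M (\<lambda>x. g x - h x) < \<epsilon> / 4"
    using e unfolding l2_closure_iff by (meson divide_pos_pos zero_less_numeral)
  have g2: "g \<in> l2_space M" using g(1) by (simp add: l2_closure_iff)
  have "sqn M (\<lambda>x. (f x - g x) + (g x - h x)) \<le> 2 * sqn M (\<lambda>x. f x - g x) + 2 * sqn M (\<lambda>x. g x - h x)"
    using f g2 h(1) S by (intro sqn_add_le l2_space_diff) auto
  with g h have "sqn M (\<lambda>x. f x - h x) < \<epsilon>" by simp
  with h(1) show "\<exists>h\<in>S. sqn M (\<lambda>x. f x - h x) < \<epsilon>" by blast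
qed

lemma (in prob_space) bdd_meas_l2: 
  assumes "bdd_meas M f" shows "f \<in> l2_space M"
proof -
  obtain C where C: "\<And>x. x \<in> space M \<Longrightarrow> cmod (f x) \<le> C" using assms unfolding bdd_meas_def by blast
  have "AE x in M. norm ((cmod (f x))\<^sup>2) \<le> C\<^sup>2"
    using power_mono[OF C, of _ 2] by (intro AE_I2) simp
  then show ?thesis using assms unfolding l2_space_def bdd_meas_def
    by (auto intro!: integrable_const_bound)
qed

text \<open>The closure contains the exponentials, hence the indicators by the monotone class
  argument, hence the simple functions, hence all of L2.\<close>

lemma (in prob_space) l2_closure_eq_l2_space:
  assumes gen: "generated_by M Y" and S: "\<And>h. h \<in> S \<Longrightarrow> bdd_meas M h"
    and add: "\<And>g h. g \<in> S \<Longrightarrow> h \<in> S \<Longrightarrow> (\<lambda>x. g x + h x) \<in> S"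
    and scale: "\<And>c h. h \<in> S \<Longrightarrow> (\<lambda>x. c * h x) \<in> S"
    and exps: "\<And>xs \<epsilon>. 0 < \<epsilon> \<Longrightarrow> \<exists>h\<in>S. sqn M (\<lambda>x. cis (lin_comb Y xs x) - h x) < \<epsilon>"
  shows "l2_closure M S = l2_space M"
proof -
  define V where "V = l2_closure M S"
  have S2: "S \<subseteq> l2_space M" using S bdd_meas_l2 by blast
  have V2: "f \<in> l2_space M" if "f \<in> V" for f using that by (simp add: V_def l2_closure_iff)
  have V_add: "(\<lambda>x. f x + g x) \<in> V" if fg: "f \<in> V" "g \<in> V" for f g
    unfolding V_def l2_closure_iff
  proof (intro conjI allI impI)
    show "(\<lambda>x. f x + g x) \<in> l2_space M" using V2 fg by (intro l2_space_add)
    fix \<epsilon> :: real assume "0 < \<epsilon>"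
    then have "0 < \<epsilon> / 4" by simp
    then obtain h k where h: "h \<in> S" "sqn M (\<lambda>x. f x - h x) < \<epsilon> / 4" and k: "k \<in> S" "sqn M (\<lambda>x. g x - k x) < \<epsilon> / 4"
      using fg unfolding V_def l2_closure_iff by blast
    have "sqn M (\<lambda>x. (f x - h x) + (g x - k x)) \<le> 2 * sqn M (\<lambda>x. f x - h x) + 2 * sqn M (\<lambda>x. g x - k x)"
      using V2 fg h k S2 by (intro sqn_add_le l2_space_diff) auto
    also have "(\<lambda>x. (f x - h x) + (g x - k x)) = (\<lambda>x. (f x + g x) - (h x + k x))" by (simp add: fun_eq_iff)
    finally have "sqn M (\<lambda>x. (f x + g x) - (h x + k x)) < \<epsilon>" using h k by linarith
    then show "\<exists>h\<in>S. sqn M (\<lambda>x. f x + g x - h x) < \<epsilon>" using add[OF h(1) k(1)] by (rule bexI)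
  qed
  have V_scale: "(\<lambda>x. c * f x) \<in> V" if f: "f \<in> V" for c f
    unfolding V_def l2_closure_iff
  proof (intro conjI allI impI)
    show "(\<lambda>x. c * f x) \<in> l2_space M" using V2 f by (intro l2_space_scale)
    fix \<epsilon> :: real assume e: "0 < \<epsilon>"
    define \<delta> where "\<delta> = \<epsilon> / ((cmod c)\<^sup>2 + 1)"
    have pos: "0 < (cmod c)\<^sup>2 + 1" by (simp add: add_nonneg_pos)
    then have "0 < \<delta>" using e by (simp add: \<delta>_def)
    then obtain h where h: "h \<in> S" "sqn M (\<lambda>x. f x - h x) < \<delta>"
      using f unfolding V_def l2_closure_iff by blast
    have "sqn M (\<lambda>x. c * f x - c * h x) = (cmod c)\<^sup>2 * sqn M (\<lambda>x. f x - h x)"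
      unfolding sqn_scale[symmetric] by (simp add: right_diff_distrib)
    also have "\<dots> \<le> (cmod c)\<^sup>2 * \<delta>" using h(2) by (intro mult_left_mono) auto
    also have "\<dots> < ((cmod c)\<^sup>2 + 1) * \<delta>" using \<open>0 < \<delta>\<close> by simp
    also have "\<dots> = \<epsilon>" using pos by (simp add: \<delta>_def)
    finally show "\<exists>h\<in>S. sqn M (\<lambda>x. c * f x - h x) < \<epsilon>" using scale[OF h(1), of c] by (intro bexI)
  qed
  have "bp_closed (space M) {f\<in>V. bdd_meas M f}"
    unfolding bp_closed_def
  proof (intro conjI ballI allI impI)
    fix F :: "nat \<Rightarrow> 'a \<Rightarrow> complex" and f C
    assume F: "\<forall>n. F n \<in> {f\<in>V. bdd_meas M f}" "\<forall>n. \<forall>x\<in>space M. cmod (F n x) \<le> C" "\<forall>x\<in>space M. (\<lambda>n. F n x) \<longlonglongrightarrow> f x"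
    have f: "bdd_meas M f" by (rule bdd_meas_limit[of M F C f]) (use F in auto)
    have lim: "(\<lambda>n. sqn M (\<lambda>x. f x - F n x)) \<longlonglongrightarrow> 0"
      unfolding sqn_def by (rule bdd_meas_L1_limit(2)[of F C f]) (use F in auto)
    have "f \<in> V"
      unfolding V_def
    proof (rule l2_closure_limit[OF bdd_meas_l2[OF f] S2])
      fix \<epsilon> :: real assume "0 < \<epsilon>"
      then obtain n where "sqn M (\<lambda>x. f x - F n x) < \<epsilon>"
        using eventually_happens'[OF sequentially_bot order_tendstoD(2)[OF lim]] by blast
      then show "\<exists>g\<in>l2_closure M S. sqn M (\<lambda>x. f x - g x) < \<epsilon>" using F(1) unfolding V_def by blast
    qed
    with f show "f \<in> {f\<in>V. bdd_meas M f}" by simp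
  qed (auto intro: V_add V_scale bdd_meas_add bdd_meas_scale)
  moreover have "(\<lambda>x. cis (lin_comb Y xs x)) \<in> {f\<in>V. bdd_meas M f}" for xs
    using bdd_meas_exp[OF gen, of xs] bdd_meas_l2 exps unfolding V_def l2_closure_iff by blast
  ultimately have ind: "indicator A \<in> V" if "A \<in> sets M" for A
    using bp_indicator[OF gen _ _ that] by blast
  have "f \<in> V" if f: "f \<in> l2_space M" for f
  proof -
    have fm [measurable]: "f \<in> borel_measurable M" and fi: "integrable M (\<lambda>x. (cmod (f x))\<^sup>2)"
      using f by (auto simp: l2_space_def)
    obtain F where F: "\<And>i. simple_function M (F i)" "\<And>x. x \<in> space M \<Longrightarrow> (\<lambda>i. F i x) \<longlonglongrightarrow> f x"
      "\<And>i x. x \<in> space M \<Longrightarrow> dist (F i x) 0 \<le> 2 * dist (f x) 0"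
      using borel_measurable_implies_sequence_metric[OF fm, of 0] by blast
    have FV: "F i \<in> V" for i
    proof -
      have zero: "(\<lambda>x. 0) \<in> V" using V_scale[OF ind[OF sets.empty_sets], of 0] by simp
      have sumV: "(\<lambda>x. \<Sum>k\<in>K. u k x) \<in> V" if "\<And>k. k \<in> K \<Longrightarrow> u k \<in> V" for K :: "complex set" and u
        using that
      proof (induction K rule: infinite_finite_induct)
        case (insert k K)
        then show ?case using V_add[of "u k" "\<lambda>x. \<Sum>k\<in>K. u k x"] by simp
      qed (simp_all add: zero)
      define u where "u = (\<lambda>x. \<Sum>k\<in>F i ` space M. k * indicator (F i -` {k} \<inter> space M) x)"
      have "u \<in> V" unfolding u_def
        by (intro sumV V_scale ind simple_functionD(2)[OF F(1)])
      moreover have Fu: "F i x = u x" if "x \<in> space M" for x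
      proof -
        have "u x = (\<Sum>k\<in>F i ` space M. if k = F i x then k else 0)"
          unfolding u_def
        proof (intro sum.cong refl)
          fix k show "k * indicator (F i -` {k} \<inter> space M) x = (if k = F i x then k else 0)"
            using that by (cases "k = F i x") (auto simp: indicator_def)
        qed
        also have "\<dots> = F i x"
          using that simple_functionD(1)[OF F(1)[of i]] by (simp add: sum.delta)
        finally show ?thesis by simp
      qed
      have "sqn M (\<lambda>x. F i x - h x) = sqn M (\<lambda>x. u x - h x)" for h
        unfolding sqn_def by (intro Bochner_Integration.integral_cong refl) (simp add: Fu)
      moreover have "F i \<in> l2_space M"
      proof -
        have "bdd_meas M (F i)"
          unfolding bdd_meas_def
          using borel_measurable_simple_function[OF F(1)] simple_functionD(1)[OF F(1)[of i]]
          by (auto intro!: exI[of _ "Max ((\<lambda>z. cmod z) ` F i ` space M)"])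
        then show ?thesis by (rule bdd_meas_l2)
      qed
      ultimately show ?thesis unfolding V_def l2_closure_iff by simp
    qed
    have [measurable]: "F i \<in> borel_measurable M" for i by (rule borel_measurable_simple_function[OF F(1)])
    have "(\<lambda>i. \<integral>x. (cmod (f x - F i x))\<^sup>2 \<partial>M) \<longlonglongrightarrow> (\<integral>x. 0 \<partial>M)"
    \<comment> \<open>The approximants satisfy \<open>cmod (F i x) \<le> 2 * cmod (f x)\<close>,
      whence the factor \<open>9 = (1 + 2)^2\<close>.\<close>
    proof (rule integral_dominated_convergence[where w = "\<lambda>x. 9 * (cmod (f x))\<^sup>2"])
      show "AE x in M. (\<lambda>i. (cmod (f x - F i x))\<^sup>2) \<longlonglongrightarrow> 0"
      proof (rule AE_I2)
        fix x assume "x \<in> space M"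
        from tendsto_power[OF tendsto_norm[OF tendsto_diff[OF tendsto_const[of "f x"] F(2)[OF this]]], of 2]
        show "(\<lambda>i. (cmod (f x - F i x))\<^sup>2) \<longlonglongrightarrow> 0" by simp
      qed
      show "AE x in M. norm ((cmod (f x - F i x))\<^sup>2) \<le> 9 * (cmod (f x))\<^sup>2" for i
      proof (rule AE_I2)
        fix x assume "x \<in> space M"
        then have "cmod (f x - F i x) \<le> 3 * cmod (f x)"
          using F(3)[of x i] norm_triangle_ineq4[of "f x" "F i x"] by simp
        from power_mono[OF this, of 2] show "norm ((cmod (f x - F i x))\<^sup>2) \<le> 9 * (cmod (f x))\<^sup>2"
          by (simp add: power_mult_distrib)
      qed
    qed (use fi in auto)
    then have lim: "(\<lambda>i. sqn M (\<lambda>x. f x - F i x)) \<longlonglongrightarrow> 0" by (simp add: sqn_def)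
    show "f \<in> V"
      unfolding V_def
    proof (rule l2_closure_limit[OF f S2])
      fix \<epsilon> :: real assume "0 < \<epsilon>"
      then obtain n where "sqn M (\<lambda>x. f x - F n x) < \<epsilon>"
        using eventually_happens'[OF sequentially_bot order_tendstoD(2)[OF lim]] by blast
      then show "\<exists>g\<in>l2_closure M S. sqn M (\<lambda>x. f x - g x) < \<epsilon>" using FV unfolding V_def by blast
    qed
  qed
  then show ?thesis using V2 unfolding V_def by blast
qed

lemma linear_span_family:
  assumes "finite A"
  shows "(\<lambda>x. \<Sum>k\<in>A. c k * f k x) \<in> linear_span (range f)"
proof -
  define F where "F = f ` A"
  \<comment> \<open>\<open>linear_span\<close> is indexed by functions, and different
    \<open>k\<close> may give the same function; their coefficients are collected.\<close>
  define b where "b = (\<lambda>h. \<Sum>k\<in>{k\<in>A. f k = h}. c k)"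
  have "(\<Sum>k\<in>A. c k * f k x) = (\<Sum>h\<in>F. b h * h x)" for x
  proof -
    have "(\<Sum>k\<in>A. c k * f k x) = (\<Sum>h\<in>F. \<Sum>k\<in>{k\<in>A. f k = h}. c k * f k x)"
      unfolding F_def by (rule sum.image_gen[OF assms])
    also have "\<dots> = (\<Sum>h\<in>F. b h * h x)"
      unfolding b_def sum_distrib_right by (intro sum.cong refl) auto
    finally show ?thesis .
  qed
  then have "(\<lambda>x. \<Sum>k\<in>A. c k * f k x) = (\<lambda>x. \<Sum>h\<in>F. b h * h x)" by (rule ext)
  moreover have "finite F" "F \<subseteq> range f" using assms by (auto simp: F_def)
  ultimately show ?thesis unfolding linear_span_def by blast
qed

lemma linear_span_scale: "h \<in> linear_span S \<Longrightarrow> (\<lambda>x. c * h x) \<in> linear_span S"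
proof -
  assume "h \<in> linear_span S"
  then obtain F b where F: "h = (\<lambda>x. \<Sum>f\<in>F. b f * f x)" "finite F" "F \<subseteq> S" unfolding linear_span_def by blast
  then have "(\<lambda>x. c * h x) = (\<lambda>x. \<Sum>f\<in>F. (c * b f) * f x)" by (simp add: sum_distrib_left mult.assoc)
  with F(2,3) show ?thesis unfolding linear_span_def
    by (intro CollectI exI[of _ F] exI[of _ "\<lambda>f. c * b f"]) simp
qed

lemma linear_span_add:
  assumes "g \<in> linear_span S" "h \<in> linear_span S"
  shows "(\<lambda>x. g x + h x) \<in> linear_span S"
proof -
  obtain F b where F: "g = (\<lambda>x. \<Sum>f\<in>F. b f * f x)" "finite F" "F \<subseteq> S" using assms(1) unfolding linear_span_def by blast
  obtain G c where G: "h = (\<lambda>x. \<Sum>f\<in>G. c f * f x)" "finite G" "G \<subseteq> S" using assms(2) unfolding linear_span_def by blast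
  define b' c' where "b' = (\<lambda>f. if f \<in> F then b f else 0)" and "c' = (\<lambda>f. if f \<in> G then c f else 0)"
  have "g x + h x = (\<Sum>f\<in>F \<union> G. (b' f + c' f) * f x)" for x
  proof -
    have "(\<Sum>f\<in>F \<union> G. (b' f + c' f) * f x) = (\<Sum>f\<in>F \<union> G. b' f * f x) + (\<Sum>f\<in>F \<union> G. c' f * f x)"
      by (simp add: distrib_right sum.distrib)
    also have "(\<Sum>f\<in>F \<union> G. b' f * f x) = g x"
      unfolding F(1) by (rule sum.mono_neutral_cong_right) (use F G in \<open>auto simp: b'_def\<close>)
    also have "(\<Sum>f\<in>F \<union> G. c' f * f x) = h x"
      unfolding G(1) by (rule sum.mono_neutral_cong_right) (use F G in \<open>auto simp: c'_def\<close>)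
    finally show ?thesis by simp
  qed
  then have "(\<lambda>x. g x + h x) = (\<lambda>x. \<Sum>f\<in>F \<union> G. (b' f + c' f) * f x)" by (rule ext)
  moreover have "finite (F \<union> G)" "F \<union> G \<subseteq> S" using F G by auto
  ultimately show ?thesis unfolding linear_span_def
    by (auto intro!: exI[of _ "F \<union> G"] exI[of _ "\<lambda>f. b' f + c' f"])
qed

lemma linear_span_bdd_meas:
  assumes "h \<in> linear_span S" "\<And>f. f \<in> S \<Longrightarrow> bdd_meas M f"
  shows "bdd_meas M h"
proof -
  obtain F b where F: "h = (\<lambda>x. \<Sum>f\<in>F. b f * f x)" "finite F" "F \<subseteq> S" using assms(1) unfolding linear_span_def by blast
  have "bdd_meas M (\<lambda>x. \<Sum>f\<in>F. b f * f x)" using F(2,3)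
  proof (induction F rule: finite_induct)
    case empty
    show ?case by (auto simp: bdd_meas_def)
  next
    case (insert f F)
    then show ?case using assms(2) by (simp add: bdd_meas_add bdd_meas_scale)
  qed
  then show ?thesis unfolding F(1) .
qed

lemma funpow_koopman: "(koopman S ^^ n) g = g \<circ> (S ^^ n)"
proof (induction n)
  case (Suc n)
  have "(koopman S ^^ Suc n) g = koopman S ((koopman S ^^ n) g)" by simp
  also have "\<dots> = koopman S (g \<circ> S ^^ n)" by (rule arg_cong[OF Suc])
  also have "\<dots> = g \<circ> (S ^^ n \<circ> S)"
    by (simp add: koopman_def o_assoc)
  finally show ?case by (simp only: funpow_Suc_right)
qed simp

section \<open>The infinite product and its Fock space\<close>

lemma sum_symmetric_int_interval:
  fixes f :: "int \<Rightarrow> 'b :: comm_monoid_add"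
  shows "(\<Sum>m\<in>{- int K..int K}. f m) = f 0 + (\<Sum>j<K. f (int j + 1) + f (- int j - 1))"
proof (induction K)
  case (Suc K)
  have "{- int (Suc K)..int (Suc K)} = insert (int K + 1) (insert (- int K - 1) {- int K..int K})"
    by auto
  then show ?case using Suc by (simp add: ac_simps)
qed simp

lemma ex_coords_below: "\<exists>J. coords_below J xs"
proof -
  have "coords_below (Suc (Max (insert 0 ((\<lambda>p. fst (fst p)) ` set xs)))) xs"
    unfolding coords_below_def by (auto intro!: le_imp_less_Suc Max_ge)
  then show ?thesis by blast
qed

text \<open>Label \<open>m = j + 1\<close> stands for coordinate \<open>j\<close>, and \<open>m = - j - 1\<close> for the conjugate; thus a shift
  multiplies \<open>hat xs m t\<close> by a character of \<open>m * t\<close>, the power \<open>Suc j\<close> being absorbed into \<open>m\<close>.\<close>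

definition hat :: "((nat \<times> int) \<times> real) list \<Rightarrow> int \<Rightarrow> real \<Rightarrow> complex" where
  "hat xs m t = (if m = 0 then 1 else if 0 < m then trig_list (proj (nat (m - 1)) xs) t
     else cnj (trig_list (proj (nat (- m - 1)) xs) t))"

lemma hat_simps [simp]: "hat xs 0 t = 1" "hat xs (int j + 1) t = trig_list (proj j xs) t"
  "hat xs (- int j - 1) t = cnj (trig_list (proj j xs) t)"
  by (auto simp: hat_def)

text \<open>The action of the \<open>k\<close>-th power of the product map on combinations: in
  coordinate \<open>j\<close> time advances by \<open>k\<close> steps of size
  \<open>Suc j\<close>.\<close>

definition shiftW :: "int \<Rightarrow> ((nat \<times> int) \<times> real) list \<Rightarrow> ((nat \<times> int) \<times> real) list" where
  "shiftW k xs = map (\<lambda>((j, n), r). ((j, n + k * int (Suc j)), r)) xs"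

lemma shiftW_simps [simp]: "shiftW k [] = []"
  "shiftW k (((j, n), r) # xs) = ((j, n + k * int (Suc j)), r) # shiftW k xs"
  by (simp_all add: shiftW_def)

lemma coords_below_shiftW [simp]: "coords_below J (shiftW k xs) = coords_below J xs"
  by (auto simp: coords_below_def shiftW_def)

lemma trig_list_proj_shiftW: "trig_list (proj j (shiftW k xs)) t = ex (of_int (k * int (Suc j)) * t) * trig_list (proj j xs) t"
proof (induction xs)
  case (Cons p xs)
  obtain i n r where p: "p = ((i, n), r)" by (cases p) auto
  show ?case
  proof (cases "i = j")
    case True
    have "ex (of_int (n + k * int (Suc j)) * t) = ex (of_int n * t) * ex (of_int (k * int (Suc j)) * t)"
      unfolding ex_add[symmetric] by (simp add: algebra_simps)
    then show ?thesis using Cons True unfolding p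
      by (simp add: algebra_simps del: of_nat_Suc of_int_add of_int_mult)
  next
    case False
    then show ?thesis using Cons unfolding p by simp
  qed
qed simp

lemma hat_shiftW:
  shows "hat (shiftW k xs) m t = ex (of_int k * (of_int m * t)) * hat xs m t"
proof (cases "m = 0")
  case False
  show ?thesis
  proof (cases "0 < m")
    case True
    then have "int (Suc (nat (m - 1))) = m" by simp
    then show ?thesis using True by (simp add: hat_def trig_list_proj_shiftW mult.assoc del: of_nat_Suc)
  next
    case neg: False
    with False have "int (Suc (nat (- m - 1))) = - m" by simp
    then show ?thesis using False neg by (simp add: hat_def trig_list_proj_shiftW mult.assoc del: of_nat_Suc)
  qed
qed simp

lemma sum_half_powers_le: "(\<Sum>m\<in>{-K..K} - {0}. (1 / 2 :: real) ^ nat \<bar>m\<bar>) \<le> 2"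
proof (cases "0 \<le> K")
  case True
  then obtain n where n: "K = int n" by (metis nonneg_int_cases)
  have "(\<Sum>j<n. (1 / 2 :: real) ^ j) = 2 - 2 * (1 / 2) ^ n" by (induction n) auto
  then have g: "(\<Sum>j<n. (1 / 2 :: real) ^ j) \<le> 2" by simp
  have "(\<Sum>m\<in>{-K..K}. (1 / 2 :: real) ^ nat \<bar>m\<bar>) = 1 + (\<Sum>j<n. (1 / 2) ^ j)"
    unfolding n sum_symmetric_int_interval
    by (auto simp: nat_add_distrib intro!: sum.cong)
  moreover have "(\<Sum>m\<in>{-K..K}. (1 / 2 :: real) ^ nat \<bar>m\<bar>) = 1 + (\<Sum>m\<in>{-K..K} - {0}. (1 / 2) ^ nat \<bar>m\<bar>)"
    using True by (subst sum.remove[of _ 0]) auto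
  ultimately show ?thesis using g by linarith
qed simp

context gaussian_system
begin

abbreviation W :: "(nat \<Rightarrow> 'a) measure" where "W \<equiv> countable_power M"

definition Y :: "nat \<times> int \<Rightarrow> (nat \<Rightarrow> 'a) \<Rightarrow> real" where "Y p w = y (snd p) (w (fst p))"

lemma W_prob: "prob_space W"
  unfolding countable_power_def by (intro prob_space_PiM prob_space_axioms)

sublocale W: prob_space W by (rule W_prob)

lemma space_W: "space W = {w. \<forall>i. w i \<in> space M}"
  by (auto simp: countable_power_def space_PiM PiE_def)

lemma component_W [measurable]: "(\<lambda>w. w i) \<in> measurable W M"
  unfolding countable_power_def by simp

lemma Y_meas [measurable]: "Y p \<in> borel_measurable W"
  unfolding Y_def by measurable

lemma gen_W: "generated_by W Y"
  unfolding generated_by_def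
proof (intro conjI allI impI)
  fix N' :: "(nat \<Rightarrow> 'a) measure" assume sp: "space N' = space W" and Ym: "\<forall>p. Y p \<in> borel_measurable N'"
  have comp: "(\<lambda>w. w i) \<in> measurable N' M" for i
  proof (rule measurable_generated_by[OF gen])
    show "(\<lambda>w. y n (w i)) \<in> borel_measurable N'" for n
      using Ym[rule_format, of "(i, n)"] by (simp add: Y_def[abs_def])
  qed (auto simp: sp space_W)
  have "(\<lambda>w i. w i) \<in> measurable N' (PiM UNIV (\<lambda>_. M))"
    by (rule measurable_PiM_single'[OF comp]) (auto simp: sp space_W)
  then have id: "(\<lambda>w. w) \<in> measurable N' W" by (simp add: countable_power_def)
  show "sets W \<subseteq> sets N'"
  proof
    fix A assume A: "A \<in> sets W"
    have "(\<lambda>w. w) -` A \<inter> space N' = A" using sets.sets_into_space[OF A] sp by auto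
    then show "A \<in> sets N'" using measurable_sets[OF id A] by simp
  qed
qed simp

lemma lin_comb_Y:
  "coords_below J xs \<Longrightarrow> lin_comb Y xs w = (\<Sum>j<J. lin_comb y (proj j xs) (w j))"
proof (induction xs)
  case (Cons p xs)
  obtain i n r where p: "p = ((i, n), r)" by (cases p) auto
  have "(\<Sum>j<J. lin_comb y (proj j (p # xs)) (w j)) = (\<Sum>j<J. (if j = i then r * y n (w i) else 0) + lin_comb y (proj j xs) (w j))"
    by (intro sum.cong refl) (auto simp: p)
  also have "\<dots> = r * y n (w i) + (\<Sum>j<J. lin_comb y (proj j xs) (w j))"
    using Cons.prems by (simp add: sum.distrib p)
  finally show ?case using Cons by (simp add: p Y_def)
qed simp

lemma cf_W:
  assumes "coords_below J xs"
  shows "(\<integral>w. cis (lin_comb Y xs w) \<partial>W) = exp (- (\<Sum>j<J. quad_form cov (proj j xs)) / 2)"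
proof -
  have "(\<integral>w. cis (lin_comb Y xs w) \<partial>W) = (\<integral>w. (\<Prod>j<J. cis (lin_comb y (proj j xs) (w j))) \<partial>W)"
    by (simp add: lin_comb_Y[OF assms] cis_conv_exp exp_sum sum_distrib_left)
  also have "\<dots> = (\<Prod>j<J. \<integral>x. cis (lin_comb y (proj j xs) x) \<partial>M)"
    unfolding countable_power_def
    by (rule integral_PiM_prod)
       (auto intro: prob_space_axioms bdd_meas_integrable bdd_meas_exp[OF gen])
  also have "\<dots> = (\<Prod>j<J. complex_of_real (exp (- quad_form cov (proj j xs) / 2)))"
    by (simp only: cf)
  also have "\<dots> = complex_of_real (exp (\<Sum>j<J. - quad_form cov (proj j xs) / 2))"
    by (simp only: of_real_prod exp_sum finite_lessThan)
  also have "(\<Sum>j<J. - quad_form cov (proj j xs) / 2) = - (\<Sum>j<J. quad_form cov (proj j xs)) / 2"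
    by (simp add: sum_negf sum_divide_distrib)
  finally show ?thesis .
qed

section \<open>The product transformation and its integer powers\<close>

abbreviation R :: "(nat \<Rightarrow> 'a) \<Rightarrow> (nat \<Rightarrow> 'a)" where "R \<equiv> product_of_powers T"

lemma R_space: "w \<in> space W \<Longrightarrow> R w \<in> space W"
  unfolding space_W product_of_powers_def using Tn_space[of _ "Suc _"] by blast

lemma Y_R: "w \<in> space W \<Longrightarrow> Y (j, n) (R w) = Y (j, n + int (Suc j)) w"
  unfolding Y_def product_of_powers_def fst_conv snd_conv by (rule y_Tn) (auto simp: space_W)

lemma Tin_space: "x \<in> space M \<Longrightarrow> (Ti ^^ n) x \<in> space M"
  by (induction n) (auto intro: Ti_space)

lemma Tn_Tin: "x \<in> space M \<Longrightarrow> (T ^^ n) ((Ti ^^ n) x) = x"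
proof (induction n arbitrary: x)
  case (Suc n)
  have "(T ^^ Suc n) ((Ti ^^ Suc n) x) = (T ^^ n) (T (Ti ((Ti ^^ n) x)))"
    by (simp only: funpow_Suc_right[of _ T] funpow.simps(2)[of _ Ti] comp_apply)
  then show ?case using Suc by (simp add: T_Ti Tin_space)
qed simp

lemma Tin_Tn: "x \<in> space M \<Longrightarrow> (Ti ^^ n) ((T ^^ n) x) = x"
proof (induction n arbitrary: x)
  case (Suc n)
  have "(Ti ^^ Suc n) ((T ^^ Suc n) x) = (Ti ^^ n) (Ti (T ((T ^^ n) x)))"
    by (simp only: funpow_Suc_right[of _ Ti] funpow.simps(2)[of _ T] comp_apply)
  then show ?case using Suc by (simp add: Ti_T Tn_space)
qed simp

lemma R_bij: "bij_betw R (space W) (space W)"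
proof (rule bij_betw_byWitness[where f' = "\<lambda>w i. (Ti ^^ Suc i) (w i)"])
  show "\<forall>w\<in>space W. (\<lambda>i. (Ti ^^ Suc i) (R w i)) = w"
    using Tin_Tn[of _ "Suc _"] unfolding space_W product_of_powers_def by auto
  show "\<forall>w\<in>space W. R (\<lambda>i. (Ti ^^ Suc i) (w i)) = w"
    using Tn_Tin[of _ "Suc _"] unfolding space_W product_of_powers_def by auto
  show "R ` space W \<subseteq> space W" using R_space by blast
  show "(\<lambda>w i. (Ti ^^ Suc i) (w i)) ` space W \<subseteq> space W"
    using Tin_space[of _ "Suc _"] unfolding space_W by blast
qed

definition Ri :: "(nat \<Rightarrow> 'a) \<Rightarrow> (nat \<Rightarrow> 'a)" where "Ri = the_inv_into (space W) R"

lemma Ri_space: "w \<in> space W \<Longrightarrow> Ri w \<in> space W"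
  using R_bij unfolding Ri_def bij_betw_def by (auto intro: the_inv_into_into)

lemma R_Ri: "w \<in> space W \<Longrightarrow> R (Ri w) = w"
  unfolding Ri_def by (rule f_the_inv_into_f_bij_betw[OF R_bij])

lemma Y_Ri: "w \<in> space W \<Longrightarrow> Y (j, n) (Ri w) = Y (j, n - int (Suc j)) w"
  using Y_R[OF Ri_space, of w j "n - int (Suc j)"] by (simp add: R_Ri)

lemma R_meas [measurable]: "R \<in> measurable W W"
proof (rule measurable_generated_by[OF gen_W])
  show "(\<lambda>w. Y p (R w)) \<in> borel_measurable W" for p
    by (cases p, simp only:, subst measurable_cong[OF Y_R]) auto
qed (auto intro: R_space)

lemma Ri_meas [measurable]: "Ri \<in> measurable W W"
proof (rule measurable_generated_by[OF gen_W])
  show "(\<lambda>w. Y p (Ri w)) \<in> borel_measurable W" for p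
    by (cases p, simp only:, subst measurable_cong[OF Y_Ri]) auto
qed (auto intro: Ri_space)

definition Rk :: "int \<Rightarrow> (nat \<Rightarrow> 'a) \<Rightarrow> (nat \<Rightarrow> 'a)" where
  "Rk k = (if 0 \<le> k then R ^^ nat k else Ri ^^ nat (- k))"

lemma koopman_power_Rk: "koopman_power W R k g = g \<circ> Rk k"
  by (simp add: koopman_power_def funpow_koopman Rk_def Ri_def)

lemma Rn_space: "w \<in> space W \<Longrightarrow> (R ^^ n) w \<in> space W"
  by (induction n) (auto intro: R_space)

lemma Rin_space: "w \<in> space W \<Longrightarrow> (Ri ^^ n) w \<in> space W"
  by (induction n) (auto intro: Ri_space)

lemma Y_Rn: "w \<in> space W \<Longrightarrow> Y (j, n) ((R ^^ k) w) = Y (j, n + int k * int (Suc j)) w"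
proof (induction k arbitrary: n)
  case (Suc k)
  have "Y (j, n) ((R ^^ Suc k) w) = Y (j, n + int (Suc j)) ((R ^^ k) w)"
    using Y_R[OF Rn_space[OF Suc.prems]] by simp
  also have "\<dots> = Y (j, n + int (Suc j) + int k * int (Suc j)) w" by (rule Suc.IH[OF Suc.prems])
  finally show ?case by (simp add: algebra_simps)
qed simp

lemma Y_Rin: "w \<in> space W \<Longrightarrow> Y (j, n) ((Ri ^^ k) w) = Y (j, n - int k * int (Suc j)) w"
proof (induction k arbitrary: n)
  case (Suc k)
  have "Y (j, n) ((Ri ^^ Suc k) w) = Y (j, n - int (Suc j)) ((Ri ^^ k) w)"
    using Y_Ri[OF Rin_space[OF Suc.prems]] by simp
  also have "\<dots> = Y (j, n - int (Suc j) - int k * int (Suc j)) w" by (rule Suc.IH[OF Suc.prems])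
  finally show ?case by (simp add: algebra_simps)
qed simp

lemma Y_Rk: "w \<in> space W \<Longrightarrow> Y (j, n) (Rk k w) = Y (j, n + k * int (Suc j)) w"
  by (auto simp: Rk_def Y_Rn Y_Rin simp del: of_nat_Suc)

lemma lin_comb_Rk: "w \<in> space W \<Longrightarrow> lin_comb Y xs (Rk k w) = lin_comb Y (shiftW k xs) w"
  by (induction xs) (auto simp: Y_Rk simp del: of_nat_Suc)

lemma Rk_meas [measurable]: "Rk k \<in> measurable W W"
proof -
  have "R ^^ n \<in> measurable W W" for n
  proof (induction n)
    case (Suc n)
    from measurable_comp[OF this R_meas] show ?case by (simp only: funpow.simps(2))
  qed (simp add: id_def)
  moreover have "Ri ^^ n \<in> measurable W W" for n
  proof (induction n)
    case (Suc n)
    from measurable_comp[OF this Ri_meas] show ?case by (simp only: funpow.simps(2))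
  qed (simp add: id_def)
  ultimately show ?thesis by (simp add: Rk_def)
qed

lemma proj_shiftW: "proj j (shiftW k xs) = shift (k * int (Suc j)) (proj j xs)"
  by (induction xs) (auto simp del: of_nat_Suc)

lemma Rk_distr: "distr W W (Rk k) = W"
proof (rule measure_preserving_by_exponentials[OF W_prob gen_W Rk_meas])
  fix xs
  obtain J where J: "coords_below J xs" using ex_coords_below by blast
  have "(\<integral>w. cis (lin_comb Y xs (Rk k w)) \<partial>W) = (\<integral>w. cis (lin_comb Y (shiftW k xs) w) \<partial>W)"
    by (intro Bochner_Integration.integral_cong refl) (simp add: lin_comb_Rk)
  also have "\<dots> = (\<integral>w. cis (lin_comb Y xs w) \<partial>W)"
    using J by (simp add: cf_W[of J] proj_shiftW quad_form_shift del: of_nat_Suc)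
  finally show "(\<integral>w. cis (lin_comb Y xs (Rk k w)) \<partial>W) = (\<integral>w. cis (lin_comb Y xs w) \<partial>W)" .
qed

lemma R_invertible: "invertible_mpt W R"
  using R_bij R_meas Ri_meas Rk_distr[of 1]
  by (simp add: invertible_mpt_def measure_preserving_map_def Ri_def Rk_def)

text \<open>The variance of \<open>lin_comb Y xs\<close> once \<open>K\<close> exceeds all
  coordinates in \<open>xs\<close>.\<close>

definition sq_norm :: "nat \<Rightarrow> ((nat \<times> int) \<times> real) list \<Rightarrow> real" where
  "sq_norm K xs = (\<Sum>j<K. quad_form cov (proj j xs))"

definition neg :: "((nat \<times> int) \<times> real) list \<Rightarrow> ((nat \<times> int) \<times> real) list" where
  "neg = map (\<lambda>(j, r). (j, - r))"

text \<open>Both sides are forms of \<open>exp \<langle>l, l'\<rangle>\<close>, the right-hand side by polarisation.\<close>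

lemma gram_tendsto:
  assumes "coords_below K l" "coords_below K l'"
  shows "(\<lambda>L. \<Prod>c<N L. 1 + (\<Sum>j<K. Re (trig_list (proj j l) (a L c) * cnj (trig_list (proj j l') (a L c)))) / N L)
     \<longlonglongrightarrow> exp (sq_norm K l / 2) * exp (sq_norm K l' / 2) * exp (- sq_norm K (l @ neg l') / 2)"
proof -
  define v v' where "v = (\<lambda>j t. trig_list (proj j l) t)" and "v' = (\<lambda>j t. trig_list (proj j l') t)"
  define p where "p = (\<lambda>L c. \<Sum>j<K. Re (v j (a L c) * cnj (v' j (a L c))))"
  have q: "(\<lambda>L. \<Sum>j<K. (\<Sum>c<N L. (cmod (trig_list (proj j xs) (a L c)))\<^sup>2) / N L) \<longlonglongrightarrow> sq_norm K xs" for xs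
    unfolding sq_norm_def by (intro tendsto_sum quad_form_tendsto)
  have pol: "Re (z * cnj z') = ((cmod z)\<^sup>2 + (cmod z')\<^sup>2 - (cmod (z - z'))\<^sup>2) / 2" for z z'
    unfolding cmod_power2 by (simp add: algebra_simps power2_eq_square)
  have avg: "(\<Sum>c<N L. p L c) / N L = ((\<Sum>j<K. (\<Sum>c<N L. (cmod (trig_list (proj j l) (a L c)))\<^sup>2) / N L)
      + (\<Sum>j<K. (\<Sum>c<N L. (cmod (trig_list (proj j l') (a L c)))\<^sup>2) / N L)
      - (\<Sum>j<K. (\<Sum>c<N L. (cmod (trig_list (proj j (l @ neg l')) (a L c)))\<^sup>2) / N L)) / 2" for L
    unfolding p_def pol
    by (subst sum.swap)
       (simp add: v_def v'_def neg_def proj_neg trig_list_neg sum_divide_distrib[symmetric] sum.distrib sum_subtractf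
          add_divide_distrib diff_divide_distrib)
  have e: "(\<lambda>L. exp ((\<Sum>c<N L. p L c) / N L)) \<longlonglongrightarrow> exp ((sq_norm K l + sq_norm K l' - sq_norm K (l @ neg l')) / 2)"
    unfolding avg by (intro tendsto_intros q) auto
  define B where "B = (\<Sum>j<K. (\<Sum>(n, r)\<leftarrow>proj j l. \<bar>r\<bar>) * (\<Sum>(n, r)\<leftarrow>proj j l'. \<bar>r\<bar>))"
  have "\<bar>p L c\<bar> \<le> B" for L c
    unfolding p_def B_def
  proof (rule order_trans[OF sum_abs], rule sum_mono)
    fix j
    have "\<bar>Re (v j (a L c) * cnj (v' j (a L c)))\<bar> \<le> cmod (v j (a L c) * cnj (v' j (a L c)))" by (rule abs_Re_le_cmod)
    also have "\<dots> = cmod (v j (a L c)) * cmod (v' j (a L c))" by (simp add: norm_mult)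
    also have "\<dots> \<le> (\<Sum>(n, r)\<leftarrow>proj j l. \<bar>r\<bar>) * (\<Sum>(n, r)\<leftarrow>proj j l'. \<bar>r\<bar>)"
      unfolding v_def v'_def
      by (intro mult_mono trig_list_bound order_trans[OF norm_ge_zero trig_list_bound]) auto
    finally show "\<bar>Re (v j (a L c) * cnj (v' j (a L c)))\<bar> \<le> (\<Sum>(n, r)\<leftarrow>proj j l. \<bar>r\<bar>) * (\<Sum>(n, r)\<leftarrow>proj j l'. \<bar>r\<bar>)" .
  qed
  then have "(\<lambda>L. exp ((\<Sum>c<N L. p L c) / N L) - (\<Prod>c<N L. 1 + p L c / N L)) \<longlonglongrightarrow> 0"
    by (intro exp_avg_minus_prod_tendsto_0[OF N_at_top])
  from tendsto_diff[OF e this]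
  have lim: "(\<lambda>L. \<Prod>c<N L. 1 + p L c / N L) \<longlonglongrightarrow> exp ((sq_norm K l + sq_norm K l' - sq_norm K (l @ neg l')) / 2)"
    by simp
  have "exp (A / 2) * exp (B / 2) * exp (- C / 2) = exp ((A + B - C) / 2)" for A B C :: real
    unfolding exp_add[symmetric] by (rule arg_cong[of _ _ exp]) (simp add: field_simps)
  with lim show ?thesis unfolding p_def v_def v'_def by (simp only:)
qed

text \<open>\<open>Re z = (z + cnj z) / 2\<close> splits coordinate \<open>j\<close> into the labels
  \<open>j + 1\<close> and \<open>- j - 1\<close> of weight \<open>1 / (2 * N L)\<close>, and label
  0 stands for the summand 1; expanding the product picks one label per cell.\<close>

lemma gram_expansion:
  "complex_of_real (\<Prod>c<N L. 1 + (\<Sum>j<K. Re (trig_list (proj j l) (a L c) * cnj (trig_list (proj j l') (a L c)))) / N L)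
    = (\<Sum>\<kappa>\<in>PiE {..<N L} (\<lambda>_. {- int K..int K}). (\<Prod>c<N L. complex_of_real (if \<kappa> c = 0 then 1 else 1 / (2 * N L)))
        * (\<Prod>c<N L. hat l (\<kappa> c) (a L c)) * cnj (\<Prod>c<N L. hat l' (\<kappa> c) (a L c)))"
proof -
  define wt where "wt = (\<lambda>m::int. complex_of_real (if m = 0 then 1 else 1 / (2 * N L)))"
  have 1: "complex_of_real (1 + (\<Sum>j<K. Re (trig_list (proj j l) t * cnj (trig_list (proj j l') t))) / N L)
     = (\<Sum>m\<in>{- int K..int K}. wt m * hat l m t * cnj (hat l' m t))" for t
  proof -
    have re: "complex_of_real (Re z) = (z + cnj z) / 2" for z by (simp add: complex_eq_iff)
    have nz: "wt (int j + 1) = 1 / (2 * of_nat (N L))" "wt (- int j - 1) = 1 / (2 * of_nat (N L))" for j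
      by (auto simp: wt_def)
    have "complex_of_real (1 + (\<Sum>j<K. Re (trig_list (proj j l) t * cnj (trig_list (proj j l') t))) / N L)
       = 1 + (\<Sum>j<K. complex_of_real (Re (trig_list (proj j l) t * cnj (trig_list (proj j l') t)))) / of_nat (N L)"
      by simp
    also have "\<dots> = 1 + (\<Sum>j<K. wt (int j + 1) * hat l (int j + 1) t * cnj (hat l' (int j + 1) t)
         + wt (- int j - 1) * hat l (- int j - 1) t * cnj (hat l' (- int j - 1) t))"
      unfolding re hat_simps nz sum_divide_distrib
      by (intro arg_cong[of _ _ "(+) 1"] sum.cong refl) (simp add: add_divide_distrib)
    also have "\<dots> = (\<Sum>m\<in>{- int K..int K}. wt m * hat l m t * cnj (hat l' m t))"
      unfolding sum_symmetric_int_interval by (simp add: wt_def)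
    finally show ?thesis .
  qed
  have "complex_of_real (\<Prod>c<N L. 1 + (\<Sum>j<K. Re (trig_list (proj j l) (a L c) * cnj (trig_list (proj j l') (a L c)))) / N L)
    = (\<Prod>c<N L. \<Sum>m\<in>{- int K..int K}. wt m * hat l m (a L c) * cnj (hat l' m (a L c)))"
    unfolding of_real_prod 1 ..
  also have "\<dots> = (\<Sum>\<kappa>\<in>PiE {..<N L} (\<lambda>_. {- int K..int K}). \<Prod>c<N L. wt (\<kappa> c) * hat l (\<kappa> c) (a L c) * cnj (hat l' (\<kappa> c) (a L c)))"
    by (rule prod_sum_PiE) auto
  finally show ?thesis by (simp add: prod.distrib wt_def)
qed

text \<open>Norms of finite combinations depend only on the Gram matrix, and the factors
  \<open>exp (sq_norm K (l \<alpha>) / 2)\<close> normalise the exponentials so that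
  \<open>gram_tendsto\<close> applies. The combination is fixed while \<open>L\<close>
  grows.\<close>

lemma fock_isometry:
  fixes l :: "'i \<Rightarrow> ((nat \<times> int) \<times> real) list" and \<beta> :: "'i \<Rightarrow> complex"
  assumes I: "finite I" and K: "\<And>\<alpha>. \<alpha> \<in> I \<Longrightarrow> coords_below K (l \<alpha>)"
  shows "(\<lambda>L. \<Sum>\<kappa>\<in>PiE {..<N L} (\<lambda>_. {- int K..int K}). (\<Prod>c<N L. if \<kappa> c = 0 then 1 else 1 / (2 * N L))
        * (cmod (\<Sum>\<alpha>\<in>I. \<beta> \<alpha> * (\<Prod>c<N L. hat (l \<alpha>) (\<kappa> c) (a L c))))\<^sup>2)
     \<longlonglongrightarrow> sqn W (\<lambda>w. \<Sum>\<alpha>\<in>I. \<beta> \<alpha> * exp (sq_norm K (l \<alpha>) / 2) * cis (lin_comb Y (l \<alpha>) w))"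
proof -
  define b where "b = (\<lambda>\<alpha>. \<beta> \<alpha> * complex_of_real (exp (sq_norm K (l \<alpha>) / 2)))"
  define E where "E = (\<lambda>\<alpha> \<alpha>'. exp (sq_norm K (l \<alpha>) / 2) * exp (sq_norm K (l \<alpha>') / 2) * exp (- sq_norm K (l \<alpha> @ neg (l \<alpha>')) / 2))"
  have ebdd: "bdd_meas W (\<lambda>w. cis (lin_comb Y xs w))" for xs by (rule bdd_meas_exp[OF gen_W])
  have inner: "(\<integral>w. cis (lin_comb Y (l \<alpha>) w) * cnj (cis (lin_comb Y (l \<alpha>') w)) \<partial>W)
      = exp (- sq_norm K (l \<alpha> @ neg (l \<alpha>')) / 2)" if "\<alpha> \<in> I" "\<alpha>' \<in> I" for \<alpha> \<alpha>'
  proof -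
    have "(\<integral>w. cis (lin_comb Y (l \<alpha>) w) * cnj (cis (lin_comb Y (l \<alpha>') w)) \<partial>W)
      = (\<integral>w. cis (lin_comb Y (l \<alpha> @ neg (l \<alpha>')) w) \<partial>W)"
      by (intro Bochner_Integration.integral_cong refl) (simp add: neg_def lin_comb_neg cis_cnj cis_mult)
    also have "\<dots> = exp (- sq_norm K (l \<alpha> @ neg (l \<alpha>')) / 2)"
      unfolding sq_norm_def by (rule cf_W) (use K that in \<open>simp add: neg_def\<close>)
    finally show ?thesis .
  qed
  have sq: "complex_of_real ((cmod (\<Sum>\<alpha>\<in>I. z \<alpha>))\<^sup>2) = (\<Sum>\<alpha>\<in>I. \<Sum>\<alpha>'\<in>I. z \<alpha> * cnj (z \<alpha>'))" for z :: "'i \<Rightarrow> complex"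
    using complex_norm_square[of "\<Sum>\<alpha>\<in>I. z \<alpha>"] by (simp add: sum_product)
  have "complex_of_real (sqn W (\<lambda>w. \<Sum>\<alpha>\<in>I. b \<alpha> * cis (lin_comb Y (l \<alpha>) w)))
     = (\<integral>w. (\<Sum>\<alpha>\<in>I. \<Sum>\<alpha>'\<in>I. (b \<alpha> * cnj (b \<alpha>')) * (cis (lin_comb Y (l \<alpha>) w) * cnj (cis (lin_comb Y (l \<alpha>') w)))) \<partial>W)"
    unfolding sqn_def integral_complex_of_real[symmetric] sq by (simp add: mult_ac)
  also have "\<dots> = (\<Sum>\<alpha>\<in>I. \<Sum>\<alpha>'\<in>I. (b \<alpha> * cnj (b \<alpha>')) * (\<integral>w. cis (lin_comb Y (l \<alpha>) w) * cnj (cis (lin_comb Y (l \<alpha>') w)) \<partial>W))"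
  proof -
    have int: "integrable W (\<lambda>w. cis (lin_comb Y (l \<alpha>) w) * cnj (cis (lin_comb Y (l \<alpha>') w)))" for \<alpha> \<alpha>'
    proof -
      have "integrable W (\<lambda>w. cis (lin_comb Y (l \<alpha> @ neg (l \<alpha>')) w))" by (rule W.bdd_meas_integrable[OF ebdd])
      then show ?thesis by (simp add: neg_def lin_comb_neg cis_cnj cis_mult)
    qed
    then show ?thesis by (simp add: Bochner_Integration.integral_sum)
  qed
  also have "\<dots> = (\<Sum>\<alpha>\<in>I. \<Sum>\<alpha>'\<in>I. (\<beta> \<alpha> * cnj (\<beta> \<alpha>')) * complex_of_real (E \<alpha> \<alpha>'))"
    by (intro sum.cong refl) (simp add: inner b_def E_def)
  finally have norm: "complex_of_real (sqn W (\<lambda>w. \<Sum>\<alpha>\<in>I. b \<alpha> * cis (lin_comb Y (l \<alpha>) w)))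
     = (\<Sum>\<alpha>\<in>I. \<Sum>\<alpha>'\<in>I. (\<beta> \<alpha> * cnj (\<beta> \<alpha>')) * complex_of_real (E \<alpha> \<alpha>'))" .
  define G where "G = (\<lambda>L \<alpha> \<alpha>'. \<Prod>c<N L. 1 + (\<Sum>j<K. Re (trig_list (proj j (l \<alpha>)) (a L c) * cnj (trig_list (proj j (l \<alpha>')) (a L c)))) / N L)"
  have lim: "(\<lambda>L. \<Sum>\<alpha>\<in>I. \<Sum>\<alpha>'\<in>I. (\<beta> \<alpha> * cnj (\<beta> \<alpha>')) * complex_of_real (G L \<alpha> \<alpha>'))
     \<longlonglongrightarrow> complex_of_real (sqn W (\<lambda>w. \<Sum>\<alpha>\<in>I. b \<alpha> * cis (lin_comb Y (l \<alpha>) w)))"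
    unfolding norm G_def E_def by (intro tendsto_sum tendsto_mult tendsto_const tendsto_of_real gram_tendsto K)
  have "(\<Sum>\<alpha>\<in>I. \<Sum>\<alpha>'\<in>I. (\<beta> \<alpha> * cnj (\<beta> \<alpha>')) * complex_of_real (G L \<alpha> \<alpha>'))
     = complex_of_real (\<Sum>\<kappa>\<in>PiE {..<N L} (\<lambda>_. {- int K..int K}). (\<Prod>c<N L. if \<kappa> c = 0 then 1 else 1 / (2 * N L))
        * (cmod (\<Sum>\<alpha>\<in>I. \<beta> \<alpha> * (\<Prod>c<N L. hat (l \<alpha>) (\<kappa> c) (a L c))))\<^sup>2)" for L
  proof -
    define D where "D = PiE {..<N L} (\<lambda>_. {- int K..int K})"
    define wt where "wt = (\<lambda>\<kappa>::nat \<Rightarrow> int. \<Prod>c<N L. complex_of_real (if \<kappa> c = 0 then 1 else 1 / (2 * N L)))"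
    define H where "H = (\<lambda>\<alpha> \<kappa>. \<Prod>c<N L. hat (l \<alpha>) (\<kappa> c) (a L c))"
    have "(\<Sum>\<alpha>\<in>I. \<Sum>\<alpha>'\<in>I. (\<beta> \<alpha> * cnj (\<beta> \<alpha>')) * complex_of_real (G L \<alpha> \<alpha>'))
      = (\<Sum>\<alpha>\<in>I. \<Sum>\<alpha>'\<in>I. \<Sum>\<kappa>\<in>D. wt \<kappa> * ((\<beta> \<alpha> * H \<alpha> \<kappa>) * cnj (\<beta> \<alpha>' * H \<alpha>' \<kappa>)))"
      unfolding G_def gram_expansion sum_distrib_left D_def wt_def H_def
      by (intro sum.cong refl) (simp add: mult_ac)
    also have "\<dots> = (\<Sum>\<alpha>\<in>I. \<Sum>\<kappa>\<in>D. \<Sum>\<alpha>'\<in>I. wt \<kappa> * ((\<beta> \<alpha> * H \<alpha> \<kappa>) * cnj (\<beta> \<alpha>' * H \<alpha>' \<kappa>)))"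
      by (intro sum.cong refl sum.swap)
    also have "\<dots> = (\<Sum>\<kappa>\<in>D. \<Sum>\<alpha>\<in>I. \<Sum>\<alpha>'\<in>I. wt \<kappa> * ((\<beta> \<alpha> * H \<alpha> \<kappa>) * cnj (\<beta> \<alpha>' * H \<alpha>' \<kappa>)))"
      by (rule sum.swap)
    also have "\<dots> = (\<Sum>\<kappa>\<in>D. wt \<kappa> * complex_of_real ((cmod (\<Sum>\<alpha>\<in>I. \<beta> \<alpha> * H \<alpha> \<kappa>))\<^sup>2))"
      unfolding sq sum_distrib_left ..
    finally show ?thesis by (simp add: D_def wt_def H_def)
  qed
  with lim have "(\<lambda>L. complex_of_real (\<Sum>\<kappa>\<in>PiE {..<N L} (\<lambda>_. {- int K..int K}). (\<Prod>c<N L. if \<kappa> c = 0 then 1 else 1 / (2 * N L))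
        * (cmod (\<Sum>\<alpha>\<in>I. \<beta> \<alpha> * (\<Prod>c<N L. hat (l \<alpha>) (\<kappa> c) (a L c))))\<^sup>2))
     \<longlonglongrightarrow> complex_of_real (sqn W (\<lambda>w. \<Sum>\<alpha>\<in>I. b \<alpha> * cis (lin_comb Y (l \<alpha>) w)))" by (simp only:)
  then show ?thesis unfolding tendsto_of_real_iff b_def .
qed

end

section \<open>The cyclic vector\<close>

lemma proj_sum_le:
  assumes "\<And>n r. 0 \<le> f n r"
  shows "(\<Sum>(n, r)\<leftarrow>proj j xs. f n r :: real) \<le> (\<Sum>((i, n), r)\<leftarrow>xs. f n r)"
proof (induction xs)
  case (Cons p xs)
  obtain i n r where "p = ((i, n), r)" by (cases p) auto
  then show ?case using Cons assms[of n r] by auto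
qed simp

text \<open>Only time 0 enters, so the one-particle amplitudes do not depend on positions. They are
  nonzero for all labels of absolute value at most \<open>K\<close>, and their decay makes the
  limiting series converge.\<close>

definition cyc_list :: "nat \<Rightarrow> ((nat \<times> int) \<times> real) list" where
  "cyc_list K = map (\<lambda>j. ((j, 0), (1 / 2) ^ Suc j)) [0..<K]"

lemma coords_below_cyc_list: "coords_below K (cyc_list K)"
  by (auto simp: cyc_list_def coords_below_def)

lemma proj_cyc_list: "j < K \<Longrightarrow> proj j (cyc_list K) = [(0, (1 / 2) ^ Suc j)]"
proof (induction K)
  case (Suc K)
  have cl: "cyc_list (Suc K) = cyc_list K @ [((K, 0), (1 / 2) ^ Suc K)]" by (simp add: cyc_list_def)
  show ?case
  proof (cases "j < K")
    case True
    then show ?thesis using Suc.IH unfolding cl by simp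
  next
    case False
    with Suc.prems have "j = K" by simp
    then show ?thesis unfolding cl using proj_above[OF coords_below_cyc_list[of K], of K] by simp
  qed
qed simp

lemma hat_cyc_list:
  assumes "\<bar>m\<bar> \<le> int K"
  shows "hat (cyc_list K) m t = of_real ((1 / 2) ^ nat \<bar>m\<bar>)"
proof (cases "m = 0")
  case False
  have pos: "trig_list (proj j (cyc_list K)) t = of_real ((1 / 2) ^ Suc j)" if "j < K" for j
    using proj_cyc_list[OF that] by simp
  show ?thesis
  proof (cases "0 < m")
    case True
    then have "nat (m - 1) < K" "Suc (nat (m - 1)) = nat \<bar>m\<bar>" using assms by auto
    then show ?thesis using True pos[of "nat (m - 1)"] by (simp add: hat_def del: power_Suc)
  next
    case neg: False
    then have "nat (- m - 1) < K" "Suc (nat (- m - 1)) = nat \<bar>m\<bar>" using assms False by auto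
    then show ?thesis using False neg pos[of "nat (- m - 1)"] by (simp add: hat_def del: power_Suc)
  qed
qed simp

context gaussian_system
begin

lemma lin_comb_cyc_list: "lin_comb Y (cyc_list K) w = (\<Sum>j<K. (1 / 2) ^ Suc j * Y (j, 0) w)"
  by (simp add: lin_comb_def cyc_list_def o_def interv_sum_list_conv_sum_set_nat atLeast0LessThan)

text \<open>The sum has an arbitrary value where the series diverges, which is a null set by
  \<open>AE_summable\<close>; boundedness and measurability hold regardless.\<close>

definition cyc :: "(nat \<Rightarrow> 'a) \<Rightarrow> complex" where
  "cyc w = cis (\<Sum>j. (1 / 2) ^ Suc j * Y (j, 0) w)"

text \<open>The weights add up to 1, so the expected sum of absolute values is the first absolute
  moment of a standard normal variable, which is finite.\<close>

lemma AE_summable: "AE w in W. summable (\<lambda>j. (1 / 2) ^ Suc j * Y (j, 0) w)"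
proof -
  have "integrable std_normal_distribution (\<lambda>x. x ^ 1)"
    by (rule integrable_std_normal_distribution_moment)
  then have "integrable (distr M borel (y 0)) (\<lambda>x. x)" by (simp add: y_0_std_normal)
  then have "integrable M (y 0)" by (simp add: integrable_distr_eq)
  then have fin: "(\<integral>\<^sup>+x. ennreal \<bar>y 0 x\<bar> \<partial>M) < \<infinity>" by (simp add: integrable_iff_bounded)
  have coord: "(\<integral>\<^sup>+w. ennreal \<bar>Y (j, 0) w\<bar> \<partial>W) = (\<integral>\<^sup>+x. ennreal \<bar>y 0 x\<bar> \<partial>M)" for j
  proof -
    have "distr W M (\<lambda>w. w j) = M"
      unfolding countable_power_def by (intro distr_PiM_component prob_space_axioms) auto
    then have "(\<integral>\<^sup>+x. ennreal \<bar>y 0 x\<bar> \<partial>M) = (\<integral>\<^sup>+x. ennreal \<bar>y 0 x\<bar> \<partial>distr W M (\<lambda>w. w j))" by simp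
    also have "\<dots> = (\<integral>\<^sup>+w. ennreal \<bar>y 0 (w j)\<bar> \<partial>W)" by (rule nn_integral_distr) auto
    finally show ?thesis by (simp add: Y_def)
  qed
  have "(\<integral>\<^sup>+w. (\<Sum>j. ennreal ((1 / 2) ^ Suc j * \<bar>Y (j, 0) w\<bar>)) \<partial>W)
      = (\<Sum>j. \<integral>\<^sup>+w. ennreal ((1 / 2) ^ Suc j) * ennreal \<bar>Y (j, 0) w\<bar> \<partial>W)"
  proof -
    have "ennreal ((1 / 2) ^ Suc j * \<bar>Y (j, 0) w\<bar>) = ennreal ((1 / 2) ^ Suc j) * ennreal \<bar>Y (j, 0) w\<bar>" for j w
      by (rule ennreal_mult) auto
    then show ?thesis by (simp only:) (rule nn_integral_suminf, measurable)
  qed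
  also have "\<dots> = (\<Sum>j. ennreal ((1 / 2) ^ Suc j) * (\<integral>\<^sup>+x. ennreal \<bar>y 0 x\<bar> \<partial>M))"
    by (subst nn_integral_cmult) (auto simp: coord)
  also have "\<dots> = (\<Sum>j. ennreal ((1 / 2) ^ Suc j)) * (\<integral>\<^sup>+x. ennreal \<bar>y 0 x\<bar> \<partial>M)"
    by (rule ennreal_suminf_multc)
  also have "(\<Sum>j. ennreal ((1 / 2) ^ Suc j)) = 1"
  proof -
    have "(\<Sum>j. ennreal ((1 / 2) ^ Suc j)) = ennreal (\<Sum>j. (1 / 2) ^ Suc j)"
      by (intro suminf_ennreal2 sums_summable[OF power_half_series] zero_le_power) simp
    also have "(\<Sum>j. (1 / 2 :: real) ^ Suc j) = 1" by (rule sums_unique[symmetric, OF power_half_series])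
    finally show ?thesis by (simp only: ennreal_1)
  qed
  finally have "(\<integral>\<^sup>+w. (\<Sum>j. ennreal ((1 / 2) ^ Suc j * \<bar>Y (j, 0) w\<bar>)) \<partial>W) \<noteq> \<infinity>" using fin by simp
  then have "AE w in W. (\<Sum>j. ennreal ((1 / 2) ^ Suc j * \<bar>Y (j, 0) w\<bar>)) \<noteq> \<infinity>"
    by (rule nn_integral_noteq_infinite[rotated]) measurable
  then show ?thesis
  proof eventually_elim
    case (elim w)
    have "summable (\<lambda>j. (1 / 2) ^ Suc j * \<bar>Y (j, 0) w\<bar>)"
      by (rule summable_suminf_not_top) (use elim in auto)
    then have "summable (\<lambda>j. \<bar>(1 / 2) ^ Suc j * Y (j, 0) w\<bar>)" by (simp add: abs_mult)
    then show ?case by (rule summable_rabs_cancel)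
  qed
qed

lemma cyc_bdd: "bdd_meas W cyc"
proof -
  have "(\<lambda>w. \<Sum>j. (1 / 2) ^ Suc j * Y (j, 0) w) \<in> borel_measurable W" by measurable
  then have "cyc \<in> borel_measurable W" unfolding cyc_def[abs_def] cis_conv_exp by measurable
  then show ?thesis unfolding bdd_meas_def by (auto simp: cyc_def intro: exI[of _ 1])
qed

text \<open>The exceptional null set may be moved by \<open>Rk k\<close> because this map preserves
  the measure.\<close>

lemma AE_cyc_limit: "AE w in W. (\<lambda>K. cis (lin_comb Y (cyc_list K) (Rk k w))) \<longlonglongrightarrow> cyc (Rk k w)"
proof -
  have "AE w in W. (\<lambda>K. cis (lin_comb Y (cyc_list K) w)) \<longlonglongrightarrow> cyc w"
    using AE_summable
  proof eventually_elim
    case (elim w)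
    show ?case unfolding lin_comb_cyc_list cyc_def by (intro tendsto_cis summable_LIMSEQ elim)
  qed
  then have "AE w in distr W W (Rk k). (\<lambda>K. cis (lin_comb Y (cyc_list K) w)) \<longlonglongrightarrow> cyc w"
    unfolding Rk_distr .
  then show ?thesis by (rule AE_distrD[OF Rk_meas])
qed

text \<open>The coefficients found on configurations are kept. For each truncation \<open>K\<close>
  the limit in \<open>L\<close> turns the estimate on configurations into one on exponentials; then
  \<open>K\<close> tends to infinity by dominated convergence.\<close>

lemma exponential_approx:
  assumes \<epsilon>: "0 < \<epsilon>"
  obtains A b where "finite A" "sqn W (\<lambda>w. cis (lin_comb Y xs w) - (\<Sum>i\<in>A. b i * cyc (Rk i w))) < \<epsilon>"
proof -
  obtain J where J: "coords_below J xs" using ex_coords_below by blast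
  define B0 where "B0 = (\<Sum>((i, n), r)\<leftarrow>xs. \<bar>r\<bar>)"
  define C1 where "C1 = (\<Sum>((i, n), r)\<leftarrow>xs. \<bar>r\<bar> * (2 * pi * \<bar>real_of_int n\<bar>))"
  \<comment> \<open>For labels of absolute value at most \<open>J\<close> one has
    \<open>tt m \<ge> (1 / 2) ^ J\<close>, so \<open>R0 * tt m\<close> dominates the amplitude bound
    \<open>B0\<close>; beyond \<open>J\<close> the amplitudes of the target vanish.\<close>
  define R0 where "R0 = max 1 B0 * 2 ^ J"
  define tt where "tt = (\<lambda>m::int. (1 / 2 :: real) ^ nat \<bar>m\<bar>)"
  define q where "q = (\<lambda>m::int. if m = 0 then 1 else R0 * tt m)"
  have R0: "1 \<le> R0" unfolding R0_def using mult_mono[of 1 "max 1 B0" 1 "2 ^ J"] by simp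
  have C1: "0 \<le> C1" unfolding C1_def by (intro sum_list_nonneg) auto
  have tt1: "tt m \<le> 1" "0 < tt m" for m by (auto simp: tt_def power_le_one)
  have big: "max 1 B0 \<le> R0 * tt m" if "\<bar>m\<bar> \<le> int J" for m
  proof -
    have "nat \<bar>m\<bar> \<le> J" using that by simp
    then have "(1 / 2 :: real) ^ J \<le> tt m" unfolding tt_def by (intro power_decreasing) auto
    then have "2 ^ J * (1 / 2 :: real) ^ J \<le> 2 ^ J * tt m" by (intro mult_left_mono) auto
    then have "1 \<le> 2 ^ J * tt m" by (simp add: power_mult_distrib[symmetric])
    then have "max 1 B0 * 1 \<le> max 1 B0 * (2 ^ J * tt m)" by (intro mult_left_mono) auto
    then show ?thesis by (simp add: R0_def mult.assoc)
  qed
  have above: "hat xs m t = 0" if "\<not> \<bar>m\<bar> \<le> int J" for m t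
  proof -
    have "J \<le> nat (m - 1)" if "0 < m" using \<open>\<not> \<bar>m\<bar> \<le> int J\<close> that by linarith
    moreover have "J \<le> nat (- m - 1)" if "m < 0" using \<open>\<not> \<bar>m\<bar> \<le> int J\<close> that by linarith
    ultimately show ?thesis using that proj_above[OF J] by (cases "0 < m") (auto simp: hat_def)
  qed
  have tb: "cmod (trig_list (proj j xs) t) \<le> B0" for j t
    using trig_list_bound[of "proj j xs" t] proj_sum_le[of "\<lambda>n r. \<bar>r\<bar>" j xs] unfolding B0_def by simp
  have tl: "cmod (trig_list (proj j xs) s - trig_list (proj j xs) t) \<le> C1 * \<bar>s - t\<bar>" for j s t
  proof -
    have "(\<Sum>(n, r)\<leftarrow>proj j xs. \<bar>r\<bar> * (2 * pi * \<bar>real_of_int n\<bar>)) \<le> C1"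
      unfolding C1_def by (rule proj_sum_le) auto
    then show ?thesis
      using trig_list_lipschitz[of "proj j xs" s t] mult_right_mono[of _ C1 "\<bar>s - t\<bar>"] by (meson abs_ge_zero order_trans)
  qed
  interpret S: spectral_data N mult d a "hat xs" tt q C1 "2 * R0\<^sup>2" R0
  proof
    fix m :: int and s t :: real and K :: int
    show "hat xs 0 t = 1" "tt 0 = 1" "0 < tt m" "q 0 = 1" "1 \<le> R0" "0 \<le> C1" "0 \<le> 2 * R0\<^sup>2"
      using R0 C1 by (simp_all add: tt_def q_def)
    show "tt m \<le> q m"
      using mult_right_mono[OF R0, of "tt m"] tt1[of m] by (auto simp: q_def)
    show "q m \<le> R0 * tt m" using R0 by (auto simp: q_def tt_def)
    show "cmod (hat xs m t) \<le> q m"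
    proof (cases "m = 0")
      case False
      show ?thesis
      proof (cases "\<bar>m\<bar> \<le> int J")
        case True
        have "cmod (hat xs m t) \<le> B0" using tb False by (auto simp: hat_def)
        then show ?thesis using big[OF True] False by (simp add: q_def)
      next
        case big': False
        then show ?thesis using above[OF big', of t] False R0 tt1[of m] by (simp add: q_def)
      qed
    qed (simp add: q_def)
    show "cmod (hat xs m s - hat xs m t) \<le> q m * (C1 * \<bar>s - t\<bar>)"
    proof (cases "m = 0")
      case False
      show ?thesis
      proof (cases "\<bar>m\<bar> \<le> int J")
        case True
        have "cmod (hat xs m s - hat xs m t) \<le> C1 * \<bar>s - t\<bar>"
          using tl False by (auto simp: hat_def complex_cnj_diff[symmetric] simp del: complex_cnj_diff)
        also have "\<dots> \<le> q m * (C1 * \<bar>s - t\<bar>)"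
          using big[OF True] False C1 mult_right_mono[of 1 "q m" "C1 * \<bar>s - t\<bar>"] by (simp add: q_def)
        finally show ?thesis .
      next
        case big': False
        then show ?thesis using above[OF big'] False R0 tt1[of m] C1 by (simp add: q_def)
      qed
    qed (use C1 in \<open>simp add: q_def\<close>)
    \<comment> \<open>Since \<open>1 + n \<le> 2 ^ n\<close>, the weight is absorbed by one of the
      two factors \<open>(1 / 2) ^ n\<close> of the square; the other sums to at most 2.\<close>
    show "(\<Sum>m\<in>{-K..K} - {0}. (1 + \<bar>real_of_int m\<bar>) * (q m)\<^sup>2) \<le> 2 * R0\<^sup>2"
    proof -
      have "(\<Sum>m\<in>{-K..K} - {0}. (1 + \<bar>real_of_int m\<bar>) * (q m)\<^sup>2) \<le> (\<Sum>m\<in>{-K..K} - {0}. R0\<^sup>2 * (1 / 2) ^ nat \<bar>m\<bar>)"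
      proof (rule sum_mono)
        fix m :: int assume m: "m \<in> {-K..K} - {0}"
        define n where "n = nat \<bar>m\<bar>"
        have n: "\<bar>real_of_int m\<bar> = real n" by (simp add: n_def)
        have "1 + real n \<le> 2 ^ n" by (induction n) auto
        then have "(1 + real n) * ((1 / 2) ^ n * (1 / 2) ^ n) \<le> 2 ^ n * ((1 / 2) ^ n * (1 / 2) ^ n)"
          by (intro mult_right_mono) auto
        also have "\<dots> = (1 / 2 :: real) ^ n" by (simp add: power_mult_distrib[symmetric] mult.assoc[symmetric])
        finally have "(1 + real n) * ((1 / 2) ^ n * (1 / 2) ^ n) \<le> (1 / 2) ^ n" .
        from mult_left_mono[OF this, of "R0\<^sup>2"]
        show "(1 + \<bar>real_of_int m\<bar>) * (q m)\<^sup>2 \<le> R0\<^sup>2 * (1 / 2) ^ nat \<bar>m\<bar>"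
          unfolding n using m by (simp add: q_def tt_def n_def[symmetric] power2_eq_square mult_ac)
      qed
      also have "\<dots> = R0\<^sup>2 * (\<Sum>m\<in>{-K..K} - {0}. (1 / 2) ^ nat \<bar>m\<bar>)" by (simp add: sum_distrib_left)
      also have "\<dots> \<le> R0\<^sup>2 * 2" by (intro mult_left_mono sum_half_powers_le) auto
      finally show ?thesis by simp
    qed
  qed
  have "0 < \<epsilon> / 2" using \<epsilon> by simp
  then obtain A c k where A: "finite A"
    and core: "\<And>L K. k \<le> L \<Longrightarrow>
      (\<Sum>\<kappa>\<in>S.confs L K. S.conf_wgt L \<kappa> *
         (cmod ((\<Sum>i\<in>A. c i * ex (S.conf_pos L \<kappa>) powi (i::int)) * S.conf_tt L \<kappa> - S.conf_fun L \<kappa>))\<^sup>2) \<le> \<epsilon> / 2"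
    by (rule S.trig_poly_approximates_configurations) blast
  define \<sigma> where "\<sigma> = sq_norm J xs"
  have \<sigma>: "0 \<le> \<sigma>" unfolding \<sigma>_def sq_norm_def by (intro sum_nonneg quad_form_nonneg)
  have \<sigma>K: "sq_norm K xs = \<sigma>" if "J \<le> K" for K
    unfolding \<sigma>_def sq_norm_def
    by (rule sum.mono_neutral_right) (use that proj_above[OF J] in \<open>auto simp: quad_form_def\<close>)
  \<comment> \<open>The coordinates are independent of variance 1, so the variance of the truncated
    exponent is a partial geometric sum and converges.\<close>
  define \<tau> where "\<tau> = (\<lambda>K. sq_norm K (cyc_list K))"
  have \<tau>_eq: "\<tau> K = (\<Sum>j<K. ((1 / 4) ^ Suc j))" for K
    unfolding \<tau>_def sq_norm_def
    by (intro sum.cong refl) (simp add: proj_cyc_list quad_form_def cov_def gam_0 power_mult_distrib[symmetric] del: power_Suc)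
  have "summable (\<lambda>j. (1 / 4 :: real) ^ Suc j)" by (intro summable_Suc_iff[THEN iffD2] summable_geometric) auto
  then have "(\<lambda>K. \<Sum>j<K. (1 / 4 :: real) ^ Suc j) \<longlonglongrightarrow> (\<Sum>j. (1 / 4) ^ Suc j)" by (rule summable_LIMSEQ)
  then obtain \<tau>' where \<tau>': "\<tau> \<longlonglongrightarrow> \<tau>'" unfolding \<tau>_eq[symmetric] by blast
  have \<tau>_le: "\<tau> K \<le> \<tau>'" for K
    by (rule incseq_le[OF _ \<tau>']) (auto simp: incseq_def \<tau>_eq intro!: sum_mono2)
  define F where "F = (\<lambda>K w. (\<Sum>i\<in>A. c i * exp (\<tau> K / 2) * cis (lin_comb Y (cyc_list K) (Rk i w))) - exp (\<sigma> / 2) * cis (lin_comb Y xs w))"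
  have FK: "sqn W (F K) \<le> \<epsilon> / 2" if K: "J \<le> K" for K
  proof -
    \<comment> \<open>\<open>None\<close> stands for the target, with coefficient -1, and
      \<open>Some i\<close> for the truncated cyclic exponential moved by \<open>Rk i\<close>; the
      approximation error thus becomes a single combination.\<close>
    define I where "I = insert None (Some ` A)"
    define l where "l = case_option xs (\<lambda>i. shiftW i (cyc_list K))"
    define \<beta> where "\<beta> = case_option (-1) c"
    have Isum: "(\<Sum>\<alpha>\<in>I. f \<alpha>) = f None + (\<Sum>i\<in>A. f (Some i))" for f :: "int option \<Rightarrow> complex"
      unfolding I_def using A by (simp add: sum.reindex)
    have cb: "coords_below K (l \<alpha>)" for \<alpha>
      using coords_below_mono[OF J K] coords_below_cyc_list[of K] by (cases \<alpha>) (auto simp: l_def)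
    have lim: "(\<lambda>L. \<Sum>\<kappa>\<in>PiE {..<N L} (\<lambda>_. {- int K..int K}). (\<Prod>c<N L. if \<kappa> c = 0 then 1 else 1 / (2 * N L))
        * (cmod (\<Sum>\<alpha>\<in>I. \<beta> \<alpha> * (\<Prod>c<N L. hat (l \<alpha>) (\<kappa> c) (a L c))))\<^sup>2)
     \<longlonglongrightarrow> sqn W (\<lambda>w. \<Sum>\<alpha>\<in>I. \<beta> \<alpha> * exp (sq_norm K (l \<alpha>) / 2) * cis (lin_comb Y (l \<alpha>) w))"
      by (rule fock_isometry) (use A cb in \<open>auto simp: I_def\<close>)
    have "sqn W (\<lambda>w. \<Sum>\<alpha>\<in>I. \<beta> \<alpha> * exp (sq_norm K (l \<alpha>) / 2) * cis (lin_comb Y (l \<alpha>) w)) \<le> \<epsilon> / 2"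
    proof (rule tendsto_upperbound[OF lim])
      show "eventually (\<lambda>L. (\<Sum>\<kappa>\<in>PiE {..<N L} (\<lambda>_. {- int K..int K}). (\<Prod>c<N L. if \<kappa> c = 0 then 1 else 1 / (2 * N L))
        * (cmod (\<Sum>\<alpha>\<in>I. \<beta> \<alpha> * (\<Prod>c<N L. hat (l \<alpha>) (\<kappa> c) (a L c))))\<^sup>2) \<le> \<epsilon> / 2) sequentially"
        using eventually_ge_at_top[of k]
      proof eventually_elim
        case (elim L)
        have "(\<Sum>\<alpha>\<in>I. \<beta> \<alpha> * (\<Prod>c<N L. hat (l \<alpha>) (\<kappa> c) (a L c)))
            = (\<Sum>i\<in>A. c i * ex (S.conf_pos L \<kappa>) powi i) * S.conf_tt L \<kappa> - S.conf_fun L \<kappa>"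
          if "\<kappa> \<in> S.confs L K" for \<kappa>
        proof -
          have kb: "\<bar>\<kappa> c\<bar> \<le> int K" if "c < N L" for c
            using \<open>\<kappa> \<in> S.confs L K\<close> that unfolding S.confs_def by (fastforce simp: PiE_iff abs_le_iff)
          have "(\<Prod>c<N L. hat (shiftW i (cyc_list K)) (\<kappa> c) (a L c)) = ex (S.conf_pos L \<kappa>) powi i * S.conf_tt L \<kappa>" for i
          proof -
            have "(\<Prod>c<N L. hat (shiftW i (cyc_list K)) (\<kappa> c) (a L c))
                = (\<Prod>c<N L. ex (of_int i * (of_int (\<kappa> c) * a L c)) * of_real (tt (\<kappa> c)))"
              by (intro prod.cong refl) (simp add: hat_shiftW hat_cyc_list kb tt_def)
            also have "\<dots> = ex (\<Sum>c<N L. of_int i * (of_int (\<kappa> c) * a L c)) * of_real (S.conf_tt L \<kappa>)"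
              by (simp add: prod.distrib ex_sum S.conf_tt_def)
            also have "(\<Sum>c<N L. of_int i * (of_int (\<kappa> c) * a L c)) = of_int i * S.conf_pos L \<kappa>"
              by (simp add: S.conf_pos_def sum_distrib_left)
            also have "ex (of_int i * S.conf_pos L \<kappa>) = ex (S.conf_pos L \<kappa>) powi i"
              by (simp add: ex_def cis_power_int mult_ac)
            finally show ?thesis .
          qed
          then show ?thesis
            unfolding Isum by (simp add: \<beta>_def l_def S.conf_fun_def sum_distrib_right mult.assoc)
        qed
        then show ?case
          using core[OF elim, of "int K"] unfolding S.confs_def S.conf_wgt_def S.wgt_def by simp
      qed
    qed simp
    also have "sqn W (\<lambda>w. \<Sum>\<alpha>\<in>I. \<beta> \<alpha> * exp (sq_norm K (l \<alpha>) / 2) * cis (lin_comb Y (l \<alpha>) w)) = sqn W (F K)"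
    proof -
      have "sq_norm K (shiftW i (cyc_list K)) = \<tau> K" for i
        by (simp add: \<tau>_def sq_norm_def proj_shiftW quad_form_shift del: of_nat_Suc)
      then have "(\<Sum>\<alpha>\<in>I. \<beta> \<alpha> * exp (sq_norm K (l \<alpha>) / 2) * cis (lin_comb Y (l \<alpha>) w)) = F K w" if "w \<in> space W" for w
        unfolding Isum F_def using that by (simp add: \<beta>_def l_def \<sigma>K[OF K] lin_comb_Rk)
      then show ?thesis unfolding sqn_def by (intro Bochner_Integration.integral_cong refl) simp
    qed
    finally show ?thesis .
  qed
  define G where "G = (\<lambda>w. (\<Sum>i\<in>A. c i * exp (\<tau>' / 2) * cyc (Rk i w)) - exp (\<sigma> / 2) * cis (lin_comb Y xs w))"
  have Fm [measurable]: "F K \<in> borel_measurable W" for K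
    unfolding F_def using bdd_meas_compose[OF bdd_meas_exp[OF gen_W] Rk_meas] bdd_meas_exp[OF gen_W, of xs]
    unfolding bdd_meas_def by (intro borel_measurable_diff borel_measurable_sum borel_measurable_times) auto
  have Gm [measurable]: "G \<in> borel_measurable W"
    unfolding G_def using bdd_meas_compose[OF cyc_bdd Rk_meas] bdd_meas_exp[OF gen_W, of xs]
    unfolding bdd_meas_def by (intro borel_measurable_diff borel_measurable_sum borel_measurable_times) auto
  have "(\<lambda>K. sqn W (F K)) \<longlonglongrightarrow> sqn W G"
    unfolding sqn_def
  proof (rule integral_dominated_convergence[where w = "\<lambda>_. ((\<Sum>i\<in>A. cmod (c i) * exp (\<tau>' / 2)) + exp (\<sigma> / 2))\<^sup>2"])
    have "AE w in W. \<forall>i\<in>A. (\<lambda>K. cis (lin_comb Y (cyc_list K) (Rk i w))) \<longlonglongrightarrow> cyc (Rk i w)"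
      using AE_cyc_limit by (intro AE_finite_allI A) auto
    then show "AE w in W. (\<lambda>K. (cmod (F K w))\<^sup>2) \<longlonglongrightarrow> (cmod (G w))\<^sup>2"
    proof eventually_elim
      case (elim w)
      then show ?case unfolding F_def G_def by (intro tendsto_intros \<tau>') auto
    qed
    show "AE w in W. norm ((cmod (F K w))\<^sup>2) \<le> ((\<Sum>i\<in>A. cmod (c i) * exp (\<tau>' / 2)) + exp (\<sigma> / 2))\<^sup>2" for K
    proof (rule AE_I2)
      fix w
      have "cmod (F K w) \<le> cmod (\<Sum>i\<in>A. c i * exp (\<tau> K / 2) * cis (lin_comb Y (cyc_list K) (Rk i w))) + cmod (exp (\<sigma> / 2) * cis (lin_comb Y xs w))"
        unfolding F_def by (rule norm_triangle_ineq4)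
      also have "\<dots> \<le> (\<Sum>i\<in>A. cmod (c i) * exp (\<tau>' / 2)) + exp (\<sigma> / 2)"
      proof (rule add_mono)
        show "cmod (\<Sum>i\<in>A. c i * exp (\<tau> K / 2) * cis (lin_comb Y (cyc_list K) (Rk i w))) \<le> (\<Sum>i\<in>A. cmod (c i) * exp (\<tau>' / 2))"
          by (rule order_trans[OF norm_sum], rule sum_mono) (simp add: norm_mult mult_left_mono \<tau>_le)
      qed (simp add: norm_mult)
      finally show "norm ((cmod (F K w))\<^sup>2) \<le> ((\<Sum>i\<in>A. cmod (c i) * exp (\<tau>' / 2)) + exp (\<sigma> / 2))\<^sup>2"
        by (simp add: power_mono)
    qed
  qed auto
  then have G: "sqn W G \<le> \<epsilon> / 2"
    by (rule tendsto_upperbound) (use FK in \<open>auto simp: eventually_sequentially\<close>)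
  \<comment> \<open>Removes the normalising factor \<open>exp (\<sigma> / 2)\<close> of the target;
    this factor is at least 1, so the error does not grow.\<close>
  define b where "b = (\<lambda>i. complex_of_real (exp (- \<sigma> / 2)) * (c i * exp (\<tau>' / 2)))"
  have "cis (lin_comb Y xs w) - (\<Sum>i\<in>A. b i * cyc (Rk i w)) = (- complex_of_real (exp (- \<sigma> / 2))) * G w" for w
  proof -
    define e e' where "e = complex_of_real (exp (- \<sigma> / 2))" and "e' = complex_of_real (exp (\<sigma> / 2))"
    have e: "e * e' = 1" unfolding e_def e'_def of_real_mult[symmetric] exp_add[symmetric] by simp
    have "- e * G w = (e * e') * cis (lin_comb Y xs w) - (\<Sum>i\<in>A. b i * cyc (Rk i w))"
      unfolding G_def b_def e_def[symmetric] e'_def[symmetric]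
      by (simp add: right_diff_distrib sum_distrib_left mult.assoc sum_negf)
    then show ?thesis unfolding e by (simp add: e_def)
  qed
  then have "sqn W (\<lambda>w. cis (lin_comb Y xs w) - (\<Sum>i\<in>A. b i * cyc (Rk i w))) = (exp (- \<sigma> / 2))\<^sup>2 * sqn W G"
    by (simp only: sqn_scale) simp
  also have "\<dots> \<le> 1 * sqn W G"
    using \<sigma> by (intro mult_right_mono sqn_nonneg) (simp add: power_le_one)
  also have "\<dots> < \<epsilon>" using G \<epsilon> by simp
  finally show thesis by (rule that[OF A])
qed

theorem R_simple_spectrum: "simple_spectrum W R"
proof -
  have "l2_closure W (linear_span (range (\<lambda>k. koopman_power W R k cyc))) = l2_space W"
  proof (rule W.l2_closure_eq_l2_space[OF gen_W])
    show "bdd_meas W h" if "h \<in> linear_span (range (\<lambda>k. koopman_power W R k cyc))" for h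
    proof (rule linear_span_bdd_meas[OF that])
      fix f assume "f \<in> range (\<lambda>k. koopman_power W R k cyc)"
      then obtain k where "f = cyc \<circ> Rk k" by (auto simp: koopman_power_Rk)
      then show "bdd_meas W f" using bdd_meas_compose[OF cyc_bdd Rk_meas] by (simp add: o_def)
    qed
    fix xs and \<epsilon> :: real assume "0 < \<epsilon>"
    then obtain A b where A: "finite A" "sqn W (\<lambda>w. cis (lin_comb Y xs w) - (\<Sum>i\<in>A. b i * cyc (Rk i w))) < \<epsilon>"
      by (rule exponential_approx)
    have "(\<lambda>w. \<Sum>i\<in>A. b i * koopman_power W R i cyc w) \<in> linear_span (range (\<lambda>k. koopman_power W R k cyc))"
      by (rule linear_span_family[OF A(1)])
    then show "\<exists>h\<in>linear_span (range (\<lambda>k. koopman_power W R k cyc)). sqn W (\<lambda>x. cis (lin_comb Y xs x) - h x) < \<epsilon>"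
      using A(2) by (intro bexI) (auto simp: koopman_power_Rk)
  qed (auto intro: linear_span_add linear_span_scale)
  then have "cyclic_vector W R cyc"
    using W.bdd_meas_l2[OF cyc_bdd] by (simp add: cyclic_vector_def)
  then show ?thesis using R_invertible by (auto simp: simple_spectrum_def)
qed

end

section \<open>Realisation on the real line\<close>

text \<open>The Gaussian sequence lives on \<open>int \<Rightarrow> real\<close>; only an injection into the reals is needed, with no
  measurability, because both the \<open>\<sigma>\<close>-algebra and the topology are transported along it.\<close>

lemma ex_inj_int_fun_real: "\<exists>\<iota> :: (int \<Rightarrow> real) \<Rightarrow> real. inj \<iota>"
proof -
  obtain f :: "real \<Rightarrow> nat set" where f: "inj f"
    using eqpoll_sym[OF nat_sets_eqpoll_reals] unfolding eqpoll_def bij_betw_def by blast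
  obtain g :: "nat set \<Rightarrow> real" where g: "inj g"
    using nat_sets_eqpoll_reals unfolding eqpoll_def bij_betw_def by blast
  define \<iota> where "\<iota> = (\<lambda>x :: int \<Rightarrow> real. g {m. snd (prod_decode m) \<in> f (x (int_decode (fst (prod_decode m))))})"
  have "inj \<iota>"
  proof (rule injI)
    fix x x' assume "\<iota> x = \<iota> x'"
    then have eq: "{m. snd (prod_decode m) \<in> f (x (int_decode (fst (prod_decode m))))}
       = {m. snd (prod_decode m) \<in> f (x' (int_decode (fst (prod_decode m))))}"
      unfolding \<iota>_def using injD[OF g] by blast
    show "x = x'"
    proof
      fix n
      have "k \<in> f (x n) \<longleftrightarrow> k \<in> f (x' n)" for k
        using eq[unfolded set_eq_iff, rule_format, of "prod_encode (int_encode n, k)"] by simp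
      then have "f (x n) = f (x' n)" by blast
      then show "x n = x' n" by (rule injD[OF f])
    qed
  qed
  then show ?thesis by blast
qed

lemma second_countable_topology_euclidean:
  "second_countable (euclidean :: 'a :: second_countable_topology topology)"
proof -
  obtain B :: "'a set set" where B: "countable B" "topological_basis B"
    using ex_countable_basis by blast
  then show ?thesis
    unfolding second_countable_def open_openin[symmetric]
    by (meson topological_basisE topological_basis_open)
qed

text \<open>Transporting the Polish topology along \<open>f\<close> makes \<open>f\<close> a
  homeomorphism onto its range, and the Borel sets there are exactly the images of Borel
  sets.\<close>

lemma standard_borel_space_embed_measure:
  fixes M :: "'a :: polish_space measure"
  assumes inj: "inj f" and M: "sets M = sets borel"
  shows "standard_borel_space (embed_measure M f)"
proof -
  have spM: "space M = UNIV" using sets_eq_imp_space_eq[OF M] by simp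
  define X where "X = pullback_topology (range f) (inv f) (euclidean :: 'a topology)"
  have openX: "openin X U \<longleftrightarrow> (\<exists>V. open V \<and> U = f ` V)" for U
  proof -
    have "inv f -` V \<inter> range f = f ` V" for V using inj by auto
    then show ?thesis unfolding X_def openin_pullback_topology by auto
  qed
  have cont1: "continuous_map X euclidean (inv f)"
    using continuous_map_pullback[of euclidean euclidean id "range f" "inv f"] by (simp add: X_def)
  have cont2: "continuous_map euclidean X f"
    unfolding X_def by (rule continuous_map_pullback') (use inj in \<open>auto simp: o_def\<close>)
  have "homeomorphic_maps X euclidean (inv f) f"
    unfolding homeomorphic_maps_def using cont1 cont2 inj
    by (auto simp: X_def topspace_pullback_topology)
  then have hom: "X homeomorphic_space (euclidean :: 'a topology)"
    unfolding homeomorphic_space_def by blast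
  have "completely_metrizable_space X"
    using homeomorphic_completely_metrizable_space[OF hom] completely_metrizable_space_euclidean by blast
  moreover have "second_countable X"
    using homeomorphic_space_second_countability[OF hom] second_countable_topology_euclidean by blast
  moreover have top: "topspace X = space (embed_measure M f)"
    by (auto simp: X_def topspace_pullback_topology space_embed_measure spM)
  moreover have "sets (embed_measure M f) = sigma_sets (space (embed_measure M f)) {U. openin X U}"
  proof
    have "f ` B \<in> sigma_sets (range f) {U. openin X U}" if "B \<in> sigma_sets UNIV {V :: 'a set. open V}" for B
      using that
    proof induction
      case (Basic V)
      then show ?case by (intro sigma_sets.Basic) (auto simp: openX)
    next
      case Empty
      then show ?case by (simp add: sigma_sets.Empty)
    next
      case (Compl B)
      have "f ` (UNIV - B) = range f - f ` B" using inj by (simp add: image_set_diff)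
      then show ?case using sigma_sets.Compl[OF Compl.IH] by simp
    next
      case (Union B)
      then show ?case unfolding image_UN by (intro sigma_sets.Union)
    qed
    then show "sets (embed_measure M f) \<subseteq> sigma_sets (space (embed_measure M f)) {U. openin X U}"
      using M inj by (auto simp: sets_embed_measure space_embed_measure spM sets_borel)
    have "{U. openin X U} \<subseteq> sets (embed_measure M f)"
      using M inj by (auto simp: openX sets_embed_measure)
    then show "sigma_sets (space (embed_measure M f)) {U. openin X U} \<subseteq> sets (embed_measure M f)"
      by (rule sets.sigma_sets_subset)
  qed
  ultimately show ?thesis unfolding standard_borel_space_def by blast
qed

text \<open>A carrier type has to be named; the space is the range of an injection into
  \<open>real\<close>, not the whole line.\<close>

theorem mainTheorem1:
  shows "\<exists>(M :: real measure) T.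
    standard_prob_space M \<and> nonatomic M \<and>
    invertible_mpt M T \<and> mixing M T \<and>
    simple_spectrum (countable_power M) (product_of_powers T)"
proof -
  obtain N mult d a where "cells N mult d a" using cells_exist by blast
  then interpret cells N mult d a .
  obtain M0 :: "(int \<Rightarrow> real) measure" where M0: "prob_space M0" "sets M0 = sets (PiM UNIV (\<lambda>_. borel))"
    "\<And>xs. (\<integral>w. cis (lin_comb (\<lambda>n w. w n) xs w) \<partial>M0) = exp (- quad_form cov xs / 2)"
    by (rule gaussian_process_exists[OF cov_sym quad_form_nonneg]) blast
  obtain \<iota> :: "(int \<Rightarrow> real) \<Rightarrow> real" where \<iota>: "inj \<iota>" using ex_inj_int_fun_real by blast
  define M where "M = embed_measure M0 \<iota>"
  define y where "y = (\<lambda>(n :: int) z. inv \<iota> z n)"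
  define T where "T = (\<lambda>z. \<iota> (\<lambda>n. inv \<iota> z (n + 1)))"
  have spM0: "space M0 = UNIV" using sets_eq_imp_space_eq[OF M0(2)] by (simp add: space_PiM)
  have spM: "space M = range \<iota>" by (simp add: M_def space_embed_measure spM0)
  have M_distr: "M = distr M0 M \<iota>" unfolding M_def by (rule embed_measure_eq_distr[OF \<iota>])
  have \<iota>_meas: "\<iota> \<in> measurable M0 M" unfolding M_def by (rule measurable_embed_measure2[OF \<iota>])
  have y\<iota>: "y n (\<iota> x) = x n" for n x by (simp add: y_def \<iota>)
  have y_meas: "y n \<in> borel_measurable M" for n
    unfolding M_def
  proof (rule measurable_embed_measure1)
    have "(\<lambda>x. x n) \<in> borel_measurable (PiM UNIV (\<lambda>_::int. borel :: real measure))" by measurable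
    then show "(\<lambda>x. y n (\<iota> x)) \<in> borel_measurable M0"
      unfolding y\<iota> using measurable_cong_sets[OF M0(2) refl] by blast
  qed
  interpret prob_space M
    by (subst M_distr) (rule prob_space.prob_space_distr[OF M0(1) \<iota>_meas])
  interpret gaussian_system N mult d a M y T
  proof
    show "generated_by M y"
      unfolding generated_by_def
    proof (intro conjI allI impI y_meas)
      fix N' :: "real measure" assume sp: "space N' = space M" and ym: "\<forall>n. y n \<in> borel_measurable N'"
      have "(\<lambda>z n. y n z) \<in> measurable N' (PiM UNIV (\<lambda>_. borel))"
        by (rule measurable_PiM_single') (use ym in auto)
      then have inv: "inv \<iota> \<in> measurable N' (PiM UNIV (\<lambda>_. borel))" by (simp add: y_def)
      show "sets M \<subseteq> sets N'"
      proof
        fix A assume "A \<in> sets M"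
        then obtain B where B: "A = \<iota> ` B" "B \<in> sets M0"
          unfolding M_def sets_embed_measure[OF \<iota>] by blast
        have "inv \<iota> -` B \<inter> space N' = A" using \<iota> by (auto simp: sp spM B(1))
        then show "A \<in> sets N'" using measurable_sets[OF inv, of B] B(2) M0(2) by simp
      qed
    qed
    show "bij_betw T (space M) (space M)"
      unfolding spM
    proof (rule bij_betw_byWitness[where f' = "\<lambda>z. \<iota> (\<lambda>n. inv \<iota> z (n - 1))"])
    qed (auto simp: T_def \<iota>)
    show "y n (T z) = y (n + 1) z" if "z \<in> space M" for z n
      by (simp add: y_def T_def \<iota>)
    show "(\<integral>z. cis (lin_comb y xs z) \<partial>M) = exp (- quad_form cov xs / 2)" for xs
    proof -
      have "(\<integral>z. cis (lin_comb y xs z) \<partial>M) = (\<integral>z. cis (lin_comb y xs z) \<partial>distr M0 M \<iota>)"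
        using M_distr by simp
      also have "\<dots> = (\<integral>x. cis (lin_comb y xs (\<iota> x)) \<partial>M0)"
        by (rule integral_distr[OF \<iota>_meas borel_measurable_cis_lin_comb[OF y_meas]])
      also have "\<dots> = (\<integral>x. cis (lin_comb (\<lambda>n w. w n) xs x) \<partial>M0)"
        by (simp add: lin_comb_def y\<iota>)
      finally show ?thesis by (simp add: M0(3))
    qed
  qed
  \<comment> \<open>On a countable product of real lines the product \<sigma>-algebra is the Borel
    one, and the product topology is Polish.\<close>
  have "sets M0 = sets borel" using M0(2) by (simp add: sets_PiM_equal_borel)
  then have "standard_borel_space M" unfolding M_def by (rule standard_borel_space_embed_measure[OF \<iota>])
  then have "standard_prob_space M" by (simp add: standard_prob_space_def prob_space_axioms)
  then show ?thesis
    using M_nonatomic T_invertible T_mixing R_simple_spectrum by blast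
qed

end
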